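(* Let $d\in\mathbb{N}$, and let $I_n$ be the truncated Faber-Schauder series operator. (i) For every (small) $\varepsilon>0$ there is a constant $C_\varepsilon>0$ such that for all $n\in\mathbb{N}$ and all $f\in S^1_{1,\infty}F([0,1]^d)$ $$\|f-I_nf\|_{L_1([0,1]^d)}\le C_\varepsilon\,2^{-n(1-\varepsilon)}\,\|f|S^1_{1,\infty}F([0,1]^d)\|.$$ (ii) For every $1<q<\infty$ there is a constant $C>0$ such that for all $n\in\mathbb{N}$ and all $f\in S^1_{1,\infty}F([0,1]^d)$ $$\|f-I_nf\|_{L_q([0,1]^d)}\le C\,2^{-n/q}\,n^{(d-1)/q}\,\|f|S^1_{1,\infty}F([0,1]^d)\|.$$
   Context: Notation: $\mathbb{N}=\{1,2,\dots\}$, $\mathbb{N}_0=\mathbb{N}\cup\{0\}$, $\mathbb{N}_{-1}=\mathbb{N}_0\cup\{-1\}$, $a_+=\max\{a,0\}$, $|x|_1=\sum_i|x_i|$. Function spaces. Let $\mathcal{F}$ be the Fourier transform on $\mathbb{R}^d$, $\mathcal{F}f(\xi)=(2\pi)^{-d/2}\int_{\mathbb{R}^d}f(x)e^{-i\xi\cdot x}dx$. Fix a system $\varphi=\{\varphi_n\}_{n=0}^\infty\subset C_0^\infty(\mathbb{R})$ with (i) $\operatorname{supp}\varphi_0\subset\{|x|\le 2\}$; (ii) $\operatorname{supp}\varphi_n\subset\{2^{n-1}\le|x|\le 2^{n+1}\}$ for $n\ge1$; (iii) for every $\ell\in\mathbb{N}_0$, $\sup_{x,n}2^{n\ell}|D^\ell\varphi_n(x)|<\infty$;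 (iv) $\sum_{n=0}^\infty\varphi_n(x)=1$ for all $x\in\mathbb{R}$. For $f\in L_1(\mathbb{R}^d)$ and $\ell\in\mathbb{N}_0^d$ put $f_\ell=\mathcal{F}^{-1}[\varphi_{\ell_1}(\xi_1)\cdots\varphi_{\ell_d}(\xi_d)\mathcal{F}f(\xi)]$. For $0<p<\infty$, $0<q\le\infty$ and $r>(1/p-1)_+$, $S^r_{p,q}F(\mathbb{R}^d)$ is the set of all $f\in L_1(\mathbb{R}^d)$ with $\|f|S^r_{p,q}F(\mathbb{R}^d)\|=\big\|\big(\sum_{j\in\mathbb{N}_0^d}2^{|j|_1rq}|f_j(x)|^q\big)^{1/q}\big\|_p<\infty$; in particular for $r=p=1$, $q=\infty$ the norm is $\big\|\sup_{j\in\mathbb{N}_0^d}2^{|j|_1}|f_j(x)|\big\|_1$. The space $S^r_{p,q}F([0,1]^d)$ consists of all $f\in L_1([0,1]^d)$ that are restrictions to $[0,1]^d$ of some $g\in S^r_{p,q}F(\mathbb{R}^d)$, with $\|f|S^r_{p,q}F([0,1]^d)\|$ the infimum of $\|g|S^r_{p,q}F(\mathbb{R}^d)\|$ over all such $g$. Elements of $S^1_{1,\infty}F([0,1]^d)$ are identified with their continuous representatives (this space embeds into $C([0,1]^d)$). Faber-Schauder system on $[0,1]^d$. Let $v:\mathbb{R}\to\mathbb{R}$ be the hat function supported on $[0,1]$, $v(x)=2x$ on $[0,1/2]$, $v(x)=2(1-x)$ on $[1/2,1]$, and $0$ otherwise. For $j\in\mathbb{N}_0$ put $\mathbb{D}_j=\{0,1,\dots,2^j-1\}$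 and $v_{j,k}(x)=v(2^jx-k)$; for $j=-1$ put $\mathbb{D}_{-1}=\{0,1\}$, $v_{-1,0}(x)=1-x$, $v_{-1,1}(x)=x$. For $j\in\mathbb{N}_{-1}^d$ put $\mathbb{D}_j=\mathbb{D}_{j_1}\times\cdots\times\mathbb{D}_{j_d}$ and $v_{j,k}(x)=\prod_{i=1}^dv_{j_i,k_i}(x_i)$. For $f\in C([0,1]^d)$, $j\in\mathbb{N}_{-1}^d$, $k\in\mathbb{D}_j$ let $e(j)=\{i:j_i\ne-1\}$, $x_{j,k}=(2^{-(j_1)_+}k_1,\dots,2^{-(j_d)_+}k_d)$ and $$d^2_{j,k}(f)=(-2)^{-|e(j)|}\Big(\prod_{i\in e(j)}\Delta^{2,i}_{2^{-(j_i+1)}}\Big)f(x_{j,k}),$$ where $|e(j)|$ is the cardinality of $e(j)$ and $\Delta^{2,i}_hf(x)=f(x+2he_i)-2f(x+he_i)+f(x)$, with $e_i$ the $i$-th unit vector. The truncated Faber-Schauder series is $$I_nf=\sum_{j\in\mathbb{N}_{-1}^d,\ |j|_1\le n}\ \sum_{k\in\mathbb{D}_j}d^2_{j,k}(f)\,v_{j,k}.$$ *)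

theory Defs
  imports "HOL-Analysis.Analysis"
begin

definition fourier :: "(real^'d \<Rightarrow> complex) \<Rightarrow> real^'d \<Rightarrow> complex" where
  "fourier f \<xi> =
     of_real ((2 * pi) powr (- real CARD('d) / 2)) * (LINT x|lebesgue. f x * cis (- (\<xi> \<bullet> x)))"

definition inv_fourier :: "(real^'d \<Rightarrow> complex) \<Rightarrow> real^'d \<Rightarrow> complex" where
  "inv_fourier g x =
     of_real ((2 * pi) powr (- real CARD('d) / 2)) * (LINT \<xi>|lebesgue. g \<xi> * cis (x \<bullet> \<xi>))"

definition nth_vector_deriv :: "nat \<Rightarrow> (real \<Rightarrow> complex) \<Rightarrow> real \<Rightarrow> complex" where
  "nth_vector_deriv l g = ((\<lambda>h x. vector_derivative h (at x)) ^^ l) g"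

definition supp :: "(real \<Rightarrow> complex) \<Rightarrow> real set" where
  "supp g = closure {x. g x \<noteq> 0}"

definition test_function :: "(real \<Rightarrow> complex) \<Rightarrow> bool" where
  "test_function g \<longleftrightarrow>
     (\<forall>l x. nth_vector_deriv l g differentiable (at x)) \<and> compact (supp g)"

definition dyadic_system :: "(nat \<Rightarrow> real \<Rightarrow> complex) \<Rightarrow> bool" where
  "dyadic_system \<phi> \<longleftrightarrow>
     (\<forall>n. test_function (\<phi> n)) \<and>
     supp (\<phi> 0) \<subseteq> {x. \<bar>x\<bar> \<le> 2} \<and>
     (\<forall>n\<ge>1. supp (\<phi> n) \<subseteq> {x. 2 ^ (n - 1) \<le> \<bar>x\<bar> \<and> \<bar>x\<bar> \<le> 2 ^ (n + 1)}) \<and>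
     (\<forall>l. \<exists>B. \<forall>n x. 2 ^ (n * l) * norm (nth_vector_deriv l (\<phi> n) x) \<le> B) \<and>
     (\<forall>x. (\<lambda>n. \<phi> n x) sums 1)"

definition lp_block ::
  "(nat \<Rightarrow> real \<Rightarrow> complex) \<Rightarrow> (real^'d \<Rightarrow> complex) \<Rightarrow> nat^'d \<Rightarrow> real^'d \<Rightarrow> complex" where
  "lp_block \<phi> f l = inv_fourier (\<lambda>\<xi>. (\<Prod>i\<in>UNIV. \<phi> (l $ i) (\<xi> $ i)) * fourier f \<xi>)"

text \<open>The case \<open>r = p = 1\<close>, \<open>q = \<infinity>\<close> of the spaces \<open>S\<^sup>r\<^sub>p\<^sub>,\<^sub>q F\<close>: the
  inner \<open>\<ell>\<^sub>q\<close> norm is a supremum.\<close>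

definition SF_norm ::
  "(nat \<Rightarrow> real \<Rightarrow> complex) \<Rightarrow> (real^'d \<Rightarrow> complex) \<Rightarrow> ennreal" where
  "SF_norm \<phi> f =
     (\<integral>\<^sup>+x. (SUP j. ennreal (2 ^ (\<Sum>i\<in>UNIV. j $ i) * norm (lp_block \<phi> f j x))) \<partial>lebesgue)"

definition SF_space :: "(nat \<Rightarrow> real \<Rightarrow> complex) \<Rightarrow> (real^'d \<Rightarrow> complex) set" where
  "SF_space \<phi> = {f. integrable lebesgue f \<and> SF_norm \<phi> f < \<infinity>}"

abbreviation unit_cube :: "(real^'d) set" where
  "unit_cube \<equiv> cbox 0 1"

text \<open>Elements of \<open>L\<^sub>1\<close> are represented by functions, so that being a restriction means
  agreeing almost everywhere on the cube.\<close>

definition SF_extensions ::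
  "(nat \<Rightarrow> real \<Rightarrow> complex) \<Rightarrow> (real^'d \<Rightarrow> complex) \<Rightarrow> (real^'d \<Rightarrow> complex) set" where
  "SF_extensions \<phi> f =
     {g \<in> SF_space \<phi>. AE x in lebesgue. x \<in> unit_cube \<longrightarrow> g x = f x}"

text \<open>The members of the space on the cube are the continuous representatives of the classes in
  \<open>L\<^sub>1\<close>; the values of \<open>f\<close> outside the cube are irrelevant.\<close>

definition SF_cube :: "(nat \<Rightarrow> real \<Rightarrow> complex) \<Rightarrow> (real^'d \<Rightarrow> complex) set" where
  "SF_cube \<phi> =
     {f. f absolutely_integrable_on unit_cube \<and> SF_extensions \<phi> f \<noteq> {} \<and>
         continuous_on unit_cube f}"

definition SF_cube_norm ::
  "(nat \<Rightarrow> real \<Rightarrow> complex) \<Rightarrow> (real^'d \<Rightarrow> complex) \<Rightarrow> ennreal" where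
  "SF_cube_norm \<phi> f = (INF g\<in>SF_extensions \<phi> f. SF_norm \<phi> g)"

definition Lq_norm_cube :: "real \<Rightarrow> (real^'d \<Rightarrow> complex) \<Rightarrow> real" where
  "Lq_norm_cube q h = (LINT x:unit_cube|lebesgue. norm (h x) powr q) powr (1 / q)"

definition hat :: "real \<Rightarrow> real" where
  "hat x = (if 0 \<le> x \<and> x \<le> 1/2 then 2 * x
            else if 1/2 \<le> x \<and> x \<le> 1 then 2 * (1 - x) else 0)"

text \<open>Levels \<open>j \<ge> -1\<close> are integers; the functions below are only used for such \<open>j\<close>.\<close>

definition faber_idx1 :: "int \<Rightarrow> nat set" where
  "faber_idx1 j = (if j = -1 then {0, 1} else {0..<2 ^ nat j})"

definition faber1 :: "int \<Rightarrow> nat \<Rightarrow> real \<Rightarrow> real" where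
  "faber1 j k x =
     (if j = -1 then (if k = 0 then 1 - x else x) else hat (2 ^ nat j * x - real k))"

definition faber_idx :: "int^'d \<Rightarrow> (nat^'d) set" where
  "faber_idx j = {k. \<forall>i. k $ i \<in> faber_idx1 (j $ i)}"

definition faber :: "int^'d \<Rightarrow> nat^'d \<Rightarrow> real^'d \<Rightarrow> real" where
  "faber j k x = (\<Prod>i\<in>UNIV. faber1 (j $ i) (k $ i) (x $ i))"

definition active :: "int^'d \<Rightarrow> 'd set" where
  "active j = {i. j $ i \<noteq> -1}"

definition faber_node :: "int^'d \<Rightarrow> nat^'d \<Rightarrow> real^'d" where
  "faber_node j k = (\<chi> i. 2 powi (- max (j $ i) 0) * real (k $ i))"

definition diff2 :: "'d \<Rightarrow> real \<Rightarrow> (real^'d \<Rightarrow> complex) \<Rightarrow> real^'d \<Rightarrow> complex" where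
  "diff2 i h f x = f (x + (2 * h) *\<^sub>R axis i 1) - 2 * f (x + h *\<^sub>R axis i 1) + f x"

text \<open>The product of the difference operators is their composition, formed by \<open>Finite_Set.fold\<close>.
  This is well defined because the operators commute.\<close>

lemma comp_fun_commute_diff2: "comp_fun_commute (\<lambda>i. diff2 i (h i))"
  by standard (simp add: fun_eq_iff diff2_def algebra_simps)

definition faber_coeff :: "int^'d \<Rightarrow> nat^'d \<Rightarrow> (real^'d \<Rightarrow> complex) \<Rightarrow> complex" where
  "faber_coeff j k f =
     (-2) powi (- int (card (active j))) *
     Finite_Set.fold (\<lambda>i. diff2 i (2 powi (- (j $ i + 1)))) f (active j) (faber_node j k)"

text \<open>The order \<open>|j|\<^sub>1\<close> is the sum of absolute values, so that a component \<open>-1\<close>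
  contributes \<open>1\<close>.\<close>

definition faber_levels :: "nat \<Rightarrow> (int^'d) set" where
  "faber_levels n = {j. (\<forall>i. j $ i \<ge> -1) \<and> (\<Sum>i\<in>UNIV. \<bar>j $ i\<bar>) \<le> int n}"

definition faber_trunc :: "nat \<Rightarrow> (real^'d \<Rightarrow> complex) \<Rightarrow> real^'d \<Rightarrow> complex" where
  "faber_trunc n f x =
     (\<Sum>j\<in>faber_levels n. \<Sum>k\<in>faber_idx j. faber_coeff j k f * of_real (faber j k x))"

text \<open>The index sets are finite, so these sums are never degenerate.\<close>

lemma finite_vec_components:
  fixes A :: "'d::finite \<Rightarrow> 'a set"
  assumes "\<And>i. finite (A i)"
  shows "finite {k :: 'a^'d. \<forall>i. k $ i \<in> A i}"
proof -
  have "finite (vec_lambda ` Pi\<^sub>E UNIV A)"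
    by (intro finite_imageI finite_PiE) (use assms in auto)
  moreover have "{k :: 'a^'d. \<forall>i. k $ i \<in> A i} \<subseteq> vec_lambda ` Pi\<^sub>E UNIV A"
  proof
    fix k :: "'a^'d" assume "k \<in> {k. \<forall>i. k $ i \<in> A i}"
    then have "vec_nth k \<in> Pi\<^sub>E UNIV A" by auto
    then show "k \<in> vec_lambda ` Pi\<^sub>E UNIV A"
      by (metis image_eqI vec_nth_inverse)
  qed
  ultimately show ?thesis by (rule finite_subset[rotated])
qed

lemma finite_faber_idx: "finite (faber_idx j)"
  unfolding faber_idx_def by (rule finite_vec_components) (simp add: faber_idx1_def)

lemma finite_faber_levels: "finite (faber_levels n :: (int^'d) set)"
proof (rule finite_subset)
  show "(faber_levels n :: (int^'d) set) \<subseteq> {j. \<forall>i. j $ i \<in> {- int n..int n}}"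
  proof
    fix j :: "int^'d" assume j: "j \<in> faber_levels n"
    have "\<bar>j $ i\<bar> \<le> int n" for i
    proof -
      have "\<bar>j $ i\<bar> \<le> (\<Sum>i\<in>UNIV. \<bar>j $ i\<bar>)"
        by (rule member_le_sum) auto
      with j show ?thesis by (simp add: faber_levels_def)
    qed
    then show "j \<in> {j. \<forall>i. j $ i \<in> {- int n..int n}}"
      by (simp add: abs_le_iff minus_le_iff)
  qed
qed (rule finite_vec_components, simp)

end

(* Write a function on the cube as the restriction of g and let h be the supremum over l of
   2^|l| |g_l|, whose integral is the norm. The Faber coefficients satisfy the borderline estimate
   sum_k |d_{j,k}(f)| <= C int h, uniformly in the level j. Indeed every block g_l reproduces itself
   under a rapidly decaying kernel, and a sub-mean-value inequality with exponent 1/2 bounds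
   |g_l(x)| by the integral of h against the product of kappa(2^{l_i} (x_i - y_i)), where
   kappa(t) = sqrt|t| / (1 + t^2). Since kappa vanishes at 0, the sum of kappa(2^l t)
     over all scales
   l is bounded, and scales coarser than the mesh gain from the second difference.

   The error f - I_n f is the sum of d_{j,k}(f) v_{j,k} over |j| > n, and |v_{j,k}| is at most the
   indicator of a dyadic box. Expanding the b-th power of this sum
     for integer b, a product of b boxes
   has volume at most a constant times 2^-|m|, where m is the coordinatewise maximum of the levels;
   there are at most C (|m| - n)^{db} tuples below m, so the b-th moment is at most a constant
   times 2^-n n^(d-1). Real exponents q follow from x^q <= x + x^b. *)

theory Submission
  imports Defs "HOL-Probability.Probability"
begin

section \<open>Dyadic sums in one variable\<close>

text \<open>The obstacle is that no summability in the scale is left. The norm controls only the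
  supremum h, and at smoothness r = 1/p = 1 the weight 2^|l| is entirely spent on normalising the
  kernel of g_l. An ordinary integrable bump would contribute about h(y) at y = x for every scale,
  so the sum over l would diverge; hence a kernel that is zero there. The exponent 1/2 in
  \<open>kappa\<close> is one choice strictly between 0 and 1: positive, so that the sum over fine
  scales converges; less than 1, so that the reciprocal weight 1/sqrt|t| is locally integrable and
  \<open>kappa\<close> can be summed over the nodes of a mesh.

  A second difficulty is that f is continuous only on the closed cube and agrees with g only almost
  everywhere, while the coefficients use point values, also on the boundary. The bound is therefore
  proved for finite sums of blocks at translated and contracted nodes, averaged against Gaussians,
  and only then passed to the limit.\<close>

definition kappa :: "real \<Rightarrow> real" where
  "kappa t = sqrt \<bar>t\<bar> / (1 + t\<^sup>2)"

lemma kappa_nonneg: "0 \<le> kappa t"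
  by (simp add: kappa_def)

text \<open>In the variable s = sqrt|t| the majorant s/(1+s)^4 is, up to a factor, s times the
  derivative of -1/(1+s)^3, and this telescopes over dyadic scales. The 8 comes from (1+s)^2 \<le>
  2(1+s^2), applied to s and then to s^2.\<close>

lemma kappa_le: "kappa t \<le> 8 * (sqrt \<bar>t\<bar> / (1 + sqrt \<bar>t\<bar>) ^ 4)"
proof -
  define s where "s = sqrt \<bar>t\<bar>"
  have s: "s \<ge> 0" and s2: "s\<^sup>2 = \<bar>t\<bar>"
    by (simp_all add: s_def)
  have t2: "t\<^sup>2 = s ^ 4"
    using arg_cong[OF s2, of "\<lambda>x. x\<^sup>2"] by simp
  have sq: "(1 + s)\<^sup>2 \<le> 2 * (1 + s\<^sup>2)" for s :: real
    using zero_le_power2[of "1 - s"] by (simp add: power2_eq_square algebra_simps)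
  have "(1 + s) ^ 4 = ((1 + s)\<^sup>2)\<^sup>2" by simp
  also have "\<dots> \<le> (2 * (1 + s\<^sup>2))\<^sup>2"
    by (intro power_mono sq) auto
  also have "\<dots> = 4 * (1 + s\<^sup>2)\<^sup>2" by (simp only: power_mult_distrib) simp
  also have "\<dots> \<le> 4 * (2 * (1 + (s\<^sup>2)\<^sup>2))" by (intro mult_left_mono sq) auto
  finally have "(1 + s) ^ 4 \<le> 8 * (1 + s ^ 4)" by simp
  then have "s / (1 + s ^ 4) \<le> 8 * (s / (1 + s) ^ 4)"
    using s mult_left_mono[of "(1 + s) ^ 4" "8 * (1 + s ^ 4)" s]
    by (simp add: divide_simps add_pos_nonneg mult_ac)
  then show ?thesis by (simp add: kappa_def t2 flip: s_def)
qed

lemma sqrt2_bounds: "sqrt 2 \<ge> 1.4" "sqrt 2 \<le> 1.42"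
proof -
  show "sqrt 2 \<ge> 1.4" by (rule real_le_rsqrt) (simp add: power2_eq_square)
  show "sqrt 2 \<le> 1.42" by (rule real_le_lsqrt) (simp_all add: power2_eq_square)
qed

text \<open>Doubling t multiplies x = sqrt|t| by sqrt 2, so one dyadic term is bounded by a
  difference of consecutive values of 3/(1+x)^3. The constants: sqrt 2 \<ge> 1.4 gives q - p \<ge>
  0.4 x, and 1.42^3 < 3 gives q^3 \<le> 3 p^3.\<close>

lemma dyadic_telescope_step:
  fixes x :: real
  assumes "x \<ge> 0"
  shows "x / (1 + x) ^ 4 \<le> 3 * (1 / (1 + x) ^ 3 - 1 / (1 + sqrt 2 * x) ^ 3)"
proof -
  define b where "b = sqrt 2"
  have b: "b \<ge> 1.4" "b \<le> 1.42" using sqrt2_bounds by (auto simp: b_def)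
  define p q where "p = 1 + x" and "q = 1 + b * x"
  have p: "p \<ge> 1" and pq: "p \<le> q" and qp: "q \<le> b * p"
    using assms b mult_right_mono[of 1 b x] by (auto simp: p_def q_def algebra_simps)
  have d: "q - p \<ge> 0.4 * x"
    using mult_right_mono[of "0.4" "b - 1" x] assms b by (simp add: p_def q_def algebra_simps)
  have "q ^ 3 - p ^ 3 = (q - p) * (q\<^sup>2 + q * p + p\<^sup>2)"
    by (simp add: power2_eq_square power3_eq_cube algebra_simps)
  also have "\<dots> \<ge> (0.4 * x) * (3 * p\<^sup>2)"
  proof (intro mult_mono d)
    have "p\<^sup>2 \<le> q\<^sup>2" "p\<^sup>2 \<le> q * p"
      using p pq by (auto simp: power2_eq_square intro!: mult_mono)
    then show "3 * p\<^sup>2 \<le> q\<^sup>2 + q * p + p\<^sup>2" by simp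
  qed (use assms p pq in auto)
  finally have "1.2 * x * p\<^sup>2 \<le> q ^ 3 - p ^ 3" by simp
  moreover have "q ^ 3 \<le> 3 * p ^ 3"
  proof -
    have "q ^ 3 \<le> (b * p) ^ 3" using p pq qp by (intro power_mono) auto
    also have "\<dots> \<le> 3 * p ^ 3"
      using power_mono[of b "1.42" 3] b p by (simp add: power_mult_distrib power3_eq_cube)
    finally show ?thesis .
  qed
  ultimately have "x * q ^ 3 \<le> 3 * (q ^ 3 - p ^ 3) * p"
  proof -
    assume a: "1.2 * x * p\<^sup>2 \<le> q ^ 3 - p ^ 3" and c: "q ^ 3 \<le> 3 * p ^ 3"
    have "x * q ^ 3 \<le> x * (3 * p ^ 3)" using assms c by (intro mult_left_mono) auto
    also have "\<dots> = (3 * x * p\<^sup>2) * p" by (simp add: power2_eq_square power3_eq_cube)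
    also have "\<dots> \<le> (3 * (1.2 * x * p\<^sup>2)) * p" using assms p by (intro mult_right_mono) auto
    also have "\<dots> \<le> (3 * (q ^ 3 - p ^ 3)) * p" using a p by (intro mult_right_mono) auto
    finally show ?thesis .
  qed
  then have "x / p ^ 4 \<le> 3 * (1 / p ^ 3 - 1 / q ^ 3)"
    using p pq by (simp add: divide_simps power4_eq_xxxx power3_eq_cube algebra_simps)
  then show ?thesis by (simp add: p_def q_def b_def)
qed

lemma dyadic_sum_ge:
  fixes z :: real
  assumes "z \<ge> 0"
  shows "(\<Sum>i<M. sqrt 2 ^ i * z / (1 + sqrt 2 ^ i * z) ^ 4) \<le> 3 / (1 + z) ^ 3"
proof -
  define f where "f i = 3 / (1 + sqrt 2 ^ i * z) ^ 3" for i
  have "(\<Sum>i<M. sqrt 2 ^ i * z / (1 + sqrt 2 ^ i * z) ^ 4) \<le> (\<Sum>i<M. f i - f (Suc i))"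
  proof (intro sum_mono)
    fix i
    show "sqrt 2 ^ i * z / (1 + sqrt 2 ^ i * z) ^ 4 \<le> f i - f (Suc i)"
      using dyadic_telescope_step[of "sqrt 2 ^ i * z"] assms
      by (simp add: f_def mult_ac right_diff_distrib)
  qed
  also have "\<dots> = f 0 - f M" by (rule sum_lessThan_telescope')
  also have "\<dots> \<le> f 0" using assms by (simp add: f_def)
  finally show ?thesis by (simp add: f_def)
qed

text \<open>What a second difference with step 2^-(j+1) gains on a kernel of scale 2^n: about (step
  * 2^n)^2, hence one factor 1/4 for each level by which the kernel is coarser than the mesh.
  Kernels finer than the mesh gain nothing.\<close>

definition scale_weight :: "nat \<Rightarrow> nat \<Rightarrow> real" where
  "scale_weight j n = (if n \<le> j then (1/4) ^ (j - n) else 1)"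

lemma scale_weight_nonneg: "0 \<le> scale_weight j n" and scale_weight_le_1: "scale_weight j n \<le> 1"
  by (auto simp: scale_weight_def power_le_one)

text \<open>Scales n \<ge> j telescope; the coarser ones are tamed by \<open>scale_weight\<close>.
  What remains decays like the power 3/2 of the distance in mesh units 2^-j, which can be summed
  over nodes. The constant is 8*5 for the coarse scales plus 8*3 for the fine ones.\<close>

lemma dyadic_kappa_sum:
  "(\<Sum>n\<le>N. scale_weight j n * kappa (2 ^ n * t)) \<le> 64 / (1 + sqrt (2 ^ j * \<bar>t\<bar>)) ^ 3"
proof -
  define z where "z = sqrt (2 ^ j * \<bar>t\<bar>)"
  have z: "z \<ge> 0" by (simp add: z_def)
  define F where "F n = scale_weight j n * kappa (2 ^ n * t)" for n
  have F0: "F n \<ge> 0" for n by (simp add: F_def scale_weight_nonneg kappa_nonneg)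
  have hi: "F (j + i) \<le> 8 * (sqrt 2 ^ i * z / (1 + sqrt 2 ^ i * z) ^ 4)" for i
  proof -
    have e: "sqrt \<bar>2 ^ (j + i) * t\<bar> = sqrt 2 ^ i * z"
      by (simp add: z_def abs_mult power_add real_sqrt_mult real_sqrt_power mult_ac)
    have "F (j + i) \<le> 1 * kappa (2 ^ (j + i) * t)"
      unfolding F_def by (intro mult_right_mono scale_weight_le_1 kappa_nonneg)
    also have "\<dots> \<le> 8 * (sqrt 2 ^ i * z / (1 + sqrt 2 ^ i * z) ^ 4)"
      using kappa_le[of "2 ^ (j + i) * t"] unfolding e by simp
    finally show ?thesis .
  qed
  have lo: "F n \<le> 8 * (1 / sqrt 2) ^ (j - n) / (1 + z) ^ 3" if "n < j" for n
  proof -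
    define i where "i = j - n"
    define \<beta> where "\<beta> = (1 / sqrt 2) ^ i"
    have j: "j = n + i" using that by (simp add: i_def)
    have \<beta>: "0 < \<beta>" "\<beta> \<le> 1" by (auto simp: \<beta>_def power_le_one)
    have e: "sqrt \<bar>2 ^ n * t\<bar> = \<beta> * z"
      by (simp add: z_def \<beta>_def j abs_mult power_add real_sqrt_mult real_sqrt_power power_one_over)
    have b4: "\<beta> ^ 4 = (1/4) ^ i"
    proof -
      have "\<beta> ^ 4 = ((1 / sqrt 2) ^ 4) ^ i" by (simp add: \<beta>_def power_commutes mult.commute flip:
        power_mult)
      moreover have "(1 / sqrt 2) ^ 4 = (1/4 :: real)" by (simp add: power4_eq_xxxx)
      ultimately show ?thesis by simp
    qed
    have "F n = \<beta> ^ 4 * kappa (2 ^ n * t)" using that by (simp add: F_def scale_weight_def b4 i_def)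
    also have "\<dots> \<le> \<beta> ^ 4 * (8 * (\<beta> * z / (1 + \<beta> * z) ^ 4))"
      using kappa_le[of "2 ^ n * t"] \<beta> by (intro mult_left_mono) (auto simp: e)
    also have "\<dots> = 8 * \<beta> * (z * \<beta> ^ 4 / (1 + \<beta> * z) ^ 4)" by simp
    also have "\<dots> \<le> 8 * \<beta> * (1 / (1 + z) ^ 3)"
    proof (intro mult_left_mono)
      \<comment> \<open>Replacing decay at the coarse scale by decay at the mesh scale costs
        \<beta>^4, exactly the factor in \<open>scale_weight\<close>. The one power of \<beta> left
        over comes from the numerator of \<open>kappa\<close> and makes the series over coarse
        scales geometric.\<close>
      have "\<beta> * (1 + z) \<le> 1 + \<beta> * z" using \<beta> by (simp add: algebra_simps)
      then have "(\<beta> * (1 + z)) ^ 4 \<le> (1 + \<beta> * z) ^ 4"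
        using \<beta> z by (intro power_mono) auto
      then have "z * (\<beta> * (1 + z)) ^ 4 \<le> (1 + z) * (1 + \<beta> * z) ^ 4"
        using \<beta> z by (intro mult_mono) auto
      then have "z * \<beta> ^ 4 * (1 + z) ^ 3 \<le> (1 + \<beta> * z) ^ 4"
        using z by (simp add: power_mult_distrib power4_eq_xxxx power3_eq_cube mult_ac)
      then show "z * \<beta> ^ 4 / (1 + \<beta> * z) ^ 4 \<le> 1 / (1 + z) ^ 3"
        using z \<beta> by (simp add: divide_simps add_pos_nonneg)
    qed (use \<beta> in auto)
    finally show ?thesis by (simp add: \<beta>_def i_def)
  qed
  have geo: "(\<Sum>i=1..j. (1 / sqrt 2) ^ i) \<le> (5::real)"
  proof -
    have l: "norm (1 / sqrt 2) < 1" by simp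
    have "(\<Sum>i=1..j. (1 / sqrt 2) ^ i) \<le> (\<Sum>i. (1 / sqrt 2) ^ i)"
      by (intro sum_le_suminf summable_geometric l) auto
    also have "\<dots> = 1 / (1 - 1 / sqrt 2)" by (rule suminf_geometric[OF l])
    also have "\<dots> \<le> 5"
      using sqrt2_bounds by (simp add: divide_simps)
    finally show ?thesis .
  qed
  have split: "(\<Sum>n<j + M. F n) = (\<Sum>n<j. F n) + (\<Sum>i<M. F (j + i))" for M
    by (induction M) (simp_all add: add_ac)
  have "(\<Sum>n\<le>N. F n) \<le> (\<Sum>n<j + Suc N. F n)"
    by (intro sum_mono2) (auto simp: F0)
  also have "\<dots> = (\<Sum>n<j. F n) + (\<Sum>i<Suc N. F (j + i))"
    by (rule split)
  also have "(\<Sum>n<j. F n) \<le> (\<Sum>n<j. 8 / (1 + z) ^ 3 * (1 / sqrt 2) ^ (j - n))"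
    by (intro sum_mono order.trans[OF lo]) auto
  also have "\<dots> = 8 / (1 + z) ^ 3 * (\<Sum>i=1..j. (1 / sqrt 2) ^ i)"
    unfolding sum_distrib_left
    by (rule sum.reindex_bij_witness[of _ "\<lambda>i. j - i" "\<lambda>i. j - i"]) auto
  also have "\<dots> \<le> 8 / (1 + z) ^ 3 * 5" using z geo by (intro mult_left_mono) auto
  also have "(\<Sum>i<Suc N. F (j + i)) \<le> (\<Sum>i<Suc N. 8 * (sqrt 2 ^ i * z / (1 + sqrt 2 ^ i * z) ^ 4))"
    by (intro sum_mono hi)
  also have "\<dots> \<le> 8 * (3 / (1 + z) ^ 3)"
    unfolding sum_distrib_left[symmetric] by (intro mult_left_mono dyadic_sum_ge z) auto
  finally show ?thesis by (simp add: F_def z_def)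
qed

text \<open>After doubling, the points are at least 1 apart, so their integer parts are distinct.
  The sum is then dominated by a series of type n^(-3/2), taken once over the nonnegative and once
  over the negative integers.\<close>

lemma separated_sum_bound:
  "\<exists>C>0. \<forall>D \<alpha> m. D \<ge> 1/2 \<longrightarrow> (\<Sum>k<m. 1 / (1 + sqrt \<bar>\<alpha> + D * real k\<bar>) ^ 3) \<le> C"
proof -
  \<comment> \<open>The integer part c of 2u satisfies |c| \<le> 2|u| + 1, hence (|c| + 1)/2 \<le>
    (1 + sqrt|u|)^2. The power 3/2 turns this square into the cube of the statement.\<close>
  define G where "G n = (2 / (real n + 1)) powr (3/2)" for n
  have G0: "G n \<ge> 0" for n by (simp add: G_def)
  have sG: "summable G"
  proof -
    have "summable (\<lambda>n. real n powr (-3/2))" by (simp add: summable_real_powr_iff)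
    then have "summable (\<lambda>n. real (Suc n) powr (-3/2))" by (subst summable_Suc_iff)
    then have "summable (\<lambda>n. 2 powr (3/2) * real (Suc n) powr (-3/2))" by (rule summable_mult)
    moreover have "(\<lambda>n. 2 powr (3/2) * real (Suc n) powr (-3/2)) = G"
      by (rule ext) (simp add: G_def powr_divide powr_minus divide_simps add.commute)
    ultimately show ?thesis by (simp only:)
  qed
  show ?thesis
  proof (intro exI conjI allI impI)
    show "2 * suminf G + 1 > 0" using suminf_nonneg[OF sG G0] by simp
    fix D \<alpha> :: real and m :: nat assume D: "D \<ge> 1/2"
    define u where "u k = \<alpha> + D * real k" for k
    define c where "c k = \<lfloor>2 * u k\<rfloor>" for k
    have inj: "inj_on c {..<m}"
    proof (rule linorder_inj_onI)
      fix k l :: nat assume "k < l"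
      then have "real (k + 1) \<le> real l" by (intro of_nat_mono) simp
      then have "D * real k + D \<le> D * real l" using D mult_left_mono[of "real (k+1)" "real l" D]
        by (simp add: algebra_simps)
      then have "2 * u k + 1 \<le> 2 * u l" using D by (simp add: u_def)
      then have "c k + 1 \<le> c l" unfolding c_def by linarith
      then show "c k \<noteq> c l" by simp
    qed auto
    have b: "1 / (1 + sqrt \<bar>u k\<bar>) ^ 3 \<le> G (nat \<bar>c k\<bar>)" for k
    proof -
      have "real (nat \<bar>c k\<bar>) \<le> 2 * \<bar>u k\<bar> + 1" unfolding c_def by linarith
      then have le: "(real (nat \<bar>c k\<bar>) + 1) / 2 \<le> (1 + sqrt \<bar>u k\<bar>)\<^sup>2"
        by (simp add: power2_sum)
          (smt (verit) real_sqrt_ge_zero abs_ge_zero)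
      have "1 / (1 + sqrt \<bar>u k\<bar>) ^ 3 = (1 / (1 + sqrt \<bar>u k\<bar>)\<^sup>2) powr (3/2)"
        by (simp add: powr_divide powr_powr add_pos_nonneg flip: powr_numeral)
      also have "\<dots> \<le> G (nat \<bar>c k\<bar>)"
        unfolding G_def
      proof (rule powr_mono2)
        show "1 / (1 + sqrt \<bar>u k\<bar>)\<^sup>2 \<le> 2 / (real (nat \<bar>c k\<bar>) + 1)"
        proof -
          have "1 / (1 + sqrt \<bar>u k\<bar>)\<^sup>2 \<le> 1 / ((real (nat \<bar>c k\<bar>) + 1) / 2)"
            using le by (intro divide_left_mono mult_pos_pos zero_less_power add_pos_nonneg) auto
          then show ?thesis by simp
        qed
      qed auto
      finally show ?thesis .
    qed
    have "(\<Sum>k<m. 1 / (1 + sqrt \<bar>\<alpha> + D * real k\<bar>) ^ 3) \<le> (\<Sum>k<m. G (nat \<bar>c k\<bar>))"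
      using b by (intro sum_mono) (simp add: u_def)
    also have "\<dots> = (\<Sum>z\<in>c ` {..<m}. G (nat \<bar>z\<bar>))"
      by (simp add: sum.reindex[OF inj])
    also have "\<dots> = (\<Sum>z\<in>{z\<in>c ` {..<m}. z \<ge> 0}. G (nat \<bar>z\<bar>))
      + (\<Sum>z\<in>{z\<in>c ` {..<m}. z < 0}. G (nat \<bar>z\<bar>))"
      by (subst sum.union_disjoint[symmetric]) (auto intro!: sum.cong)
    also have "(\<Sum>z\<in>{z\<in>c ` {..<m}. z \<ge> 0}. G (nat \<bar>z\<bar>))
      = sum G ((\<lambda>z. nat \<bar>z\<bar>) ` {z\<in>c ` {..<m}. z \<ge> 0})"
      by (subst sum.reindex) (auto simp: inj_on_def)
    also have "\<dots> \<le> suminf G" by (intro sum_le_suminf sG) (auto simp: G0)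
    also have "(\<Sum>z\<in>{z\<in>c ` {..<m}. z < 0}. G (nat \<bar>z\<bar>))
      = sum G ((\<lambda>z. nat \<bar>z\<bar>) ` {z\<in>c ` {..<m}. z < 0})"
      by (subst sum.reindex) (auto simp: inj_on_def)
    also have "\<dots> \<le> suminf G" by (intro sum_le_suminf sG) (auto simp: G0)
    finally show "(\<Sum>k<m. 1 / (1 + sqrt \<bar>\<alpha> + D * real k\<bar>) ^ 3) \<le> 2 * suminf G + 1" by simp
  qed
qed

section \<open>Stencils of Faber nodes\<close>

text \<open>At level \<open>-1\<close> only the node with index \<open>0\<close> carries weight, so that all levels share one
  index set.\<close>

definition stencil_node :: "int \<Rightarrow> nat \<Rightarrow> nat \<Rightarrow> real" where
  "stencil_node j k s = (if j = -1 then real k else 2 powi (-j) * real k + real s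
    * 2 powi (-(j + 1)))"

definition stencil_coeff :: "int \<Rightarrow> nat \<Rightarrow> complex" where
  "stencil_coeff j s = (if j = -1 then (if s = 0 then 1 else 0) else (if s = 1 then 1 else -1/2))"

text \<open>For each node the scales are summed first, which leaves enough decay to sum over k with
  the stencil index fixed: these nodes are spaced by \<mu> \<ge> 1/2 in mesh units. The parameters
  \<mu> and \<alpha> stay free because the nodes will be contracted and translated. Level -1 has
  only 2*3 terms, each at most 64.\<close>

lemma stencil_kappa_sum:
  "\<exists>C>0. \<forall>j\<ge>-1. \<forall>\<mu> \<alpha> N. 1/2 \<le> \<mu> \<longrightarrow>
     (\<Sum>n\<le>N. \<Sum>k\<in>faber_idx1 j. \<Sum>s\<in>{..2}. scale_weight (nat j) n
       * kappa (2 ^ n * (\<mu> * stencil_node j k s + \<alpha>))) \<le> C"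
proof -
  obtain C where C: "C > 0"
    "\<And>D \<alpha> m. D \<ge> 1/2 \<Longrightarrow> (\<Sum>k<m. 1 / (1 + sqrt \<bar>\<alpha> + D * real k\<bar>) ^ 3) \<le> C"
    using separated_sum_bound by blast
  show ?thesis
  proof (intro exI[of _ "64 * 6 + 64 * 3 * C"] conjI allI impI)
    show "0 < 64 * 6 + 64 * 3 * C" using C by simp
    fix j :: int and \<mu> \<alpha> :: real and N :: nat
    assume j: "j \<ge> -1" and \<mu>: "1/2 \<le> \<mu>"
    define H where "H k s = 1 / (1 + sqrt (2 ^ nat j * \<bar>\<mu> * stencil_node j k s + \<alpha>\<bar>)) ^ 3" for k s
    have "(\<Sum>n\<le>N. \<Sum>k\<in>faber_idx1 j. \<Sum>s\<in>{..2}. scale_weight (nat j) n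
      * kappa (2 ^ n * (\<mu> * stencil_node j k s + \<alpha>)))
        = (\<Sum>k\<in>faber_idx1 j. \<Sum>n\<le>N. \<Sum>s\<in>{..2}. scale_weight (nat j) n
          * kappa (2 ^ n * (\<mu> * stencil_node j k s + \<alpha>)))"
      by (rule sum.swap)
    also have "\<dots> = (\<Sum>k\<in>faber_idx1 j. \<Sum>s\<in>{..2}. \<Sum>n\<le>N. scale_weight (nat j) n
      * kappa (2 ^ n * (\<mu> * stencil_node j k s + \<alpha>)))"
      by (intro sum.cong refl sum.swap)
    also have "\<dots> \<le> (\<Sum>k\<in>faber_idx1 j. \<Sum>s\<in>{..2}. 64 * H k s)"
      using dyadic_kappa_sum by (intro sum_mono) (simp add: H_def)
    also have "\<dots> \<le> 64 * 6 + 64 * 3 * C"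
    proof (cases "j = -1")
      case True
      have "(\<Sum>k\<in>faber_idx1 j. \<Sum>s\<in>{..2}. 64 * H k s) \<le> (\<Sum>k\<in>faber_idx1 j. \<Sum>s\<in>{..2::nat}. 64)"
      proof (intro sum_mono)
        fix k s
        have "H k s \<le> 1 / 1"
          unfolding H_def by (intro divide_left_mono one_le_power mult_pos_pos zero_less_power
            add_pos_nonneg) auto
        then show "64 * H k s \<le> 64" by simp
      qed
      also have "\<dots> = 64 * 6" using True by (simp add: faber_idx1_def)
      finally show ?thesis using C by simp
    next
      case False
      then have "j = int (nat j)" using j by simp
      then obtain i where i: "j = int i" by blast
      have idx: "faber_idx1 j = {..<2 ^ i}" using i by (auto simp: faber_idx1_def)
      have "(\<Sum>k\<in>faber_idx1 j. \<Sum>s\<in>{..2}. 64 * H k s) = (\<Sum>s\<in>{..2}. \<Sum>k<2^i. 64 * H k s)"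
        unfolding idx by (rule sum.swap)
      also have "\<dots> \<le> (\<Sum>s\<in>{..2::nat}. 64 * C)"
      proof (intro sum_mono)
        fix s :: nat
        have "H k s = 1 / (1 + sqrt \<bar>(\<mu> * real s / 2 + 2 ^ i * \<alpha>) + \<mu> * real k\<bar>) ^ 3" for k
        proof -
          have "2 ^ i * \<bar>\<mu> * stencil_node j k s + \<alpha>\<bar> = \<bar>2 ^ i * (\<mu> * stencil_node j k s + \<alpha>)\<bar>"
            by (simp add: abs_mult)
          also have "2 ^ i * (\<mu> * stencil_node j k s + \<alpha>) = (\<mu> * real s / 2 + 2 ^ i * \<alpha>) + \<mu>
            * real k"
          proof -
            have "2 powi (- (int i + 1)) = (1 / (2 * 2 ^ i) :: real)"
              by (simp add: power_int_minus power_int_diff divide_simps)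
            then show ?thesis using i
              by (simp add: stencil_node_def power_int_minus field_simps)
          qed
          finally show ?thesis using i by (simp add: H_def)
        qed
        then show "(\<Sum>k<2^i. 64 * H k s) \<le> 64 * C"
          using C(2)[OF \<mu>] unfolding sum_distrib_left[symmetric] by simp
      qed
      also have "\<dots> = 64 * 3 * C" by simp
      finally show ?thesis by simp
    qed
    finally show "(\<Sum>n\<le>N. \<Sum>k\<in>faber_idx1 j. \<Sum>s\<in>{..2}. scale_weight (nat j) n
      * kappa (2 ^ n * (\<mu> * stencil_node j k s + \<alpha>)))
      \<le> 64 * 6 + 64 * 3 * C" .
  qed
qed

section \<open>Fourier kernels in one variable\<close>

lemma borel_measurable_cis [measurable]: "cis \<in> borel_measurable borel"
  by (intro borel_measurable_continuous_onI continuous_intros)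

lemma integrable_pair_bound:
  fixes f :: "'a::euclidean_space \<Rightarrow> complex" and g :: "'b::euclidean_space \<Rightarrow> complex"
  assumes f: "integrable lborel f" and g: "integrable lborel g"
    and H [measurable]: "case_prod H \<in> borel_measurable (lborel \<Otimes>\<^sub>M lborel)"
    and b: "\<And>x y. norm (H x y :: complex) \<le> norm (f x) * norm (g y)"
  shows "integrable (lborel \<Otimes>\<^sub>M lborel) (case_prod H)"
proof (rule Bochner_Integration.integrable_bound[OF _ H])
  have [measurable]: "f \<in> borel_measurable borel" "g \<in> borel_measurable borel"
    using f g by auto
  show "integrable (lborel \<Otimes>\<^sub>M lborel) (\<lambda>(x, y). f x * g y)"
    by (rule lborel_pair.Fubini_integrable)
      (use f g in \<open>auto simp: norm_mult intro!: integrable_mult_left integrable_norm\<close>)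
  show "AE p in lborel \<Otimes>\<^sub>M lborel. norm (case p of (x, y) \<Rightarrow> H x y) \<le> norm (case p of (x, y) \<Rightarrow> f x
    * g y)"
    using b by (auto simp: norm_mult)
qed

lemma Fubini_pair_bound:
  fixes f :: "'a::euclidean_space \<Rightarrow> complex" and g :: "'b::euclidean_space \<Rightarrow> complex"
  assumes "integrable lborel f" "integrable lborel g"
    and "case_prod H \<in> borel_measurable (lborel \<Otimes>\<^sub>M lborel)"
    and "\<And>x y. norm (H x y :: complex) \<le> norm (f x) * norm (g y)"
  shows "(LINT y|lborel. LINT x|lborel. H x y) = (LINT x|lborel. LINT y|lborel. H x y)"
  by (rule lborel_pair.Fubini_integral[OF integrable_pair_bound[OF assms]])

lemma integrable_compact_support:
  fixes v :: "real \<Rightarrow> complex"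
  assumes "continuous_on UNIV v" "\<And>x. R < \<bar>x\<bar> \<Longrightarrow> v x = 0"
  shows "integrable lborel v"
proof -
  have "integrable lborel (\<lambda>x. indicator {-R..R} x *\<^sub>R v x)"
    using borel_integrable_compact[of "{-R..R}" v] continuous_on_subset[OF assms(1)] by auto
  moreover have "(\<lambda>x. indicator {-R..R} x *\<^sub>R v x) = v"
    using assms(2) by (force simp: indicator_def fun_eq_iff)
  ultimately show ?thesis by simp
qed

lemma cis_vector_derivative:
  "((\<lambda>x. cis (t * x)) has_vector_derivative (\<i> * of_real t) * cis (t * x)) (at x)"
proof -
  show ?thesis unfolding has_vector_derivative_def
    by (rule derivative_eq_intros refl)+ (simp add: fun_eq_iff scaleR_conv_of_real)
qed

lemma fourier_ibp:
  fixes v v' :: "real \<Rightarrow> complex"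
  assumes d: "\<And>x. (v has_vector_derivative v' x) (at x)"
    and c: "continuous_on UNIV v'"
    and z: "\<And>x. R < \<bar>x\<bar> \<Longrightarrow> v x = 0" "\<And>x. R < \<bar>x\<bar> \<Longrightarrow> v' x = 0"
  shows "(LINT x|lborel. v' x * cis (t * x)) = - \<i> * of_real t * (LINT x|lborel. v x * cis (t * x))"
proof -
  have cv: "continuous_on UNIV v"
    using d by (meson continuous_at_imp_continuous_on has_vector_derivative_continuous)
  \<comment> \<open>Both end points lie strictly outside [-R, R], where v vanishes, and the interval
    is nonempty even if R is negative.\<close>
  define Q where "Q = \<bar>R\<bar> + 1"
  have cc: "continuous_on A (\<lambda>x. cis (t * x))" for A :: "real set" by (intro continuous_intros)
  have i1: "integrable lborel (\<lambda>x. v x * cis (t * x))" and i2: "integrable lborel (\<lambda>x. v' x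
    * cis (t * x))"
    by (rule integrable_compact_support[of _ R]; use z in \<open>auto intro!:
      continuous_on_mult cv c cc\<close>)+
  let ?h = "\<lambda>x. v' x * cis (t * x) + v x * (\<i> * of_real t * cis (t * x))"
  have ftc: "(\<integral>x. indicator {-Q..Q} x *\<^sub>R ?h x \<partial>lborel) = v Q * cis (t * Q) - v (-Q)
    * cis (t * (-Q))"
  proof (rule integral_FTC_Icc)
    show "- Q \<le> Q" by (simp add: Q_def)
    show "((\<lambda>x. v x * cis (t * x)) has_vector_derivative ?h x) (at x within {-Q..Q})" for x
      using has_vector_derivative_mult[OF d cis_vector_derivative[of t], of x]
      by (auto intro: has_vector_derivative_at_within simp: add.commute)
    show "continuous_on {-Q..Q} ?h"
      by (intro continuous_intros continuous_on_subset[OF cv] continuous_on_subset[OF c]) auto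
  qed
  have "(\<lambda>x. indicator {-Q..Q} x *\<^sub>R ?h x) = ?h"
    using z by (force simp: indicator_def fun_eq_iff Q_def)
  moreover have "v Q = 0" "v (-Q) = 0" using z(1)[of Q] z(1)[of "-Q"] by (auto simp: Q_def)
  ultimately have "(\<integral>x. ?h x \<partial>lborel) = 0" using ftc by simp
  moreover have "(\<integral>x. ?h x \<partial>lborel) = (\<integral>x. v' x * cis (t * x) \<partial>lborel)
    + (\<integral>x. \<i> * of_real t * (v x * cis (t * x)) \<partial>lborel)"
    using i1 i2 by (subst Bochner_Integration.integral_add[symmetric]) (auto simp: mult_ac)
  ultimately show ?thesis
    using i1 by (simp add: eq_neg_iff_add_eq_0)
qed

lemma fourier_sup_bound:
  fixes v :: "real \<Rightarrow> complex"
  assumes "R \<ge> 0" "\<And>x. norm (v x) \<le> B * indicator {-R..R} x"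
  shows "norm (LINT x|lborel. v x * cis (t * x)) \<le> 2 * R * B"
proof -
  have "norm (LINT x|lborel. v x * cis (t * x)) \<le> (LINT x|lborel. B * indicator {-R..R} x)"
  proof (cases "integrable lborel (\<lambda>x. v x * cis (t * x))")
    case i: True
    show ?thesis
      by (rule Bochner_Integration.integral_norm_bound_integral[OF i])
        (use assms in \<open>auto simp: norm_mult\<close>)
  next
    \<comment> \<open>The integral of a non-integrable function is 0, so it remains to see that B
      \<ge> 0, which is read off from the bound at the origin.\<close>
    case False
    moreover have "B \<ge> 0" using assms(2)[of 0] assms(1) norm_ge_zero[of "v 0"]
      by (simp del: norm_ge_zero)
    ultimately show ?thesis using assms(1) by (simp add: not_integrable_integral_eq)
  qed
  also have "\<dots> = 2 * R * B" using assms(1) by simp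
  finally show ?thesis .
qed

text \<open>\<open>v l\<close> is the \<open>l\<close>-th derivative of the symbol; the decay comes from four integrations by
  parts.\<close>

lemma multiplier_kernel_decay:
  fixes v :: "nat \<Rightarrow> real \<Rightarrow> complex"
  assumes d: "\<And>l x. l < 4 \<Longrightarrow> (v l has_vector_derivative v (Suc l) x) (at x)"
    and c: "continuous_on UNIV (v 4)"
    and b: "\<And>l x. l \<le> 4 \<Longrightarrow> norm (v l x) \<le> B * (1 / 2 ^ n) ^ l
      * indicator {- (2 ^ (n + 2))..2 ^ (n + 2)} x"
  shows "norm (LINT x|lborel. v 0 x * cis (t * x)) \<le> 32 * B * 2 ^ n / (1 + (2 ^ n * t)\<^sup>2)\<^sup>2"
proof -
  let ?F = "\<lambda>l. LINT x|lborel. v l x * cis (t * x)"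
  have z: "v l x = 0" if "l \<le> 4" "2 ^ (n + 2) < \<bar>x\<bar>" for l x
    using b[OF that(1), of x] that by (auto simp: indicator_def abs_if split: if_splits)
  have cv: "continuous_on UNIV (v l)" if "l \<le> 4" for l
  proof (cases "l = 4")
    case False
    then show ?thesis using d[of l] that
      by (meson continuous_at_imp_continuous_on has_vector_derivative_continuous
        le_neq_implies_less)
  qed (use c in auto)
  have step: "?F (Suc l) = - \<i> * of_real t * ?F l" if "l < 4" for l
    by (rule fourier_ibp[of "v l" "v (Suc l)" "2 ^ (n + 2)"]) (use d z cv that in auto)
  have F4: "?F 4 = of_real (t ^ 4) * ?F 0"
    using step[of 0] step[of 1] step[of 2] step[of 3]
    by (simp add: eval_nat_numeral algebra_simps)
  have F0: "norm (?F 0) \<le> 8 * 2 ^ n * B"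
    using fourier_sup_bound[of "2 ^ (n + 2)" "v 0" B t] b[of 0] by (simp add: mult_ac)
  have "norm (?F 4) \<le> 2 * 2 ^ (n + 2) * (B * (1 / 2 ^ n) ^ 4)"
    by (rule fourier_sup_bound) (use b[of 4] in auto)
  then have "t ^ 4 * norm (?F 0) \<le> 8 * 2 ^ n * B * (1 / 2 ^ n) ^ 4"
    unfolding F4 norm_mult norm_of_real by simp
  then have "(2 ^ n) ^ 4 * (t ^ 4 * norm (?F 0)) \<le> (2 ^ n) ^ 4 * (8 * 2 ^ n * B * (1 / 2 ^ n) ^ 4)"
    by (intro mult_left_mono) auto
  then have "(2 ^ n * t) ^ 4 * norm (?F 0) \<le> 8 * 2 ^ n * B"
    by (simp add: power_mult_distrib power_one_over)
  with F0 have f: "(1 + (2 ^ n * t) ^ 4) * norm (?F 0) \<le> 16 * 2 ^ n * B"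
    by (simp add: algebra_simps)
  have "(1 + (2 ^ n * t)\<^sup>2)\<^sup>2 \<le> 2 * (1 + (2 ^ n * t) ^ 4)"
    using zero_le_power2[of "1 - (2 ^ n * t)\<^sup>2"] by (simp add: power2_diff power2_sum)
  from mult_right_mono[OF this norm_ge_zero[of "?F 0"]]
  have "(1 + (2 ^ n * t)\<^sup>2)\<^sup>2 * norm (?F 0) \<le> 2 * ((1 + (2 ^ n * t) ^ 4) * norm (?F 0))"
    by (simp only: mult.assoc)
  with f have "(1 + (2 ^ n * t)\<^sup>2)\<^sup>2 * norm (?F 0) \<le> 32 * 2 ^ n * B" by linarith
  moreover have "(1 + (2 ^ n * t)\<^sup>2)\<^sup>2 > 0" by (intro zero_less_power add_pos_nonneg) auto
  ultimately show ?thesis by (simp only: pos_le_divide_eq mult_ac)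
qed

section \<open>Fourier inversion by Gaussian damping\<close>

lemma char_normal_integral:
  "(LINT x|lborel. of_real (std_normal_density x) * cis (t * x)) = of_real (exp (- t\<^sup>2 / 2))"
proof -
  have "char std_normal_distribution t = (LINT x|lborel. std_normal_density x *\<^sub>R cis (t * x))"
    unfolding char_def by (subst integral_density) (auto simp: cis_conv_exp)
  then show ?thesis by (simp add: char_std_normal_distribution scaleR_conv_of_real)
qed

text \<open>Damping the integral by a Gaussian turns it into the convolution of \<open>u\<close> with a narrow
  Gaussian.\<close>

lemma fourier_inversion:
  fixes u :: "real \<Rightarrow> complex"
  defines "U \<equiv> \<lambda>t. (LINT x|lborel. u x * cis (t * x)) / of_real (2 * pi)"
  assumes c: "continuous_on UNIV u" and z: "\<And>x. R < \<bar>x\<bar> \<Longrightarrow> u x = 0"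
    and U: "integrable lborel U"
  shows "(LINT t|lborel. U t * cis (- (x * t))) = u x"
proof -
  define G where "G e t = exp (- (e * t)\<^sup>2 / 2)" for e t :: real
  have iu: "integrable lborel u" by (rule integrable_compact_support[OF c z])
  have [measurable]: "u \<in> borel_measurable borel"
    using c by (simp add: borel_measurable_continuous_onI)
  obtain B where B: "\<And>x. norm (u x) \<le> B"
  proof -
    have "compact (u ` {-R..R})" using c by (intro compact_continuous_image)
      (auto intro: continuous_on_subset)
    then obtain B where "\<And>x. x \<in> {-R..R} \<Longrightarrow> norm (u x) \<le> B"
      using compact_imp_bounded bounded_iff by (metis imageI)
    then have "norm (u x) \<le> max B 0" for x using z[of x] by (cases "x \<in> {-R..R}") force+
    then show ?thesis using that by blast
  qed
  \<comment> \<open>With damping width e the double integral converges absolutely, so Fubini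
    applies. The inner integral over t is the transform of a Gaussian, and the substitution y = x +
    e s makes the resulting density a standard one.\<close>
  have key: "(LINT t|lborel. U t * cis (- (x * t)) * of_real (G e t)) =
      (LINT s|lborel. u (x + e * s) * of_real (std_normal_density s))" if e: "e > 0" for e
  proof -
    have iG: "integrable lborel (G e)"
    proof -
      have "integrable lborel (\<lambda>x. std_normal_density (0 + e * x))"
        by (rule lborel_integrable_real_affine) (use e in auto)
      then have "integrable lborel (\<lambda>x. sqrt (2 * pi) * std_normal_density (0 + e * x))"
        by (rule integrable_mult_right)
      then show ?thesis by (simp add: std_normal_density_def G_def[abs_def])
    qed
    have "(LINT t|lborel. U t * cis (- (x * t)) * of_real (G e t)) =
       (LINT t|lborel. LINT y|lborel. u y * cis (t * (y - x)) * of_real (G e t) / of_real (2 * pi))"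
    proof (intro Bochner_Integration.integral_cong refl)
      fix t
      have "u y * cis (t * (y - x)) * of_real (G e t) / of_real (2 * pi) =
          u y * cis (t * y) * (cis (- (x * t)) * of_real (G e t) / of_real (2 * pi))" for y
      proof -
        have "cis (t * (y - x)) = cis (t * y) * cis (- (x * t))"
          unfolding cis_mult by (simp add: algebra_simps)
        then show ?thesis by simp
      qed
      then have "(LINT y|lborel. u y * cis (t * (y - x)) * of_real (G e t) / of_real (2 * pi)) =
          (LINT y|lborel. u y * cis (t * y) * (cis (- (x * t)) * of_real (G e t) / of_real
            (2 * pi)))"
        by (intro Bochner_Integration.integral_cong refl)
      also have "\<dots> = (LINT y|lborel. u y * cis (t * y))
        * (cis (- (x * t)) * of_real (G e t) / of_real (2 * pi))"
        by (rule integral_mult_left_zero)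
      also have "\<dots> = U t * cis (- (x * t)) * of_real (G e t)"
        unfolding U_def times_divide_eq_left times_divide_eq_right mult.assoc ..
      finally show "U t * cis (- (x * t)) * of_real (G e t) =
          (LINT y|lborel. u y * cis (t * (y - x)) * of_real (G e t) / of_real (2 * pi))"
        by (rule sym)
    qed
    also have "\<dots> = (LINT y|lborel. LINT t|lborel. u y * cis (t * (y - x))
      * of_real (G e t) / of_real (2 * pi))"
    proof (rule Fubini_pair_bound[OF iu])
      show "integrable lborel (\<lambda>t. complex_of_real (G e t))" using iG by simp
      show "(\<lambda>(y, t). u y * cis (t * (y - x)) * of_real (G e t) / of_real (2 * pi)) \<in>
        borel_measurable (lborel \<Otimes>\<^sub>M lborel)"
        unfolding G_def by measurable
      show "norm (u y * cis (t * (y - x)) * of_real (G e t) / of_real (2 * pi)) \<le> norm (u y)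
        * norm (complex_of_real (G e t))" for y t
      proof -
        have "norm (u y * cis (t * (y - x)) * of_real (G e t) / of_real (2 * pi)) = norm (u y)
          * norm (complex_of_real (G e t)) / (2 * pi)"
          by (simp add: norm_mult norm_divide)
        also have "\<dots> \<le> norm (u y) * norm (complex_of_real (G e t)) / 1"
          using pi_gt3 by (intro divide_left_mono) auto
        finally show ?thesis by simp
      qed
    qed
    also have "\<dots> = (LINT y|lborel. u y * of_real (std_normal_density ((y - x) / e) / e))"
    proof (intro Bochner_Integration.integral_cong refl)
      fix y
      have "(LINT t|lborel. u y * cis (t * (y - x)) * of_real (G e t) / of_real (2 * pi)) =
        (LINT t|lborel. u y / of_real (sqrt (2 * pi)) * (of_real (std_normal_density (0 + e * t))
          * cis ((y - x) / e * (0 + e * t))))"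
      proof (intro Bochner_Integration.integral_cong refl)
        fix t
        have p: "of_real (2 * pi) = (of_real (sqrt (2 * pi)) * of_real (sqrt (2 * pi)) :: complex)"
          by (simp flip: of_real_mult)
        have n: "std_normal_density (0 + e * t) = G e t / sqrt (2 * pi)"
          by (simp add: std_normal_density_def G_def)
        have c: "(y - x) / e * (0 + e * t) = t * (y - x)" using e by simp
        show "u y * cis (t * (y - x)) * of_real (G e t) / of_real (2 * pi) =
          u y / of_real (sqrt (2 * pi)) * (of_real (std_normal_density (0 + e * t))
            * cis ((y - x) / e * (0 + e * t)))"
          unfolding n c p by (simp only: of_real_divide times_divide_eq_right times_divide_eq_left
            divide_divide_eq_left mult_ac)
      qed
      also have "\<dots> = u y / of_real (sqrt (2 * pi)) *
          (LINT t|lborel. of_real (std_normal_density (0 + e * t))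
            * cis ((y - x) / e * (0 + e * t)))"
        by (rule integral_mult_right_zero)
      also have "(LINT t|lborel. of_real (std_normal_density (0 + e * t))
        * cis ((y - x) / e * (0 + e * t))) =
         of_real (exp (- ((y - x) / e)\<^sup>2 / 2)) / of_real e"
        using lborel_integral_real_affine[of e "\<lambda>t. of_real (std_normal_density t)
          * cis ((y - x) / e * t)" 0]
        unfolding char_normal_integral using e
        by (simp only: scaleR_conv_of_real abs_of_pos) (simp add: field_simps)
      also have "u y / of_real (sqrt (2 * pi)) * (of_real (exp (- ((y - x) / e)\<^sup>2 / 2)) / of_real e)
        =
          u y * of_real (std_normal_density ((y - x) / e) / e)"
        by (simp add: std_normal_density_def)
      finally show "(LINT t|lborel. u y * cis (t * (y - x)) * of_real (G e t) / of_real (2 * pi))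
        = u y * of_real (std_normal_density ((y - x) / e) / e)" .
    qed
    also have "\<dots> = \<bar>e\<bar> *\<^sub>R (LINT s|lborel. u (x + e * s)
      * of_real (std_normal_density ((x + e * s - x) / e) / e))"
      by (rule lborel_integral_real_affine) (use e in auto)
    also have "\<dots> = (LINT s|lborel. \<bar>e\<bar> *\<^sub>R (u (x + e * s)
      * of_real (std_normal_density ((x + e * s - x) / e) / e)))"
      by (rule integral_scaleR_right[symmetric])
    also have "\<dots> = (LINT s|lborel. u (x + e * s) * of_real (std_normal_density s))"
      using e by (intro Bochner_Integration.integral_cong refl) (simp add: scaleR_conv_of_real)
    finally show ?thesis .
  qed
  have e0: "(\<lambda>k. 1 / real (Suc k)) \<longlonglongrightarrow> 0" by (rule LIMSEQ_Suc[OF lim_1_over_n])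
  have "(\<lambda>k. LINT t|lborel. U t * cis (- (x * t)) * of_real (G (1 / real (Suc k)) t))
    \<longlonglongrightarrow> (LINT t|lborel. U t * cis (- (x * t)))"
  proof (rule integral_dominated_convergence[where w="\<lambda>t. norm (U t)"])
    show "AE t in lborel. (\<lambda>k. U t * cis (- (x * t)) * of_real (G (1 / real (Suc k)) t)) \<longlonglongrightarrow> U t
      * cis (- (x * t))"
    proof (rule AE_I2)
      fix t
      have "(\<lambda>k. U t * cis (- (x * t)) * of_real (exp (- (1 / real (Suc k) * t)\<^sup>2 / 2))) \<longlonglongrightarrow> U t
        * cis (- (x * t)) * of_real (exp (- (0 * t)\<^sup>2 / 2))"
        by (intro tendsto_intros e0) auto
      then show "(\<lambda>k. U t * cis (- (x * t)) * of_real (G (1 / real (Suc k)) t)) \<longlonglongrightarrow> U t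
        * cis (- (x * t))"
        by (simp add: G_def)
    qed
  qed (use U in \<open>auto simp: norm_mult G_def mult_left_le\<close>)
  moreover have "(\<lambda>k. LINT s|lborel. u (x + 1 / real (Suc k) * s) * of_real (std_normal_density s))
    \<longlonglongrightarrow> (LINT s|lborel. u x * of_real (std_normal_density s))"
  proof (rule integral_dominated_convergence[where w="\<lambda>s. B * std_normal_density s"])
    show "AE s in lborel. (\<lambda>k. u (x + 1 / real (Suc k) * s) * of_real (std_normal_density s)) \<longlonglongrightarrow> u x
      * of_real (std_normal_density s)"
    proof (rule AE_I2)
      fix s
      have "(\<lambda>k. x + 1 / real (Suc k) * s) \<longlonglongrightarrow> x + 0 * s" by (intro tendsto_intros e0)
      then have "(\<lambda>k. u (x + 1 / real (Suc k) * s)) \<longlonglongrightarrow> u (x + 0 * s)"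
        using c continuous_on_tendsto_compose[of UNIV u] by auto
      then show "(\<lambda>k. u (x + 1 / real (Suc k) * s) * of_real (std_normal_density s)) \<longlonglongrightarrow> u x
        * of_real (std_normal_density s)"
        by (auto intro: tendsto_intros)
    qed
  qed (use B in \<open>auto simp: norm_mult intro!: mult_right_mono\<close>)
  ultimately have "(LINT t|lborel. U t * cis (- (x * t)))
    = (LINT s|lborel. u x * of_real (std_normal_density s))"
    using LIMSEQ_unique key by (simp add: key)
  also have "\<dots> = u x"
    using char_normal_integral[of 0] by simp
  finally show ?thesis .
qed

section \<open>Kernels of a dyadic system\<close>

text \<open>The supports in \<open>dyadic_system\<close> are closed sets that may touch at a radius
  2^(n+1) for indices n and n + 2. Approaching such a radius from outside a support shows that the
  function vanishes there too, so only immediate neighbours can be non-zero at the same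
  point.\<close>

lemma limit_point_zero:
  assumes c: "continuous_on UNIV (g :: real \<Rightarrow> complex)"
    and z: "\<And>k. g (x * (1 + e / real (Suc k))) = 0"
  shows "g x = 0"
proof -
  have e0: "(\<lambda>k. 1 / real (Suc k)) \<longlonglongrightarrow> 0" by (rule LIMSEQ_Suc[OF lim_1_over_n])
  have "(\<lambda>k. x * (1 + e * (1 / real (Suc k)))) \<longlonglongrightarrow> x * (1 + e * 0)"
    by (intro tendsto_mult tendsto_add tendsto_const e0)
  then have "(\<lambda>k. g (x * (1 + e * (1 / real (Suc k))))) \<longlonglongrightarrow> g (x * (1 + e * 0))"
    using c continuous_on_tendsto_compose[of UNIV g] by auto
  moreover have "g (x * (1 + e * (1 / real (Suc k)))) = 0" for k
    using z[of k] by (simp only: times_divide_eq_right mult_1_right)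
  ultimately have "(\<lambda>k. 0) \<longlonglongrightarrow> g (x * (1 + e * 0))" by (simp only:)
  then show ?thesis by (simp add: LIMSEQ_const_iff)
qed

section \<open>Symbols of a dyadic system and their reproducing neighbours\<close>

locale dyadic =
  fixes \<phi> :: "nat \<Rightarrow> real \<Rightarrow> complex"
  assumes sys: "dyadic_system \<phi>"
begin

definition phi_deriv :: "nat \<Rightarrow> nat \<Rightarrow> real \<Rightarrow> complex" where
  "phi_deriv n l = nth_vector_deriv l (\<phi> n)"

lemma phi_deriv_0 [simp]: "phi_deriv n 0 = \<phi> n"
  by (simp add: phi_deriv_def nth_vector_deriv_def)

lemma phi_deriv_step: "(phi_deriv n l has_vector_derivative phi_deriv n (Suc l) x) (at x)"
proof -
  have "phi_deriv n l differentiable (at x)"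
    using sys by (auto simp: dyadic_system_def test_function_def phi_deriv_def)
  then show ?thesis
    by (simp add: phi_deriv_def nth_vector_deriv_def vector_derivative_works)
qed

lemma phi_deriv_cont: "continuous_on UNIV (phi_deriv n l)"
  using phi_deriv_step by (meson continuous_at_imp_continuous_on has_vector_derivative_continuous)

lemma phi_cont: "continuous_on UNIV (\<phi> n)"
  using phi_deriv_cont[of n 0] by simp

lemma phi_supp: "supp (\<phi> n) \<subseteq> {x. \<bar>x\<bar> \<le> 2 ^ (n + 1)}"
  and phi_supp': "n \<ge> 1 \<Longrightarrow> supp (\<phi> n) \<subseteq> {x. 2 ^ (n - 1) \<le> \<bar>x\<bar>}"
proof -
  have 0: "supp (\<phi> 0) \<subseteq> {x. \<bar>x\<bar> \<le> 2}"
    and 1: "n \<ge> 1 \<Longrightarrow> supp (\<phi> n) \<subseteq> {x. 2 ^ (n - 1) \<le> \<bar>x\<bar> \<and> \<bar>x\<bar> \<le> 2 ^ (n + 1)}"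
    using sys by (auto simp: dyadic_system_def)
  show "supp (\<phi> n) \<subseteq> {x. \<bar>x\<bar> \<le> 2 ^ (n + 1)}"
    using 0 1 by (cases "n = 0") auto
  show "n \<ge> 1 \<Longrightarrow> supp (\<phi> n) \<subseteq> {x. 2 ^ (n - 1) \<le> \<bar>x\<bar>}" using 1 by auto
qed

lemma phi_nonzero: "\<phi> n x \<noteq> 0 \<Longrightarrow> x \<in> supp (\<phi> n)"
  using closure_subset[of "{x. \<phi> n x \<noteq> 0}"] by (auto simp: supp_def)

lemma phi_zero: "2 ^ (n + 1) \<le> \<bar>x\<bar> \<Longrightarrow> \<phi> n x = 0"
proof (rule limit_point_zero[OF phi_cont, of _ _ 1])
  fix k assume x: "2 ^ (n + 1) \<le> \<bar>x\<bar>"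
  have "\<bar>x\<bar> > 0" using x zero_less_power[of "2::real" "n+1"] by linarith
  then have "\<bar>x\<bar> * 1 < \<bar>x\<bar> * (1 + 1 / real (Suc k))" by (intro mult_strict_left_mono) auto
  then have "2 ^ (n + 1) < \<bar>x * (1 + 1 / real (Suc k))\<bar>"
    using x by (simp add: abs_mult abs_of_pos)
  then show "\<phi> n (x * (1 + 1 / real (Suc k))) = 0"
    using phi_nonzero phi_supp[of n] by force
qed

lemma phi_zero': "n \<ge> 1 \<Longrightarrow> \<bar>x\<bar> \<le> 2 ^ (n - 1) \<Longrightarrow> \<phi> n x = 0"
proof (rule limit_point_zero[OF phi_cont, of _ _ "-1"])
  fix k assume n: "n \<ge> 1" and x: "\<bar>x\<bar> \<le> 2 ^ (n - 1)"
  have *: "\<bar>x * (1 + - 1 / real (Suc k))\<bar> < 2 ^ (n - 1)"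
  proof (cases "x = 0")
    case False
    have "\<bar>x * (1 + - 1 / real (Suc k))\<bar> = \<bar>x\<bar> * (1 - 1 / real (Suc k))"
    proof -
      have "1 + - 1 / real (Suc k) = 1 - 1 / real (Suc k)" and "1 - 1 / real (Suc k) \<ge> 0" by auto
      then show ?thesis by (simp only: abs_mult abs_of_nonneg)
    qed
    also have "\<dots> < \<bar>x\<bar> * 1" using False by (intro mult_strict_left_mono) auto
    finally show ?thesis using x by simp
  qed simp
  show "\<phi> n (x * (1 + - 1 / real (Suc k))) = 0"
  proof (rule ccontr)
    assume "\<phi> n (x * (1 + - 1 / real (Suc k))) \<noteq> 0"
    from phi_nonzero[OF this] phi_supp'[OF n] * show False by auto
  qed
qed

lemma phi_neighbours:
  assumes "\<phi> n x \<noteq> 0" "\<phi> m x \<noteq> 0"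
  shows "n \<le> m + 1"
proof (rule ccontr)
  assume "\<not> n \<le> m + 1"
  then have "m + 1 \<le> n - 1" "n \<ge> 1" by auto
  then have "(2::real) ^ (m + 1) \<le> 2 ^ (n - 1)" by (intro power_increasing) auto
  moreover have "\<bar>x\<bar> < 2 ^ (m + 1)" using phi_zero[of m x] assms(2) by force
  moreover have "\<bar>x\<bar> > 2 ^ (n - 1)" using phi_zero'[of n x] assms(1) \<open>n \<ge> 1\<close> by force
  ultimately show False by simp
qed

text \<open>The sum over the neighbours equals \<open>1\<close> on the support of \<open>\<phi> n\<close>. For \<open>n = 0\<close> the
  truncated subtraction leaves two terms.\<close>

definition psi :: "nat \<Rightarrow> nat \<Rightarrow> real \<Rightarrow> complex" where
  "psi n l x = (\<Sum>m\<in>{n - 1..n + 1}. phi_deriv m l x)"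

lemma psi_one: "\<phi> n x \<noteq> 0 \<Longrightarrow> psi n 0 x = 1"
proof -
  assume x: "\<phi> n x \<noteq> 0"
  have "(\<lambda>m. \<phi> m x) sums (\<Sum>m\<in>{n - 1..n + 1}. \<phi> m x)"
    by (rule sums_finite) (use x phi_neighbours[OF x] phi_neighbours[OF _ x] in force)+
  moreover have "(\<lambda>m. \<phi> m x) sums 1" using sys by (auto simp: dyadic_system_def)
  ultimately show ?thesis using sums_unique2 by (auto simp: psi_def)
qed

lemma psi_deriv: "(psi n l has_vector_derivative psi n (Suc l) x) (at x)"
  unfolding psi_def[abs_def] by (rule has_vector_derivative_sum) (rule phi_deriv_step)

lemma psi_cont: "continuous_on UNIV (psi n l)"
  unfolding psi_def[abs_def] by (intro continuous_intros phi_deriv_cont)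

lemma phi_deriv_zero: "2 ^ (n + 1) < \<bar>x\<bar> \<Longrightarrow> phi_deriv n l x = 0"
proof (induction l arbitrary: x)
  case (Suc l)
  have "open {x :: real. 2 ^ (n + 1) < \<bar>x\<bar>}"
    by (intro open_Collect_less continuous_intros)
  then have "(phi_deriv n l has_vector_derivative 0) (at x)"
    using has_vector_derivative_transform_within_open[OF has_vector_derivative_const, of
      "{x. 2 ^ (n + 1) < \<bar>x\<bar>}" x 0 "phi_deriv n l"]
      Suc by auto
  then show ?case using phi_deriv_step vector_derivative_unique_at by blast
qed (use phi_zero in force)

lemma phi_deriv_bound: "\<exists>B\<ge>0. \<forall>n x. norm (phi_deriv n l x) \<le> B * (1 / 2 ^ n) ^ l"
proof -
  obtain B where B: "\<And>n x. 2 ^ (n * l) * norm (phi_deriv n l x) \<le> B"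
    using sys unfolding dyadic_system_def phi_deriv_def by blast
  have "B \<ge> 0" using B[of 0 0] norm_ge_zero[of "phi_deriv 0 l 0"] by (simp del: norm_ge_zero)
  moreover have "norm (phi_deriv n l x) \<le> B * (1 / 2 ^ n) ^ l" for n x
    using B[of n x] by (simp add: power_one_over field_simps flip: power_mult)
  ultimately show ?thesis by blast
qed

text \<open>Four derivatives are what \<open>multiplier_kernel_decay\<close> consumes. A neighbour m
  of n satisfies 2^-m \<le> 2 * 2^-n, which costs at most 2^4 = 16 over four derivatives. There are
  at most three neighbours, and the largest is supported in |x| \<le> 2^(n+2).\<close>

lemma psi_bound:
  "\<exists>B\<ge>0. \<forall>n. \<forall>l\<le>4. \<forall>x. norm (psi n l x) \<le> B * (1 / 2 ^ n) ^ l
    * indicator {- (2 ^ (n + 2))..2 ^ (n + 2)} x"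
proof -
  obtain b where b: "\<And>l. b l \<ge> 0" "\<And>l n x. norm (phi_deriv n l x) \<le> b l * (1 / 2 ^ n) ^ l"
    using phi_deriv_bound by metis
  define B where "B = 16 * (\<Sum>l\<le>4. b l)"
  have "norm (psi n l x) \<le> 3 * B * (1 / 2 ^ n) ^ l * indicator {- (2 ^ (n + 2))..2 ^ (n + 2)} x"
    if l: "l \<le> 4" for n l x
  proof (cases "x \<in> {- (2 ^ (n + 2))..2 ^ (n + 2)}")
    case False
    then have x: "2 ^ (n + 2) < \<bar>x\<bar>" by auto
    have "phi_deriv m l x = 0" if "m \<in> {n - 1..n + 1}" for m
    proof (rule phi_deriv_zero)
      have "(2::real) ^ (m + 1) \<le> 2 ^ (n + 2)" using that by (intro power_increasing) auto
      then show "2 ^ (m + 1) < \<bar>x\<bar>" using x by linarith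
    qed
    then have "psi n l x = 0" unfolding psi_def by (intro sum.neutral) auto
    then show ?thesis using False by simp
  next
    case True
    have "norm (phi_deriv m l x) \<le> B * (1 / 2 ^ n) ^ l" if m: "m \<in> {n - 1..n + 1}" for m
    proof -
      have "b l \<le> (\<Sum>l\<le>4. b l)" by (rule member_le_sum) (use l b in auto)
      have "(1 / 2 ^ m :: real) \<le> 2 * (1 / 2 ^ n)"
      proof -
        have "(2::real) ^ n \<le> 2 ^ (m + 1)" using m by (intro power_increasing) auto
        then show ?thesis by (simp add: field_simps)
      qed
      then have "(1 / 2 ^ m :: real) ^ l \<le> (2 * (1 / 2 ^ n)) ^ l" by (intro power_mono) auto
      also have "\<dots> = 2 ^ l * (1 / 2 ^ n) ^ l" by (rule power_mult_distrib)
      also have "\<dots> \<le> 2 ^ 4 * (1 / 2 ^ n) ^ l"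
        using l by (intro mult_right_mono power_increasing) auto
      finally have p: "(1 / 2 ^ m :: real) ^ l \<le> 16 * (1 / 2 ^ n) ^ l" by simp
      have "norm (phi_deriv m l x) \<le> b l * (1 / 2 ^ m) ^ l" by (rule b)
      also have "\<dots> \<le> (\<Sum>l\<le>4. b l) * (16 * (1 / 2 ^ n) ^ l)"
        using p \<open>b l \<le> _\<close> b(1) by (intro mult_mono) (auto intro!: sum_nonneg)
      finally show ?thesis by (simp add: B_def)
    qed
    then have "norm (psi n l x) \<le> real (card {n - 1..n + 1}) * (B * (1 / 2 ^ n) ^ l)"
      unfolding psi_def by (rule sum_norm_bound)
    also have "\<dots> \<le> 3 * (B * (1 / 2 ^ n) ^ l)"
      by (intro mult_right_mono) (auto simp: B_def b intro!: mult_nonneg_nonneg sum_nonneg)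
    finally show ?thesis using True by simp
  qed
  moreover have "3 * B \<ge> 0" by (auto simp: B_def b intro!: sum_nonneg)
  ultimately show ?thesis by blast
qed

text \<open>The whole factor 1/(2 pi) is placed here, so that the forward transform in
  \<open>Psi_inversion\<close> carries none and convolution with \<open>Psi n\<close> multiplies the
  symbol by \<open>psi n 0\<close>.\<close>

definition Psi :: "nat \<Rightarrow> real \<Rightarrow> complex" where
  "Psi n t = (LINT x|lborel. psi n 0 x * cis (t * x)) / of_real (2 * pi)"

lemma Psi_bound: "\<exists>C>0. \<forall>n t. norm (Psi n t) \<le> C * 2 ^ n / (1 + (2 ^ n * t)\<^sup>2)\<^sup>2"
proof -
  obtain B where B: "B \<ge> 0" "\<And>n l x. l \<le> 4 \<Longrightarrow> norm (psi n l x) \<le> B * (1 / 2 ^ n) ^ l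
    * indicator {- (2 ^ (n + 2))..2 ^ (n + 2)} x"
    using psi_bound by blast
  have "norm (Psi n t) \<le> (32 * B + 1) * 2 ^ n / (1 + (2 ^ n * t)\<^sup>2)\<^sup>2" for n t
  proof -
    have "norm (Psi n t) = norm (LINT x|lborel. psi n 0 x * cis (t * x)) / (2 * pi)"
      by (simp add: Psi_def norm_divide norm_mult)
    also have "\<dots> \<le> norm (LINT x|lborel. psi n 0 x * cis (t * x)) / 1"
      using pi_gt3 by (intro divide_left_mono) auto
    also have "\<dots> \<le> 32 * B * 2 ^ n / (1 + (2 ^ n * t)\<^sup>2)\<^sup>2"
      using multiplier_kernel_decay[of "psi n" B n t] psi_deriv psi_cont B(2) by simp
    also have "\<dots> \<le> (32 * B + 1) * 2 ^ n / (1 + (2 ^ n * t)\<^sup>2)\<^sup>2"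
      by (intro divide_right_mono mult_right_mono) auto
    finally show ?thesis .
  qed
  moreover have "32 * B + 1 > 0" using B by simp
  ultimately show ?thesis by blast
qed

end

section \<open>Second differences of the kernels\<close>

text \<open>The \<open>l\<close>-th derivative of \<open>(cis (h * x) - 1)\<^sup>2\<close>, the symbol of the second difference with
  step \<open>h\<close>.\<close>

definition diff2_symbol :: "real \<Rightarrow> nat \<Rightarrow> real \<Rightarrow> complex" where
  "diff2_symbol h l x = (\<i> * of_real (2 * h)) ^ l * cis (2 * h * x) - 2 * (\<i> * of_real h) ^ l
    * cis (h * x)
     + (if l = 0 then 1 else 0)"

lemma diff2_symbol_deriv: "(diff2_symbol h l has_vector_derivative diff2_symbol h (Suc l) x) (at x)"
  unfolding diff2_symbol_def[abs_def]
  by (rule derivative_eq_intros cis_vector_derivative refl has_vector_derivative_mult_right)+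
    (simp add: algebra_simps)

lemma norm_cis_diff: "norm (cis t - 1) \<le> \<bar>t\<bar>"
proof -
  have "(norm (cis t - 1))\<^sup>2 = (cos t - 1)\<^sup>2 + (sin t)\<^sup>2"
    by (simp add: cmod_power2)
  also have "\<dots> = 4 * (sin (t / 2))\<^sup>2"
    using cos_double_sin[of "t / 2"] sin_cos_squared_add[of t]
      by (simp add: power2_eq_square algebra_simps)
  also have "\<dots> \<le> 4 * \<bar>t / 2\<bar>\<^sup>2"
    using abs_sin_x_le_abs_x[of "t / 2"] power_mono[of "\<bar>sin (t / 2)\<bar>" "\<bar>t / 2\<bar>" 2] by simp
  also have "\<dots> = \<bar>t\<bar>\<^sup>2" by (simp add: power_divide)
  finally show ?thesis by (rule power2_le_imp_le) simp
qed

text \<open>The symbol is (cis(hx) - 1)^2, so orders 0 and 1 keep two and one small factors of size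
  at most 4 h 2^n. From order 2 on the powers of h produced by differentiation suffice, because h
  2^n \<le> 1. The constant 18 is 2^4 + 2, met at order 4.\<close>

lemma diff2_symbol_bound:
  assumes h: "0 \<le> h" "h * 2 ^ n \<le> 1" and x: "\<bar>x\<bar> \<le> 2 ^ (n + 2)" and l: "l \<le> 4"
  shows "norm (diff2_symbol h l x) \<le> 18 * (h * 2 ^ n)\<^sup>2 * (1 / 2 ^ n) ^ l"
proof -
  define e where "e = h * 2 ^ n"
  define p :: real where "p = 1 / 2 ^ n"
  have e: "0 \<le> e" "e \<le> 1" and p: "p > 0" using h by (auto simp: e_def p_def)
  have h_eq: "h = e * p" by (simp add: e_def p_def)
  have c2: "cis (2 * h * x) = cis (h * x) * cis (h * x)" by (simp add: cis_mult mult.assoc)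
  have nx: "norm (cis (h * x) - 1) \<le> 4 * e"
  proof -
    have "norm (cis (h * x) - 1) \<le> \<bar>h * x\<bar>" by (rule norm_cis_diff)
    also have "\<dots> \<le> h * 2 ^ (n + 2)" using x h by (simp add: abs_mult mult_left_mono)
    finally show ?thesis by (simp add: e_def)
  qed
  have tri: "norm (diff2_symbol h k x) \<le> (2 ^ k + 2) * h ^ k" if "k \<noteq> 0" for k
  proof -
    have "norm (diff2_symbol h k x) \<le> norm ((\<i> * of_real (2 * h)) ^ k * cis (2 * h * x))
      + norm (2 * (\<i> * of_real h) ^ k * cis (h * x))"
      using that by (simp add: diff2_symbol_def norm_triangle_ineq4)
    also have "\<dots> = (2 ^ k + 2) * h ^ k"
      using h by (simp add: norm_mult norm_power power_mult_distrib algebra_simps)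
    finally show ?thesis .
  qed
  consider "l = 0" | "l = 1" | "l = 2" | "l = 3" | "l = 4" using l by linarith
  then have "norm (diff2_symbol h l x) \<le> 18 * e\<^sup>2 * p ^ l"
  proof cases
    case 1
    have "diff2_symbol h 0 x = (cis (h * x) - 1)\<^sup>2"
      unfolding diff2_symbol_def c2 by (simp add: power2_eq_square algebra_simps)
    then have "norm (diff2_symbol h 0 x) \<le> (4 * e)\<^sup>2"
      using power_mono[OF nx norm_ge_zero, of 2] by (simp add: norm_power)
    then have "norm (diff2_symbol h 0 x) \<le> 16 * e\<^sup>2" by (simp add: power_mult_distrib)
    moreover have "e\<^sup>2 \<ge> 0" by simp
    ultimately have "norm (diff2_symbol h 0 x) \<le> 18 * e\<^sup>2" by linarith
    then show ?thesis using 1 by simp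
  next
    case 2
    have "diff2_symbol h 1 x = 2 * \<i> * of_real h * cis (h * x) * (cis (h * x) - 1)"
      unfolding diff2_symbol_def c2 by (simp add: algebra_simps)
    then have "norm (diff2_symbol h 1 x) = 2 * h * norm (cis (h * x) - 1)"
      using h by (simp add: norm_mult)
    also have "\<dots> \<le> 2 * h * (4 * e)" using nx h by (intro mult_left_mono) auto
    also have "\<dots> = 8 * e\<^sup>2 * p" by (simp add: h_eq power2_eq_square)
    also have "\<dots> \<le> 18 * e\<^sup>2 * p" using p by (intro mult_right_mono) auto
    finally show ?thesis using 2 by simp
  next
    case 3
    have "6 * (e\<^sup>2 * p\<^sup>2) \<le> 18 * (e\<^sup>2 * p\<^sup>2)" by (intro mult_right_mono) auto
    moreover have "norm (diff2_symbol h 2 x) \<le> 6 * (e ^ 2 * p ^ 2)" using tri[of 2]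
      by (simp add: h_eq power_mult_distrib)
    ultimately show ?thesis unfolding 3 mult.assoc by (rule order_trans[rotated])
  next
    case 4
    have "e ^ 3 \<le> e\<^sup>2" using e by (intro power_decreasing) auto
    then have "e ^ 3 * p ^ 3 \<le> e\<^sup>2 * p ^ 3" using p by (intro mult_right_mono) auto
    moreover have "e\<^sup>2 * p ^ 3 \<ge> 0" using p by simp
    ultimately have "10 * (e ^ 3 * p ^ 3) \<le> 18 * (e\<^sup>2 * p ^ 3)" by linarith
    moreover have "norm (diff2_symbol h 3 x) \<le> 10 * (e ^ 3 * p ^ 3)" using tri[of 3]
      by (simp add: h_eq power_mult_distrib)
    ultimately show ?thesis unfolding 4 mult.assoc by (rule order_trans[rotated])
  next
    case 5
    have "e ^ 4 \<le> e\<^sup>2" using e by (intro power_decreasing) auto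
    then have "e ^ 4 * p ^ 4 \<le> e\<^sup>2 * p ^ 4" using p by (intro mult_right_mono) auto
    then have "18 * (e ^ 4 * p ^ 4) \<le> 18 * (e\<^sup>2 * p ^ 4)" by linarith
    moreover have "norm (diff2_symbol h 4 x) \<le> 18 * (e ^ 4 * p ^ 4)" using tri[of 4]
      by (simp add: h_eq power_mult_distrib)
    ultimately show ?thesis unfolding 5 mult.assoc by (rule order_trans[rotated])
  qed
  then show ?thesis by (simp add: e_def p_def)
qed

context dyadic
begin

text \<open>A second difference of \<open>Psi n\<close> multiplies its symbol by
  \<open>diff2_symbol\<close>, whose derivatives scale like those of \<open>psi\<close> with the
  extra factor (h 2^n)^2. The decay argument for \<open>Psi\<close> therefore applies to the product
  of the two symbols.\<close>

lemma Psi_diff2_bound: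
  "\<exists>C>0. \<forall>n t h. 0 \<le> h \<longrightarrow> h * 2 ^ n \<le> 1 \<longrightarrow>
     norm (Psi n (t + 2 * h) - 2 * Psi n (t + h) + Psi n t) \<le> C * (h * 2 ^ n)\<^sup>2
       * 2 ^ n / (1 + (2 ^ n * t)\<^sup>2)\<^sup>2"
proof -
  obtain B where B: "B \<ge> 0" "\<And>n l x. l \<le> 4 \<Longrightarrow> norm (psi n l x) \<le> B * (1 / 2 ^ n) ^ l
    * indicator {- (2 ^ (n + 2))..2 ^ (n + 2)} x"
    using psi_bound by blast
  have main: "norm (Psi n (t + 2 * h) - 2 * Psi n (t + h) + Psi n t) \<le> (32 * (16 * (B * 18)) + 1)
    * (h * 2 ^ n)\<^sup>2 * 2 ^ n / (1 + (2 ^ n * t)\<^sup>2)\<^sup>2"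
    if h: "0 \<le> h" "h * 2 ^ n \<le> 1" for n t h
  proof -
    \<comment> \<open>The Leibniz formula: \<open>v l\<close> is the l-th derivative of
      \<open>v 0\<close> for all orders used. In the bound below the binomial coefficients add up to
      2^l \<le> 16.\<close>
    define v where "v l x = (\<Sum>i\<le>l. of_nat (l choose i) * (psi n i x * diff2_symbol h (l - i) x))"
      for l x
    define A where "A = 18 * (h * 2 ^ n)\<^sup>2"
    have A: "A \<ge> 0" by (simp add: A_def)
    have pz: "psi n l x = 0" if "l \<le> 4" "x \<notin> {- (2 ^ (n + 2))..2 ^ (n + 2)}" for l x
      using B(2)[OF that(1), of n x] that(2) by simp
    have vd: "(v l has_vector_derivative v (Suc l) x) (at x)" if "l < 4" for l x
    proof -
      have "((\<lambda>x. psi n i x * diff2_symbol h k x) has_vector_derivative psi n i x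
        * diff2_symbol h (Suc k) x + psi n (Suc i) x * diff2_symbol h k x) (at x)" for i k
        using has_vector_derivative_mult[OF psi_deriv diff2_symbol_deriv] .
      then have "(v l has_vector_derivative (\<Sum>i\<le>l. of_nat (l choose i)
        * (psi n i x * diff2_symbol h (Suc (l - i)) x + psi n (Suc i) x * diff2_symbol h (l - i)
        x))) (at x)"
        unfolding v_def[abs_def]
        by (intro has_vector_derivative_sum has_vector_derivative_mult_right)
      moreover have "(\<Sum>i\<le>l. of_nat (l choose i) * (psi n i x * diff2_symbol h (Suc (l - i)) x
        + psi n (Suc i) x * diff2_symbol h (l - i) x)) = v (Suc l) x"
      proof -
        consider "l = 0" | "l = 1" | "l = 2" | "l = 3" using \<open>l < 4\<close> by linarith
        then show ?thesis unfolding v_def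
          by cases (simp_all add: numeral_2_eq_2 numeral_3_eq_3 algebra_simps)
      qed
      ultimately show ?thesis by simp
    qed
    have vc: "continuous_on UNIV (v 4)"
    proof -
      have "continuous_on UNIV (diff2_symbol h k)" for k
        using diff2_symbol_deriv by (meson continuous_at_imp_continuous_on
          has_vector_derivative_continuous)
      then show ?thesis unfolding v_def[abs_def] by (intro continuous_intros psi_cont)
    qed
    have vb: "norm (v l x) \<le> (16 * (B * A)) * (1 / 2 ^ n) ^ l
      * indicator {- (2 ^ (n + 2))..2 ^ (n + 2)} x" if l: "l \<le> 4" for l x
    proof (cases "x \<in> {- (2 ^ (n + 2))..2 ^ (n + 2)}")
      case False
      then show ?thesis using pz l by (simp add: v_def)
    next
      case True
      have "norm (v l x) \<le> (\<Sum>i\<le>l. norm (of_nat (l choose i)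
        * (psi n i x * diff2_symbol h (l - i) x)))"
        unfolding v_def by (rule norm_sum)
      also have "\<dots> \<le> (\<Sum>i\<le>l. real (l choose i) * (B * A * (1 / 2 ^ n) ^ l))"
      proof (intro sum_mono)
        fix i assume i: "i \<in> {..l}"
        have "norm (psi n i x) * norm (diff2_symbol h (l - i) x) \<le> (B * (1 / 2 ^ n) ^ i)
          * (A * (1 / 2 ^ n) ^ (l - i))"
          using B(2)[of i n x] diff2_symbol_bound[OF h, of x "l - i"] True i l B(1) A
          by (intro mult_mono) (auto simp: A_def abs_le_iff)
        also have "\<dots> = B * A * (1 / 2 ^ n) ^ l"
          using i power_add[of "1 / 2 ^ n :: real" i "l - i"] by (simp add: mult_ac)
        finally show "norm (of_nat (l choose i) * (psi n i x * diff2_symbol h (l - i) x))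
          \<le> real (l choose i) * (B * A * (1 / 2 ^ n) ^ l)"
          by (simp add: norm_mult mult_left_mono)
      qed
      also have "\<dots> = real (\<Sum>i\<le>l. l choose i) * (B * A * (1 / 2 ^ n) ^ l)"
        by (simp add: sum_distrib_right)
      also have "\<dots> = 2 ^ l * (B * A * (1 / 2 ^ n) ^ l)" by (simp add: choose_row_sum)
      also have "\<dots> \<le> 2 ^ 4 * (B * A * (1 / 2 ^ n) ^ l)"
        using l B(1) A by (intro mult_right_mono power_increasing mult_nonneg_nonneg) auto
      finally show ?thesis using True by simp
    qed
    have int: "integrable lborel (\<lambda>x. psi n 0 x * cis (s * x))" for s
    proof (rule integrable_compact_support[of _ "2 ^ (n + 2)"])
      show "continuous_on UNIV (\<lambda>x. psi n 0 x * cis (s * x))" by (intro continuous_intros psi_cont)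
      show "psi n 0 x * cis (s * x) = 0" if "2 ^ (n + 2) < \<bar>x\<bar>" for x
      proof -
        have "x \<notin> {- (2 ^ (n + 2))..2 ^ (n + 2)}" using that by (auto simp: abs_if split: if_splits)
        then have "psi n 0 x = 0" by (rule pz[rotated]) simp
        then show ?thesis by (simp only: mult_zero_left)
      qed
    qed
    have "Psi n (t + 2 * h) - 2 * Psi n (t + h) + Psi n t =
      ((LINT x|lborel. psi n 0 x * cis ((t + 2 * h) * x))
        - (LINT x|lborel. 2 * (psi n 0 x * cis ((t + h) * x)))
        + (LINT x|lborel. psi n 0 x * cis (t * x))) / of_real (2 * pi)"
      by (simp add: Psi_def diff_divide_distrib add_divide_distrib)
    also have "(LINT x|lborel. psi n 0 x * cis ((t + 2 * h) * x))
      - (LINT x|lborel. 2 * (psi n 0 x * cis ((t + h) * x)))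
      + (LINT x|lborel. psi n 0 x * cis (t * x))
       = (LINT x|lborel. v 0 x * cis (t * x))"
    proof (subst Bochner_Integration.integral_diff[symmetric], rule int,
      intro integrable_mult_right int,
        subst Bochner_Integration.integral_add[symmetric])
      show "(LINT x|lborel. psi n 0 x * cis ((t + 2 * h) * x) - 2 * (psi n 0 x * cis ((t + h) * x))
        + psi n 0 x * cis (t * x)) = (LINT x|lborel. v 0 x * cis (t * x))"
      proof (intro Bochner_Integration.integral_cong refl)
        fix x
        have "cis ((t + 2 * h) * x) = cis (t * x) * cis (2 * h * x)" "cis ((t + h) * x)
          = cis (t * x) * cis (h * x)"
          by (simp_all add: cis_mult distrib_right)
        then show "psi n 0 x * cis ((t + 2 * h) * x) - 2 * (psi n 0 x * cis ((t + h) * x))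
          + psi n 0 x * cis (t * x) = v 0 x * cis (t * x)"
          by (simp add: v_def diff2_symbol_def algebra_simps)
      qed
    qed (intro Bochner_Integration.integrable_diff integrable_mult_right int)+
    finally have "norm (Psi n (t + 2 * h) - 2 * Psi n (t + h) + Psi n t)
      = norm (LINT x|lborel. v 0 x * cis (t * x)) / (2 * pi)"
      by (simp add: norm_divide norm_mult)
    also have "\<dots> \<le> norm (LINT x|lborel. v 0 x * cis (t * x)) / 1"
      using pi_gt3 by (intro divide_left_mono) auto
    also have "\<dots> \<le> 32 * (16 * (B * A)) * 2 ^ n / (1 + (2 ^ n * t)\<^sup>2)\<^sup>2"
      using multiplier_kernel_decay[of v "16 * (B * A)" n t] vd vc vb by simp
    also have "\<dots> = (32 * (16 * (B * 18))) * ((h * 2 ^ n)\<^sup>2 * 2 ^ n) / (1 + (2 ^ n * t)\<^sup>2)\<^sup>2"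
      by (simp add: A_def)
    also have "\<dots> \<le> (32 * (16 * (B * 18)) + 1) * ((h * 2 ^ n)\<^sup>2 * 2 ^ n) / (1 + (2 ^ n * t)\<^sup>2)\<^sup>2"
      by (intro divide_right_mono mult_right_mono) auto
    finally show ?thesis by (simp only: mult.assoc)
  qed
  have "32 * (16 * (B * 18)) + 1 > 0" using B(1) by simp
  with main show ?thesis by blast
qed

end

section \<open>Product kernels and a sub-mean-value inequality\<close>

abbreviation nat_box :: "nat \<Rightarrow> (nat^'d) set" where
  "nat_box N \<equiv> {l. \<forall>i. l $ i \<in> {..N}}"

text \<open>The levels -1 to N - 1 together represent interpolation on the grid of mesh 2^-N, see
  \<open>interpolation\<close>; hence the shift by one.\<close>

abbreviation level_box :: "nat \<Rightarrow> (int^'d) set" where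
  "level_box N \<equiv> {j. \<forall>i. j $ i \<in> {-1..int N - 1}}"

abbreviation stencil_prod :: "int^'d \<Rightarrow> nat^'d \<Rightarrow> complex" where
  "stencil_prod j \<sigma> \<equiv> \<Prod>i\<in>UNIV. stencil_coeff (j $ i) (\<sigma> $ i)"

section \<open>Products over the coordinates and Lebesgue measure\<close>

lemma sum_vec_reindex:
  fixes X :: "'d::finite \<Rightarrow> 'a set"
  shows "(\<Sum>k\<in>{k :: 'a^'d. \<forall>i. k $ i \<in> X i}. G k) = (\<Sum>k\<in>Pi\<^sub>E UNIV X. G (vec_lambda k))"
  by (rule sum.reindex_bij_witness[of _ vec_lambda vec_nth]) (auto simp: vec_nth_inverse)

lemma prod_sum_vec:
  fixes X :: "'d::finite \<Rightarrow> 'a set" and f :: "'d \<Rightarrow> 'a \<Rightarrow> 'b::comm_semiring_1"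
  assumes "\<And>i. finite (X i)"
  shows "(\<Prod>i\<in>UNIV. \<Sum>a\<in>X i. f i a) = (\<Sum>k\<in>{k :: 'a^'d. \<forall>i. k $ i \<in> X i}. \<Prod>i\<in>UNIV. f i (k $ i))"
  by (simp add: sum_vec_reindex prod_sum_PiE assms)

lemma prod_Basis_vec:
  "(\<Prod>b\<in>(Basis :: (real^'d) set). F b) = (\<Prod>i\<in>(UNIV :: 'd set). F (axis i (1::real)))"
proof -
  have B: "(Basis :: (real^'d) set) = (\<lambda>i. axis i 1) ` UNIV" by (auto simp: Basis_vec_def)
  have "inj (\<lambda>i::'d. axis i (1::real))" by (auto simp: inj_on_def axis_eq_axis)
  then show ?thesis unfolding B by (simp add: prod.reindex)
qed

text \<open>Inverse of the map from i to \<open>axis i 1\<close>. It lets a family indexed by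
  coordinates be read as one indexed by \<open>Basis\<close>, over which Lebesgue measure is a
  product.\<close>

definition axis_index :: "real^'d \<Rightarrow> 'd" where
  "axis_index b = (THE i. b = axis i 1)"

lemma axis_index [simp]: "axis_index (axis i 1) = i"
  unfolding axis_index_def by (rule the_equality) (auto simp: axis_eq_axis)

lemma nn_integral_tensor:
  fixes f :: "'d::finite \<Rightarrow> real \<Rightarrow> ennreal"
  assumes [measurable]: "\<And>i. f i \<in> borel_measurable borel"
  shows "(\<integral>\<^sup>+x. (\<Prod>i\<in>UNIV. f i (x $ i)) \<partial>(lborel :: (real^'d) measure))
    = (\<Prod>i\<in>UNIV. \<integral>\<^sup>+t. f i t \<partial>lborel)"
  using nn_integral_lborel_prod[of "\<lambda>b::real^'d. f (axis_index b)"]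
  by (simp add: prod_Basis_vec inner_axis)

text \<open>Lebesgue measure on the vectors is the image under \<open>T\<close> of the product
  measure over \<open>Basis\<close>, where integrals of products factorise.\<close>

lemma
  fixes f :: "'d::finite \<Rightarrow> real \<Rightarrow> complex"
  assumes f: "\<And>i. integrable lborel (f i)"
  shows integrable_tensor: "integrable (lborel :: (real^'d) measure) (\<lambda>x. \<Prod>i\<in>UNIV. f i (x $ i))"
    and integral_tensor: "(LINT x|(lborel :: (real^'d) measure). (\<Prod>i\<in>UNIV. f i (x $ i)))
      = (\<Prod>i\<in>UNIV. (LINT t|lborel. f i t))"
proof -
  interpret product_sigma_finite "\<lambda>_::real^'d. lborel :: real measure" ..
  have [measurable]: "f i \<in> borel_measurable borel" for i using f[of i] by auto
  define T :: "(real^'d \<Rightarrow> real) \<Rightarrow> real^'d" where "T = (\<lambda>g. \<Sum>b\<in>Basis. g b *\<^sub>R b)"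
  have T [measurable]: "T \<in> (\<Pi>\<^sub>M b\<in>Basis. lborel) \<rightarrow>\<^sub>M borel"
    unfolding T_def by measurable
  have L: "lborel = distr (\<Pi>\<^sub>M b\<in>Basis. lborel) borel T"
    unfolding T_def by (rule lborel_eq)
  have e: "(\<Prod>i\<in>UNIV. f i (T g $ i)) = (\<Prod>b\<in>Basis. f (axis_index b) (g b))" for g
  proof -
    have "T g $ i = g (axis i 1)" for i
    proof -
      have "T g $ i = T g \<bullet> axis i 1" by (simp add: inner_axis)
      also have "\<dots> = g (axis i 1)"
        unfolding T_def by (rule inner_sum_left_Basis) simp
      finally show ?thesis .
    qed
    then show ?thesis by (simp add: prod_Basis_vec)
  qed
  have i: "integrable (\<Pi>\<^sub>M b\<in>Basis. lborel) (\<lambda>g. \<Prod>b\<in>(Basis::(real^'d) set). f (axis_index b) (g b))"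
    by (intro product_integrable_prod f) auto
  show "integrable (lborel :: (real^'d) measure) (\<lambda>x. \<Prod>i\<in>UNIV. f i (x $ i))"
    unfolding L by (subst integrable_distr_eq) (use i in \<open>auto simp: e\<close>)
  have "(LINT x|(lborel :: (real^'d) measure). (\<Prod>i\<in>UNIV. f i (x $ i))) =
      (LINT g|(\<Pi>\<^sub>M b\<in>Basis. lborel). (\<Prod>b\<in>(Basis::(real^'d) set). f (axis_index b) (g b)))"
    unfolding L by (subst integral_distr) (auto simp: e)
  also have "\<dots> = (\<Prod>b\<in>(Basis::(real^'d) set). (LINT t|lborel. f (axis_index b) t))"
    by (intro product_integral_prod f) auto
  finally show "(LINT x|(lborel :: (real^'d) measure). (\<Prod>i\<in>UNIV. f i (x $ i)))
    = (\<Prod>i\<in>UNIV. (LINT t|lborel. f i t))"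
    by (simp add: prod_Basis_vec)
qed

text \<open>The hyperplanes through a point parallel to the axes are where \<open>bumpV\<close>
  vanishes and \<open>bumpQ\<close> is singular; they have to be negligible.\<close>

lemma AE_component_neq: "AE x in (lborel :: (real^'d) measure). x $ i \<noteq> c"
proof -
  have "negligible {x :: real^'d. x $ i = c}"
    using negligible_standard_hyperplane[of "axis i 1 :: real^'d" c] by (simp add: inner_axis)
  moreover have "closed {x :: real^'d. x $ i = c}"
    by (intro closed_Collect_eq continuous_intros)
  then have "{x :: real^'d. x $ i = c} \<in> sets lborel" by simp
  ultimately have "{x :: real^'d. x $ i = c} \<in> null_sets lborel"
    by (simp add: negligible_iff_null_sets null_sets_completion_iff)
  then show ?thesis by (auto dest: AE_not_in)
qed

section \<open>Integrable profiles and their dilated products\<close>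

lemma nn_integral_dilate:
  fixes g :: "real \<Rightarrow> real" and x :: real
  assumes [measurable]: "g \<in> borel_measurable borel" and "\<And>t. g t \<ge> 0"
  shows "(\<integral>\<^sup>+y. ennreal (2 ^ n * g (2 ^ n * (x - y))) \<partial>lborel) = (\<integral>\<^sup>+t. ennreal (g t) \<partial>lborel)"
proof -
  have "(\<integral>\<^sup>+t. ennreal (g t) \<partial>lborel) = ennreal \<bar>- (2 ^ n)\<bar>
    * (\<integral>\<^sup>+y. ennreal (g (2 ^ n * x + - (2 ^ n) * y)) \<partial>lborel)"
    by (rule nn_integral_real_affine) auto
  also have "\<dots> = (\<integral>\<^sup>+y. ennreal (2 ^ n * g (2 ^ n * (x - y))) \<partial>lborel)"
    by (subst nn_integral_cmult[symmetric]) (auto simp: ennreal_mult' assms algebra_simps intro!: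
      nn_integral_cong)
  finally show ?thesis by simp
qed

lemma integrable_inverse_1_plus_square_lborel: "integrable lborel (\<lambda>x::real. inverse (1 + x\<^sup>2))"
  using Sinc_Integral.integrable_inverse_1_plus_square
  by (simp add: set_integrable_def interval_lebesgue_integrable_def einterval_def)

lemma nn_integral_inverse_1_plus_square: "(\<integral>\<^sup>+x. ennreal (1 / (1 + x\<^sup>2)) \<partial>lborel) < \<infinity>"
proof -
  have "1 + x\<^sup>2 > (0::real)" for x by (intro add_pos_nonneg) auto
  then show ?thesis
    using integrable_inverse_1_plus_square_lborel unfolding integrable_iff_bounded
    by (simp add: inverse_eq_divide less_imp_le abs_of_pos)
qed

lemma nn_integral_inverse_1_plus_square2: "(\<integral>\<^sup>+x. ennreal (1 / (1 + x\<^sup>2)\<^sup>2) \<partial>lborel) < \<infinity>"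
proof (rule le_less_trans[OF nn_integral_mono nn_integral_inverse_1_plus_square])
  fix x :: real
  have "1 + x\<^sup>2 \<le> (1 + x\<^sup>2)\<^sup>2" using self_le_power[of "1 + x\<^sup>2" 2] by simp
  then show "ennreal (1 / (1 + x\<^sup>2)\<^sup>2) \<le> ennreal (1 / (1 + x\<^sup>2))"
    by (intro ennreal_leI divide_left_mono) (auto intro!:
      mult_pos_pos add_pos_nonneg zero_less_power)
qed

text \<open>Near 0 the singularity |s|^(-1/2) is integrable, and away from 0 the factor 1 + s^2
  suffices. The reflected copy \<open>?f (-s)\<close> takes care of negative s.\<close>

lemma nn_integral_inverse_sqrt: "(\<integral>\<^sup>+s. ennreal (1 / (sqrt \<bar>s\<bar> * (1 + s\<^sup>2))) \<partial>lborel) < \<infinity>"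
proof -
  let ?f = "\<lambda>s::real. ennreal (s powr (-1/2) * indicator {0..1} s)"
  have fin: "(\<integral>\<^sup>+s. ?f s \<partial>lborel) < \<infinity>"
  proof -
    have "(\<lambda>s::real. s powr (-1/2)) integrable_on {0..1}"
      by (rule integrable_on_powr_from_0) auto
    then have "(\<lambda>s::real. s powr (-1/2)) absolutely_integrable_on {0..1}"
      by (subst absolutely_integrable_on_iff_nonneg) auto
    then have "integrable lebesgue (\<lambda>s::real. indicator {0..1} s *\<^sub>R s powr (-1/2))"
      unfolding set_integrable_def .
    then have "(\<integral>\<^sup>+s. ennreal (norm (indicator {0..1} s *\<^sub>R s powr (-1/2) :: real)) \<partial>lebesgue) < \<infinity>"
      unfolding integrable_iff_bounded by simp
    then show ?thesis
      by (simp add: nn_integral_completion mult.commute)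
  qed
  have m: "(\<integral>\<^sup>+s. ?f (-s) \<partial>lborel) = (\<integral>\<^sup>+s. ?f s \<partial>lborel)"
    using nn_integral_real_affine[of ?f "-1" 0] by simp
  have "(\<integral>\<^sup>+s. ennreal (1 / (sqrt \<bar>s\<bar> * (1 + s\<^sup>2))) \<partial>lborel)
    \<le> (\<integral>\<^sup>+s. (?f s + ?f (-s)) + ennreal (1 / (1 + s\<^sup>2)) \<partial>lborel)"
  proof (rule nn_integral_mono)
    fix s :: real
    have p: "1 + s\<^sup>2 \<ge> 1" by simp
    show "ennreal (1 / (sqrt \<bar>s\<bar> * (1 + s\<^sup>2))) \<le> (?f s + ?f (-s)) + ennreal (1 / (1 + s\<^sup>2))"
    proof (cases "\<bar>s\<bar> \<le> 1")
      case True
      have "ennreal (1 / (sqrt \<bar>s\<bar> * (1 + s\<^sup>2))) \<le> ?f s + ?f (-s)"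
      \<comment> \<open>At s = 0 the left-hand side is 1/0 = 0.\<close>
      proof (cases "s = 0")
        case False
        have "1 / (sqrt \<bar>s\<bar> * (1 + s\<^sup>2)) \<le> 1 / (sqrt \<bar>s\<bar> * 1)"
          using False p by (intro divide_left_mono mult_left_mono mult_pos_pos add_pos_nonneg) auto
        also have "\<dots> = \<bar>s\<bar> powr (-1/2)"
          by (simp add: powr_minus powr_half_sqrt divide_simps)
        finally have "ennreal (1 / (sqrt \<bar>s\<bar> * (1 + s\<^sup>2))) \<le> ennreal (\<bar>s\<bar> powr (-1/2))"
          by (rule ennreal_leI)
        also have "\<dots> \<le> ?f s + ?f (-s)"
          using True False by (cases "s > 0") (auto simp: add_increasing)
        finally show ?thesis .
      qed simp
      then show ?thesis by (simp add: add_increasing2)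
    next
      case False
      then have "sqrt \<bar>s\<bar> \<ge> 1" by simp
      then have "1 / (sqrt \<bar>s\<bar> * (1 + s\<^sup>2)) \<le> 1 / (1 * (1 + s\<^sup>2))"
        using p by (intro divide_left_mono mult_right_mono mult_pos_pos add_pos_nonneg) auto
      then have "ennreal (1 / (sqrt \<bar>s\<bar> * (1 + s\<^sup>2))) \<le> ennreal (1 / (1 + s\<^sup>2))"
        by (intro ennreal_leI) simp
      then show ?thesis by (simp add: add_increasing)
    qed
  qed
  also have "\<dots> = ((\<integral>\<^sup>+s. ?f s \<partial>lborel) + (\<integral>\<^sup>+s. ?f (-s) \<partial>lborel))
    + (\<integral>\<^sup>+s. ennreal (1 / (1 + s\<^sup>2)) \<partial>lborel)"
    by (subst nn_integral_add; simp?)+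
  also have "\<dots> < \<infinity>" using fin nn_integral_inverse_1_plus_square unfolding m by simp
  finally show ?thesis .
qed

text \<open>Up to a constant a majorant of a product of kernels \<open>Psi\<close>, normalised so
  that its integral does not depend on l.\<close>

definition bumpW :: "nat^'d \<Rightarrow> real^'d \<Rightarrow> real" where
  "bumpW l z = (\<Prod>i\<in>UNIV. 2 ^ (l $ i) / (1 + (2 ^ (l $ i) * z $ i)\<^sup>2)\<^sup>2)"

definition bumpV :: "nat^'d \<Rightarrow> real^'d \<Rightarrow> real" where
  "bumpV l z = (\<Prod>i\<in>UNIV. 2 ^ (l $ i) * kappa (2 ^ (l $ i) * z $ i))"

text \<open>The counterpart of \<open>bumpV\<close>: in \<open>peetre_kernel_bound\<close> the
  product |u| \<open>bumpW\<close> is split into a multiple of |u| \<open>bumpV\<close> and a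
  multiple of \<open>bumpQ\<close>. It has to be singular where \<open>bumpV\<close> vanishes and
  yet be integrable.\<close>

definition bumpQ :: "nat^'d \<Rightarrow> real^'d \<Rightarrow> real" where
  "bumpQ l z = (\<Prod>i\<in>UNIV. 2 ^ (l $ i) * (1 / (sqrt \<bar>2 ^ (l $ i) * z $ i\<bar>
    * (1 + (2 ^ (l $ i) * z $ i)\<^sup>2))))"

lemma bump_nonneg: "bumpW l z \<ge> 0" "bumpV l z \<ge> 0" "bumpQ l z \<ge> 0"
  by (auto simp: bumpW_def bumpV_def bumpQ_def kappa_nonneg intro!: prod_nonneg)

lemma borel_measurable_vec_nth [measurable]: "(\<lambda>x :: real^'d. x $ i) \<in> borel_measurable borel"
  by (intro borel_measurable_continuous_onI continuous_intros)

lemma kappa_measurable [measurable]: "kappa \<in> borel_measurable borel"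
  unfolding kappa_def[abs_def] by measurable

lemma bump_measurable [measurable]:
  "bumpW l \<in> borel_measurable borel" "bumpV l \<in> borel_measurable borel" "bumpQ l \<in>
    borel_measurable borel"
  unfolding bumpW_def[abs_def] bumpV_def[abs_def] bumpQ_def[abs_def] by measurable

lemma nn_integral_bumpW:
  "\<exists>w::real. \<forall>(l::nat^'d) x. (\<integral>\<^sup>+y. ennreal (bumpW l (x - y)) \<partial>lborel) = ennreal w"
proof -
  let ?I = "\<integral>\<^sup>+t. ennreal (1 / (1 + t\<^sup>2)\<^sup>2) \<partial>lborel"
  have "(\<integral>\<^sup>+y. ennreal (bumpW l (x - y)) \<partial>lborel) = ?I ^ CARD('d)" for l :: "nat^'d" and x
  proof -
    have "(\<integral>\<^sup>+y. ennreal (bumpW l (x - y)) \<partial>lborel) =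
        (\<integral>\<^sup>+y. (\<Prod>i\<in>UNIV. ennreal (2 ^ (l $ i) * (1 / (1 + (2 ^ (l $ i) * (x $ i - y $ i))\<^sup>2)\<^sup>2)))
          \<partial>lborel)"
      by (subst prod_ennreal) (auto simp: bumpW_def)
    also have "\<dots> = (\<Prod>i\<in>UNIV. \<integral>\<^sup>+t. ennreal (2 ^ (l $ i)
      * (1 / (1 + (2 ^ (l $ i) * (x $ i - t))\<^sup>2)\<^sup>2)) \<partial>lborel)"
      by (rule nn_integral_tensor) measurable
    also have "\<dots> = (\<Prod>i\<in>(UNIV::'d set). ?I)"
      by (intro prod.cong refl nn_integral_dilate[of "\<lambda>t. 1 / (1 + t\<^sup>2)\<^sup>2"]) auto
    finally show ?thesis by simp
  qed
  moreover have "?I ^ CARD('d) = ennreal (enn2real ?I ^ CARD('d))"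
    using nn_integral_inverse_1_plus_square2 by (simp add: ennreal_power[symmetric])
  ultimately show ?thesis by (intro exI[of _ "enn2real ?I ^ CARD('d)"]) simp
qed

lemma nn_integral_bumpQ:
  "\<exists>w::real. w > 0 \<and> (\<forall>(l::nat^'d) x. (\<integral>\<^sup>+y. ennreal (bumpQ l (x - y)) \<partial>lborel) \<le> ennreal w)"
proof -
  let ?I = "\<integral>\<^sup>+t. ennreal (1 / (sqrt \<bar>t\<bar> * (1 + t\<^sup>2))) \<partial>lborel"
  have "(\<integral>\<^sup>+y. ennreal (bumpQ l (x - y)) \<partial>lborel) = ?I ^ CARD('d)" for l :: "nat^'d" and x
  proof -
    have "(\<integral>\<^sup>+y. ennreal (bumpQ l (x - y)) \<partial>lborel) =
        (\<integral>\<^sup>+y. (\<Prod>i\<in>UNIV. ennreal (2 ^ (l $ i) * (1 / (sqrt \<bar>2 ^ (l $ i) * (x $ i - y $ i)\<bar>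
          * (1 + (2 ^ (l $ i) * (x $ i - y $ i))\<^sup>2))))) \<partial>lborel)"
      by (subst prod_ennreal) (auto simp: bumpQ_def)
    also have "\<dots> = (\<Prod>i\<in>UNIV. \<integral>\<^sup>+t. ennreal (2 ^ (l $ i)
      * (1 / (sqrt \<bar>2 ^ (l $ i) * (x $ i - t)\<bar> * (1 + (2 ^ (l $ i) * (x $ i - t))\<^sup>2)))) \<partial>lborel)"
      by (rule nn_integral_tensor) measurable
    also have "\<dots> = (\<Prod>i\<in>(UNIV::'d set). ?I)"
      by (intro prod.cong refl nn_integral_dilate[of "\<lambda>t. 1 / (sqrt \<bar>t\<bar> * (1 + t\<^sup>2))"]) auto
    finally show ?thesis by simp
  qed
  moreover have "?I ^ CARD('d) = ennreal (enn2real ?I ^ CARD('d))"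
    using nn_integral_inverse_sqrt by (simp add: ennreal_power[symmetric])
  moreover have "ennreal (enn2real ?I ^ CARD('d)) \<le> ennreal (enn2real ?I ^ CARD('d) + 1)"
    by (intro ennreal_leI) simp
  moreover have "enn2real ?I ^ CARD('d) + 1 > 0" by (intro add_nonneg_pos) auto
  ultimately show ?thesis by (intro exI[of _ "enn2real ?I ^ CARD('d) + 1"]) simp
qed

text \<open>Moving the centre of the bump from x to y costs a polynomial factor, by 1 + (s+t)^2
  \<le> 2(1+s^2)(1+t^2). Squaring this gives one factor 4 per coordinate.\<close>

lemma bumpW_submult:
  "bumpW l (y - z) \<le> 4 ^ CARD('d) * (\<Prod>i\<in>UNIV. (1 + (2 ^ (l $ i) * (x $ i - y $ i))\<^sup>2)\<^sup>2)
    * bumpW l (x - z)"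
  for l :: "nat^'d"
proof -
  have "bumpW l (y - z) \<le> (\<Prod>i\<in>UNIV. 4 * (1 + (2 ^ (l $ i) * (x $ i - y $ i))\<^sup>2)\<^sup>2
    * (2 ^ (l $ i) / (1 + (2 ^ (l $ i) * (x - z) $ i)\<^sup>2)\<^sup>2))"
    unfolding bumpW_def
  proof (intro prod_mono conjI)
    fix i
    define s t where "s = 2 ^ (l $ i) * (x $ i - y $ i)" and "t = 2 ^ (l $ i) * (y - z) $ i"
    have st_eq: "2 ^ (l $ i) * (x - z) $ i = s + t" by (simp add: s_def t_def algebra_simps)
    have "1 + (s + t)\<^sup>2 \<le> 2 * (1 + s\<^sup>2) * (1 + t\<^sup>2)"
      using zero_le_power2[of "s - t"] zero_le_power2[of "s * t"]
        by (simp add: power2_eq_square algebra_simps)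
    then have "(1 + (s + t)\<^sup>2)\<^sup>2 \<le> (2 * (1 + s\<^sup>2) * (1 + t\<^sup>2))\<^sup>2"
      by (intro power_mono) auto
    also have "\<dots> = 4 * (1 + s\<^sup>2)\<^sup>2 * (1 + t\<^sup>2)\<^sup>2" by (simp only: power_mult_distrib) simp
    finally have "1 / (1 + t\<^sup>2)\<^sup>2 \<le> 4 * (1 + s\<^sup>2)\<^sup>2 / (1 + (s + t)\<^sup>2)\<^sup>2"
    proof -
      assume a: "(1 + (s + t)\<^sup>2)\<^sup>2 \<le> 4 * (1 + s\<^sup>2)\<^sup>2 * (1 + t\<^sup>2)\<^sup>2"
      have p: "(1 + (s + t)\<^sup>2)\<^sup>2 > 0" "(1 + t\<^sup>2)\<^sup>2 > 0"
        by (intro zero_less_power add_pos_nonneg; simp)+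
      show ?thesis using a p by (simp add: pos_divide_le_eq pos_le_divide_eq)
    qed
    then have "2 ^ (l $ i) * (1 / (1 + t\<^sup>2)\<^sup>2) \<le> 2 ^ (l $ i)
      * (4 * (1 + s\<^sup>2)\<^sup>2 / (1 + (s + t)\<^sup>2)\<^sup>2)"
      by (intro mult_left_mono) auto
    then show "2 ^ (l $ i) / (1 + (2 ^ (l $ i) * (y - z) $ i)\<^sup>2)\<^sup>2 \<le> 4
      * (1 + (2 ^ (l $ i) * (x $ i - y $ i))\<^sup>2)\<^sup>2 *
      (2 ^ (l $ i) / (1 + (2 ^ (l $ i) * (x - z) $ i)\<^sup>2)\<^sup>2)"
      unfolding st_eq s_def[symmetric] t_def[symmetric] by (simp add: mult_ac)
  qed auto
  also have "\<dots> = 4 ^ CARD('d) * (\<Prod>i\<in>UNIV. (1 + (2 ^ (l $ i) * (x $ i - y $ i))\<^sup>2)\<^sup>2)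
    * bumpW l (x - z)"
    by (simp only: bumpW_def prod.distrib prod_constant)
  finally show ?thesis .
qed

text \<open>A sub-mean-value inequality with exponent \<open>1/2\<close> (Peetre, Plancherel--Polya). The gain over
  the hypothesis is that the kernel \<open>bumpV\<close> vanishes on the coordinate hyperplanes, which is what
  makes the sum over all scales converge. The weight \<open>sqrt \<bar>s\<bar>\<close> enters through the inequality of
  arithmetic and geometric means, and half of the left-hand side is absorbed.\<close>

lemma peetre_kernel_bound:
  assumes C1: "C1 > 0"
  shows "\<exists>C>0. \<forall>(l::nat^'d) (u :: real^'d \<Rightarrow> complex) B.
    u \<in> borel_measurable borel \<longrightarrow> (\<forall>x. norm (u x) \<le> B) \<longrightarrow>
    (\<forall>x. ennreal (norm (u x)) \<le> ennreal C1 * (\<integral>\<^sup>+y. ennreal (norm (u y) * bumpW l (x - y)) \<partial>lborel))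
      \<longrightarrow>
    (\<forall>x. (\<integral>\<^sup>+y. ennreal (norm (u y) * bumpW l (x - y)) \<partial>lborel)
        \<le> ennreal C * (\<integral>\<^sup>+y. ennreal (norm (u y) * bumpV l (x - y)) \<partial>lborel))"
proof -
  obtain w where w: "\<And>(l::nat^'d) x. (\<integral>\<^sup>+y. ennreal (bumpW l (x - y)) \<partial>lborel) = ennreal w"
    using nn_integral_bumpW by blast
  obtain q where q: "q > 0" "\<And>(l::nat^'d) x. (\<integral>\<^sup>+y. ennreal (bumpQ l (x - y)) \<partial>lborel) \<le> ennreal q"
    using nn_integral_bumpQ by blast
  define C3 where "C3 = C1 * 4 ^ CARD('d)"
  \<comment> \<open>Chosen so that the \<open>bumpQ\<close> term below is at most half of the
    left-hand side and can be absorbed.\<close>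
  define \<tau> where "\<tau> = C3 * q"
  have C3: "C3 > 0" and \<tau>: "\<tau> > 0" using C1 q by (auto simp: C3_def \<tau>_def)
  show ?thesis
  proof (intro exI[of _ \<tau>] conjI allI impI \<tau>)
    fix l :: "nat^'d" and u :: "real^'d \<Rightarrow> complex" and B x
    assume [measurable]: "u \<in> borel_measurable borel" and B: "\<forall>x. norm (u x) \<le> B"
      and sub: "\<forall>x. ennreal (norm (u x)) \<le> ennreal C1
        * (\<integral>\<^sup>+y. ennreal (norm (u y) * bumpW l (x - y)) \<partial>lborel)"
    define A where "A x = (\<integral>\<^sup>+y. ennreal (norm (u y) * bumpW l (x - y)) \<partial>lborel)" for x
    define I where "I = (\<integral>\<^sup>+y. ennreal (norm (u y) * bumpV l (x - y)) \<partial>lborel)"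
    define \<omega> where "\<omega> y = (\<Prod>i\<in>UNIV. 1 + (2 ^ (l $ i) * (x $ i - y $ i))\<^sup>2)" for y
    define \<sigma> where "\<sigma> y = (\<Prod>i\<in>UNIV. sqrt \<bar>2 ^ (l $ i) * (x $ i - y $ i)\<bar>)" for y
    define g where "g = (\<Prod>i\<in>UNIV. 2 ^ (l $ i) :: real)"
    have \<omega>: "\<omega> y > 0" for y unfolding \<omega>_def by (intro prod_pos) (auto intro: add_pos_nonneg)
    have g: "g > 0" by (auto simp: g_def intro!: prod_pos)
    have W: "bumpW l (x - y) = g / (\<omega> y)\<^sup>2" for y
      by (simp add: bumpW_def g_def \<omega>_def prod_dividef prod_power_distrib)
    have V: "bumpV l (x - y) = g * \<sigma> y / \<omega> y" for y
      by (simp add: bumpV_def g_def \<omega>_def \<sigma>_def kappa_def prod_dividef prod.distrib)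
    have Q: "bumpQ l (x - y) = g / (\<sigma> y * \<omega> y)" for y
      by (simp add: bumpQ_def g_def \<omega>_def \<sigma>_def prod_dividef prod.distrib)
    \<comment> \<open>Absorbing half of \<open>A x\<close> is legitimate only if it is finite. This
      is where u has to be bounded; the bound B does not enter the constant.\<close>
    have Afin: "A x < \<infinity>"
    proof -
      have "A x \<le> (\<integral>\<^sup>+y. ennreal B * ennreal (bumpW l (x - y)) \<partial>lborel)"
        unfolding A_def
      proof (rule nn_integral_mono)
        fix y
        have "0 \<le> B" using B norm_ge_zero order_trans by blast
        then show "ennreal (norm (u y) * bumpW l (x - y)) \<le> ennreal B * ennreal (bumpW l (x - y))"
          using B bump_nonneg(1)[of l] by (simp add: ennreal_mult[symmetric]
            ennreal_leI mult_right_mono)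
      qed
      also have "\<dots> = ennreal B * ennreal w" by (subst nn_integral_cmult) (auto simp: w)
      also have "\<dots> < \<infinity>" by (simp add: ennreal_mult_less_top)
      finally show ?thesis .
    qed
    define a where "a = enn2real (A x)"
    have a: "A x = ennreal a" "a \<ge> 0" using Afin by (auto simp: a_def)
    \<comment> \<open>The hypothesis at y, with the centre of the bump moved from y back to x,
      bounds |u(y)| by the single number a times a polynomial weight.\<close>
    have u_le: "norm (u y) \<le> C3 * a * (\<omega> y)\<^sup>2" for y
    proof -
      have "A y \<le> (\<integral>\<^sup>+z. ennreal (4 ^ CARD('d) * (\<omega> y)\<^sup>2) * ennreal (norm (u z) * bumpW l (x - z))
        \<partial>lborel)"
        unfolding A_def
      proof (rule nn_integral_mono)
        fix z
        have "bumpW l (y - z) \<le> 4 ^ CARD('d) * (\<omega> y)\<^sup>2 * bumpW l (x - z)"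
          using bumpW_submult[of l y z x] by (simp add: \<omega>_def prod_power_distrib)
        then have "norm (u z) * bumpW l (y - z) \<le> norm (u z)
          * (4 ^ CARD('d) * (\<omega> y)\<^sup>2 * bumpW l (x - z))"
          by (intro mult_left_mono) auto
        then show "ennreal (norm (u z) * bumpW l (y - z)) \<le> ennreal (4 ^ CARD('d) * (\<omega> y)\<^sup>2)
          * ennreal (norm (u z) * bumpW l (x - z))"
          using bump_nonneg(1)[of l] by (subst ennreal_mult[symmetric])
            (auto intro!: ennreal_leI simp: mult_ac)
      qed
      also have "\<dots> = ennreal (4 ^ CARD('d) * (\<omega> y)\<^sup>2) * A x"
        unfolding A_def by (rule nn_integral_cmult) measurable
      finally have "ennreal C1 * A y \<le> ennreal C1 * (ennreal (4 ^ CARD('d) * (\<omega> y)\<^sup>2) * ennreal a)"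
        unfolding a by (intro mult_left_mono) auto
      then have "ennreal (norm (u y)) \<le> ennreal (C1 * (4 ^ CARD('d) * (\<omega> y)\<^sup>2 * a))"
        using sub C1 a(2) unfolding A_def[symmetric] by (auto simp: ennreal_mult intro: order_trans)
      then have "norm (u y) \<le> C1 * (4 ^ CARD('d) * (\<omega> y)\<^sup>2 * a)"
        using C1 a(2) by (subst (asm) ennreal_le_iff) auto
      then show ?thesis by (simp add: C3_def mult_ac)
    qed
    \<comment> \<open>With P = \<open>\<omega> y\<close> and k = C3 a, the bound |u| \<le> k P^2
      gives |u|^2 \<le> |u| k P^2, hence |u| \<le> P sqrt(|u| k); the mean inequality with weight s
      = \<open>\<tau> * \<sigma> y\<close> finishes. Where \<open>\<sigma> y\<close> is 0 both
      kernels on the right are 0, the second by division by zero, and the inequality may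
      fail.\<close>
    have pt: "norm (u y) * bumpW l (x - y) \<le> \<tau> / 2 * (norm (u y) * bumpV l (x - y)) + C3
      * a / (2 * \<tau>) * bumpQ l (x - y)"
      if "\<sigma> y > 0" for y
    proof -
      define n where "n = norm (u y)"
      define P where "P = \<omega> y"
      define k where "k = C3 * a"
      define s where "s = \<tau> * \<sigma> y"
      have n: "0 \<le> n" "n \<le> k * P\<^sup>2" using u_le[of y] by (auto simp: n_def P_def k_def)
      have P: "P > 0" using \<omega> by (simp add: P_def)
      have k: "k \<ge> 0" using C3 a by (simp add: k_def)
      have s: "s > 0" using \<tau> that by (simp add: s_def)
      have "n\<^sup>2 \<le> n * k * P\<^sup>2" using n by (simp add: power2_eq_square mult_left_mono mult.assoc)
      also have "\<dots> \<le> (P * (s * n + k / s) / 2)\<^sup>2"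
      proof -
        have "(s * n - k / s)\<^sup>2 \<ge> 0" by simp
        then have "n * k \<le> ((s * n + k / s) / 2)\<^sup>2" using s
          by (simp add: power2_eq_square field_simps)
        then have "n * k * P\<^sup>2 \<le> ((s * n + k / s) / 2)\<^sup>2 * P\<^sup>2" by (intro mult_right_mono) auto
        then show ?thesis by (simp add: power_mult_distrib power_divide mult_ac)
      qed
      finally have "n\<^sup>2 \<le> (P * (s * n + k / s) / 2)\<^sup>2" .
      moreover have "0 \<le> P * (s * n + k / s) / 2" using P s k n by simp
      ultimately have "n \<le> P * (s * n + k / s) / 2" by (rule power2_le_imp_le)
      then have "n * (g / P\<^sup>2) \<le> P * (s * n + k / s) / 2 * (g / P\<^sup>2)"
        using g by (intro mult_right_mono) auto
      also have "\<dots> = \<tau> / 2 * (n * (g * \<sigma> y / P)) + k / (2 * \<tau>) * (g / (\<sigma> y * P))"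
        using P that \<tau> by (simp add: s_def power2_eq_square field_simps)
      finally show ?thesis unfolding W V Q n_def P_def k_def .
    qed
    have AE: "AE y in lborel. \<sigma> y > 0"
    proof -
      have "AE y in lborel. \<forall>i\<in>(UNIV::'d set). y $ i \<noteq> x $ i"
        by (subst AE_ball_countable) (auto simp: AE_component_neq)
      then show ?thesis
      proof eventually_elim
        case (elim y)
        then have "x $ i \<noteq> y $ i" for i by (metis UNIV_I)
        then show ?case unfolding \<sigma>_def by (intro prod_pos) simp
      qed
    qed
    have "A x \<le> (\<integral>\<^sup>+y. ennreal (\<tau> / 2) * ennreal (norm (u y) * bumpV l (x - y))
      + ennreal (C3 * a / (2 * \<tau>)) * ennreal (bumpQ l (x - y)) \<partial>lborel)"
      unfolding A_def
    proof (rule nn_integral_mono_AE, use AE in eventually_elim)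
      case (elim y)
      have "ennreal (norm (u y) * bumpW l (x - y)) \<le> ennreal (\<tau> / 2 * (norm (u y) * bumpV l (x - y))
        + C3 * a / (2 * \<tau>) * bumpQ l (x - y))"
        by (rule ennreal_leI[OF pt[OF elim]])
      also have "\<dots> = ennreal (\<tau> / 2) * ennreal (norm (u y) * bumpV l (x - y))
        + ennreal (C3 * a / (2 * \<tau>)) * ennreal (bumpQ l (x - y))"
        using \<tau> C3 a bump_nonneg[of l "x - y"] by (subst ennreal_plus)
          (auto simp: ennreal_mult[symmetric])
      finally show ?case .
    qed
    also have "\<dots> = ennreal (\<tau> / 2) * I + ennreal (C3 * a / (2 * \<tau>))
      * (\<integral>\<^sup>+y. ennreal (bumpQ l (x - y)) \<partial>lborel)"
      unfolding I_def by (subst nn_integral_add) (auto simp: nn_integral_cmult)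
    also have "\<dots> \<le> ennreal (\<tau> / 2) * I + ennreal (C3 * a / (2 * \<tau>)) * ennreal q"
      by (intro add_left_mono mult_left_mono q) auto
    also have "ennreal (C3 * a / (2 * \<tau>)) * ennreal q = ennreal (a / 2)"
      using q C3 a by (simp add: ennreal_mult[symmetric] \<tau>_def)
    finally have le: "ennreal a \<le> ennreal (\<tau> / 2) * I + ennreal (a / 2)" unfolding a .
    show "(\<integral>\<^sup>+y. ennreal (norm (u y) * bumpW l (x - y)) \<partial>lborel) \<le> ennreal \<tau>
      * (\<integral>\<^sup>+y. ennreal (norm (u y) * bumpV l (x - y)) \<partial>lborel)"
      unfolding A_def[symmetric] I_def[symmetric] a
    proof (cases I)
      case (real r)
      have "ennreal a \<le> ennreal (\<tau> / 2 * r + a / 2)"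
        using le real \<tau> a by (simp add: ennreal_mult[symmetric] ennreal_plus[symmetric] del:
          ennreal_plus)
      then have "a \<le> \<tau> / 2 * r + a / 2" using real \<tau> a by (subst (asm) ennreal_le_iff) auto
      then show "ennreal a \<le> ennreal \<tau> * I"
        using real \<tau> by (simp add: ennreal_mult[symmetric] ennreal_leI)
    next
      case top
      then show "ennreal a \<le> ennreal \<tau> * I" using \<tau> by (simp add: ennreal_mult_top)
    qed
  qed
qed

section \<open>Littlewood--Paley blocks\<close>

lemma cis_sum: "cis (\<Sum>i\<in>A. f i) = (\<Prod>i\<in>A. cis (f i))"
  by (induction A rule: infinite_finite_induct) (simp_all add: cis_mult[symmetric])

lemma norm_stencil_coeff: "norm (stencil_coeff j s) \<le> 1"
  by (auto simp: stencil_coeff_def)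

lemma bumpW_prod: "bumpW l (x - y) = (\<Prod>i\<in>UNIV. 2 ^ (l $ i) /
  (1 + (2 ^ (l $ i) * (x $ i - y $ i))\<^sup>2)\<^sup>2)"
  by (simp add: bumpW_def)

lemma fourier_lborel:
  fixes g :: "real^'d \<Rightarrow> complex"
  assumes [measurable]: "g \<in> borel_measurable borel"
  shows "fourier g \<xi> = of_real ((2 * pi) powr (- real CARD('d) / 2))
    * (LINT x|lborel. g x * cis (- (\<xi> \<bullet> x)))"
  unfolding fourier_def by (subst integral_completion) auto

lemma fourier_measurable:
  fixes g :: "real^'d \<Rightarrow> complex"
  assumes [measurable]: "g \<in> borel_measurable borel"
  shows "fourier g \<in> borel_measurable borel"
  unfolding fourier_lborel[OF assms, abs_def] by measurable

lemma fourier_bounded: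
  fixes g :: "real^'d \<Rightarrow> complex"
  assumes g: "integrable lborel g" and [measurable]: "g \<in> borel_measurable borel"
  shows "\<exists>K\<ge>0. \<forall>\<xi>. norm (fourier g \<xi>) \<le> K"
proof -
  let ?K = "(2 * pi) powr (- real CARD('d) / 2) * (LINT x|lborel. norm (g x))"
  have "norm (fourier g \<xi>) \<le> ?K" for \<xi>
  proof -
    have "norm (LINT x|lborel. g x * cis (- (\<xi> \<bullet> x)))
      \<le> (LINT x|lborel. norm (g x * cis (- (\<xi> \<bullet> x))))"
      by (rule integral_norm_bound)
    then show ?thesis
      by (simp add: fourier_lborel[OF assms(2)] norm_mult mult_left_mono)
  qed
  moreover have "?K \<ge> 0" by simp
  ultimately show ?thesis by blast
qed

context dyadic
begin

lemma phi_measurable [measurable]: "\<phi> n \<in> borel_measurable borel"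
  using phi_cont by (rule borel_measurable_continuous_onI)

lemma integrable_phi: "integrable lborel (\<phi> n)"
  by (rule integrable_compact_support[OF phi_cont, of "2 ^ (n + 1)"]) (auto intro: phi_zero)

lemma Psi_measurable [measurable]: "Psi n \<in> borel_measurable borel"
proof -
  have [measurable]: "psi n 0 \<in> borel_measurable borel"
    using psi_cont by (rule borel_measurable_continuous_onI)
  show ?thesis unfolding Psi_def[abs_def] by measurable
qed

lemma integrable_Psi: "integrable lborel (Psi n)"
proof -
  obtain C where C: "C > 0" "\<And>n t. norm (Psi n t) \<le> C * 2 ^ n / (1 + (2 ^ n * t)\<^sup>2)\<^sup>2"
    using Psi_bound by blast
  show ?thesis
    unfolding integrable_iff_bounded
  proof
    have "(\<integral>\<^sup>+t. ennreal (norm (Psi n t)) \<partial>lborel)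
      \<le> (\<integral>\<^sup>+t. ennreal C * ennreal (2 ^ n * (1 / (1 + (2 ^ n * (0 - t))\<^sup>2)\<^sup>2)) \<partial>lborel)"
      using C by (intro nn_integral_mono) (simp add: ennreal_mult[symmetric] ennreal_leI)
    also have "\<dots> = ennreal C * (\<integral>\<^sup>+t. ennreal (2 ^ n * (1 / (1 + (2 ^ n * (0 - t))\<^sup>2)\<^sup>2)) \<partial>lborel)"
      by (rule nn_integral_cmult) measurable
    also have "(\<integral>\<^sup>+t. ennreal (2 ^ n * (1 / (1 + (2 ^ n * (0 - t))\<^sup>2)\<^sup>2)) \<partial>lborel)
      = (\<integral>\<^sup>+t. ennreal (1 / (1 + t\<^sup>2)\<^sup>2) \<partial>lborel)"
      by (rule nn_integral_dilate) auto
    also have "ennreal C * \<dots> < \<infinity>"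
      using nn_integral_inverse_1_plus_square2 by (simp add: ennreal_mult_less_top)
    finally show "(\<integral>\<^sup>+t. ennreal (norm (Psi n t)) \<partial>lborel) < \<infinity>" .
  qed measurable
qed

lemma Psi_inversion: "(LINT t|lborel. Psi n t * cis (- (x * t))) = psi n 0 x"
proof -
  obtain B where B: "\<And>x. norm (psi n 0 x) \<le> B * indicator {- (2 ^ (n + 2))..2 ^ (n + 2)} x"
    using psi_bound by (metis le0 mult_1_right power_0)
  have "psi n 0 x = 0" if "2 ^ (n + 2) < \<bar>x\<bar>" for x
  proof -
    have "x \<notin> {- (2 ^ (n + 2))..2 ^ (n + 2)}" using that by (auto simp: abs_if split: if_splits)
    then show ?thesis using B[of x] by simp
  qed
  then show ?thesis
    using fourier_inversion[of "psi n 0" "2 ^ (n + 2)" x, OF psi_cont] integrable_Psi[of n]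
    unfolding Psi_def[abs_def] by blast
qed

lemma integrable_Psi_shift: "integrable lborel (\<lambda>y. Psi n (x - y))"
  using lborel_integrable_real_affine[OF integrable_Psi, of "-1" n x] by simp

text \<open>The substitution t = x - y reduces this to \<open>Psi_inversion\<close>: exponentials
  are eigenfunctions of convolution with \<open>Psi n\<close>.\<close>

lemma Psi_cis_integral:
  "integrable lborel (\<lambda>y. cis (y * \<xi>) * Psi n (x - y))"
  "(LINT y|lborel. cis (y * \<xi>) * Psi n (x - y)) = cis (x * \<xi>) * psi n 0 \<xi>"
proof -
  show "integrable lborel (\<lambda>y. cis (y * \<xi>) * Psi n (x - y))"
    by (rule Bochner_Integration.integrable_bound[OF integrable_Psi_shift]) (auto simp: norm_mult)
  have "(LINT y|lborel. cis (y * \<xi>) * Psi n (x - y)) = \<bar>-1\<bar>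
    *\<^sub>R (LINT t|lborel. cis ((x + -1 * t) * \<xi>) * Psi n (x - (x + -1 * t)))"
    by (rule lborel_integral_real_affine) simp
  also have "\<dots> = (LINT t|lborel. cis (x * \<xi>) * (Psi n t * cis (- (\<xi> * t))))"
  proof -
    have "cis ((x + -1 * t) * \<xi>) = cis (x * \<xi>) * cis (- (\<xi> * t))" for t
      unfolding cis_mult by (simp add: algebra_simps)
    then show ?thesis by (simp add: mult_ac)
  qed
  also have "\<dots> = cis (x * \<xi>) * psi n 0 \<xi>"
    by (simp only: integral_mult_right_zero Psi_inversion)
  finally show "(LINT y|lborel. cis (y * \<xi>) * Psi n (x - y)) = cis (x * \<xi>) * psi n 0 \<xi>" .
qed

text \<open>If the kernel is no finer than the mesh, the stencil is -1/2 times a second difference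
  with step h = \<mu> 2^-(j+1) and gains (h 2^n)^2 \<le> 4^-(j-n). For finer kernels, and at level
  -1, the triangle inequality is enough.\<close>

lemma stencil_Psi_bound:
  "\<exists>C>0. \<forall>j\<ge>-1. \<forall>\<mu> \<alpha> n k. 0 \<le> \<mu> \<longrightarrow> \<mu> \<le> 1 \<longrightarrow>
     norm (\<Sum>s\<in>{..2}. stencil_coeff j s * Psi n (\<mu> * stencil_node j k s + \<alpha>))
     \<le> C * scale_weight (nat j) n * (\<Sum>s\<in>{..2}. 2 ^ n /
       (1 + (2 ^ n * (\<mu> * stencil_node j k s + \<alpha>))\<^sup>2)\<^sup>2)"
proof -
  obtain C1 where C1: "C1 > 0" "\<And>n t. norm (Psi n t) \<le> C1 * 2 ^ n / (1 + (2 ^ n * t)\<^sup>2)\<^sup>2"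
    using Psi_bound by blast
  obtain C2 where C2: "C2 > 0" "\<And>n t h. 0 \<le> h \<Longrightarrow> h * 2 ^ n \<le> 1 \<Longrightarrow>
     norm (Psi n (t + 2 * h) - 2 * Psi n (t + h) + Psi n t) \<le> C2 * (h * 2 ^ n)\<^sup>2
       * 2 ^ n / (1 + (2 ^ n * t)\<^sup>2)\<^sup>2"
    using Psi_diff2_bound by blast
  show ?thesis
  proof (intro exI[of _ "C1 + C2"] conjI allI impI)
    show "C1 + C2 > 0" using C1 C2 by simp
    fix j :: int and \<mu> \<alpha> :: real and n k :: nat
    assume j: "-1 \<le> j" and \<mu>: "0 \<le> \<mu>" "\<mu> \<le> 1"
    define w where "w s = 2 ^ n / (1 + (2 ^ n * (\<mu> * stencil_node j k s + \<alpha>))\<^sup>2)\<^sup>2" for s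
    have w: "w s \<ge> 0" for s by (simp add: w_def)
    show "norm (\<Sum>s\<in>{..2}. stencil_coeff j s * Psi n (\<mu> * stencil_node j k s + \<alpha>)) \<le> (C1 + C2)
      * scale_weight (nat j) n * (\<Sum>s\<in>{..2}. 2 ^ n /
      (1 + (2 ^ n * (\<mu> * stencil_node j k s + \<alpha>))\<^sup>2)\<^sup>2)"
      unfolding w_def[symmetric]
    proof (cases "j = -1 \<or> nat j < n")
      case True
      \<comment> \<open>At level -1 the value of \<open>nat j\<close> is 0, and
        \<open>scale_weight 0 n\<close> is 1 for every n.\<close>
      then have "scale_weight (nat j) n = 1" by (auto simp: scale_weight_def)
      have "norm (\<Sum>s\<in>{..2}. stencil_coeff j s * Psi n (\<mu> * stencil_node j k s + \<alpha>))
        \<le> (\<Sum>s\<in>{..2}. C1 * w s)"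
      proof (rule sum_norm_le)
        fix s
        have "norm (stencil_coeff j s * Psi n (\<mu> * stencil_node j k s + \<alpha>)) \<le> 1
          * norm (Psi n (\<mu> * stencil_node j k s + \<alpha>))"
          unfolding norm_mult by (intro mult_right_mono norm_stencil_coeff) auto
        also have "\<dots> \<le> C1 * w s" using C1(2)[of n "\<mu> * stencil_node j k s + \<alpha>"] by (simp add: w_def)
        finally show "norm (stencil_coeff j s * Psi n (\<mu> * stencil_node j k s + \<alpha>)) \<le> C1 * w s" .
      qed
      also have "\<dots> = C1 * (\<Sum>s\<in>{..2}. w s)" by (simp only: sum_distrib_left)
      also have "\<dots> \<le> (C1 + C2) * (\<Sum>s\<in>{..2}. w s)"
        using C2 w by (intro mult_right_mono sum_nonneg) auto
      finally show "norm (\<Sum>s\<in>{..2}. stencil_coeff j s * Psi n (\<mu> * stencil_node j k s + \<alpha>))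
        \<le> (C1 + C2) * scale_weight (nat j) n * (\<Sum>s\<in>{..2}. w s)"
        using \<open>scale_weight (nat j) n = 1\<close> by simp
    next
      case False
      then obtain i where i: "j = int i" and ni: "n \<le> i"
        using j by (intro that[of "nat j"]) auto
      define h where "h = \<mu> / (2 * 2 ^ i)"
      define t where "t = \<mu> * stencil_node j k 0 + \<alpha>"
      have p: "2 powi (- (j + 1)) = (1 / (2 * 2 ^ i) :: real)"
        using i by (simp add: power_int_minus power_int_diff divide_simps)
      have t1: "\<mu> * stencil_node j k 1 + \<alpha> = t + h" and t2: "\<mu> * stencil_node j k 2 + \<alpha> = t + 2 * h"
        using i unfolding stencil_node_def t_def h_def p by (simp_all add: algebra_simps)
      have s3: "{..2::nat} = {0, 1, 2}" by auto
      have "(\<Sum>s\<in>{..2}. stencil_coeff j s * Psi n (\<mu> * stencil_node j k s + \<alpha>)) = (-1/2)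
        * (Psi n (t + 2 * h) - 2 * Psi n (t + h) + Psi n t)"
      proof -
        have "j \<noteq> -1" using i by simp
        then show ?thesis
          unfolding s3 by (simp add: stencil_coeff_def t1 t2 t_def[symmetric] del: One_nat_def)
            (simp add: field_simps)
      qed
      then have "norm (\<Sum>s\<in>{..2}. stencil_coeff j s * Psi n (\<mu> * stencil_node j k s + \<alpha>)) = 1/2
        * norm (Psi n (t + 2 * h) - 2 * Psi n (t + h) + Psi n t)"
        by (simp add: norm_mult)
      also have "\<dots> \<le> 1 * norm (Psi n (t + 2 * h) - 2 * Psi n (t + h) + Psi n t)"
        by (intro mult_right_mono) auto
      also have "\<dots> \<le> 1 * (C2 * (h * 2 ^ n)\<^sup>2 * 2 ^ n / (1 + (2 ^ n * t)\<^sup>2)\<^sup>2)"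
      proof (intro mult_left_mono C2(2))
        show "0 \<le> h" using \<mu> by (simp add: h_def)
        have "h * 2 ^ n \<le> 1 / (2 * 2 ^ i) * 2 ^ i"
          unfolding h_def using \<mu> ni by (intro mult_mono divide_right_mono power_increasing) auto
        also have "\<dots> \<le> 1" by simp
        finally show "h * 2 ^ n \<le> 1" .
      qed auto
      also have "\<dots> = C2 * (h * 2 ^ n)\<^sup>2 * w 0" by (simp add: w_def t_def)
      also have "\<dots> \<le> C2 * scale_weight (nat j) n * w 0"
      proof (intro mult_right_mono mult_left_mono w)
        have e: "(2::real) ^ i = 2 ^ n * 2 ^ (i - n)" using ni by (simp flip: power_add)
        have "0 \<le> h * 2 ^ n" using \<mu> by (simp add: h_def)
        moreover have "h * 2 ^ n \<le> 1 / 2 ^ (i - n)"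
          unfolding h_def e using \<mu> by (simp add: field_simps)
        ultimately have "(h * 2 ^ n)\<^sup>2 \<le> (1 / 2 ^ (i - n))\<^sup>2" by (intro power_mono)
        also have "\<dots> = (1/4) ^ (i - n)"
          by (simp add: power_one_over power2_eq_square flip: power_mult_distrib)
        finally show "(h * 2 ^ n)\<^sup>2 \<le> scale_weight (nat j) n"
          using i ni by (simp add: scale_weight_def)
      qed (use C2 in auto)
      also have "\<dots> \<le> (C1 + C2) * scale_weight (nat j) n * (\<Sum>s\<in>{..2}. w s)"
        using C1 C2 w by (intro mult_mono mult_nonneg_nonneg scale_weight_nonneg member_le_sum) auto
      finally show "norm (\<Sum>s\<in>{..2}. stencil_coeff j s * Psi n (\<mu> * stencil_node j k s + \<alpha>))
        \<le> (C1 + C2) * scale_weight (nat j) n * (\<Sum>s\<in>{..2}. w s)" .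
    qed
  qed
qed

context
  fixes g :: "real^'d \<Rightarrow> complex"
  assumes g: "integrable lborel g" and gm [measurable]: "g \<in> borel_measurable borel"
begin

definition block_symbol :: "nat^'d \<Rightarrow> real^'d \<Rightarrow> complex" where
  "block_symbol l \<xi> = (\<Prod>i\<in>UNIV. \<phi> (l $ i) (\<xi> $ i)) * fourier g \<xi>"

lemma block_symbol_measurable [measurable]: "block_symbol l \<in> borel_measurable borel"
proof -
  note fourier_measurable[OF gm, measurable]
  show ?thesis unfolding block_symbol_def[abs_def] by measurable
qed

lemma integrable_block_symbol: "integrable lborel (block_symbol l)"
proof -
  obtain K where K: "K \<ge> 0" "\<And>\<xi>. norm (fourier g \<xi>) \<le> K"
    using fourier_bounded[OF g gm] by blast
  have "integrable lborel (\<lambda>\<xi>::real^'d. of_real K * (\<Prod>i\<in>UNIV. \<phi> (l $ i) (\<xi> $ i)))"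
    by (intro integrable_mult_right integrable_tensor integrable_phi)
  then show ?thesis
    by (rule Bochner_Integration.integrable_bound)
      (use K in \<open>auto simp: block_symbol_def norm_mult mult.commute intro!: mult_mono\<close>)
qed

lemma lp_block_lborel:
  "lp_block \<phi> g l x = of_real ((2 * pi) powr (- real CARD('d) / 2))
    * (LINT \<xi>|lborel. block_symbol l \<xi> * cis (x \<bullet> \<xi>))"
  unfolding lp_block_def inv_fourier_def block_symbol_def[symmetric]
    by (subst integral_completion) auto

lemma lp_block_measurable [measurable]: "lp_block \<phi> g l \<in> borel_measurable borel"
  unfolding lp_block_lborel[abs_def] by measurable

lemma lp_block_bounded: "\<exists>B\<ge>0. \<forall>x. norm (lp_block \<phi> g l x) \<le> B"
proof -
  let ?B = "(2 * pi) powr (- real CARD('d) / 2) * (LINT \<xi>|lborel. norm (block_symbol l \<xi>))"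
  have "norm (lp_block \<phi> g l x) \<le> ?B" for x
  proof -
    have "norm (LINT \<xi>|lborel. block_symbol l \<xi> * cis (x \<bullet> \<xi>))
      \<le> (LINT \<xi>|lborel. norm (block_symbol l \<xi> * cis (x \<bullet> \<xi>)))"
      by (rule integral_norm_bound)
    then show ?thesis by (simp add: lp_block_lborel norm_mult mult_left_mono)
  qed
  moreover have "?B \<ge> 0" by simp
  ultimately show ?thesis by blast
qed

lemma integrable_lp_block_Psi:
  "integrable lborel (\<lambda>y::real^'d. lp_block \<phi> g l y * (\<Prod>i\<in>UNIV. Psi (l $ i) (x $ i - y $ i)))"
proof -
  obtain B where B: "B \<ge> 0" "\<And>x. norm (lp_block \<phi> g l x) \<le> B" using lp_block_bounded by blast
  have "integrable lborel (\<lambda>y::real^'d. of_real B * (\<Prod>i\<in>UNIV. Psi (l $ i) (x $ i - y $ i)))"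
    by (intro integrable_mult_right integrable_tensor integrable_Psi_shift)
  then show ?thesis
    by (rule Bochner_Integration.integrable_bound)
      (use B in \<open>auto simp: norm_mult intro!: mult_right_mono\<close>)
qed

text \<open>Where the symbol of the block is non-zero every factor \<open>psi\<close> equals 1, so
  multiplying by these factors changes nothing. Fubini carries this over to the convolution, the
  inner integral being an eigenvalue computation in each coordinate.\<close>

lemma lp_block_reproducing:
  "lp_block \<phi> g l x = (LINT y|lborel. lp_block \<phi> g l y * (\<Prod>i\<in>UNIV. Psi (l $ i) (x $ i - y $ i)))"
proof -
  define c :: complex where "c = of_real ((2 * pi) powr (- real CARD('d) / 2))"
  define \<Theta> where "\<Theta> y = (\<Prod>i\<in>UNIV. Psi (l $ i) (x $ i - y $ i))" for y :: "real^'d"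
  have [measurable]: "\<Theta> \<in> borel_measurable borel" unfolding \<Theta>_def[abs_def] by measurable
  have i\<Theta>: "integrable lborel \<Theta>"
    unfolding \<Theta>_def[abs_def] by (intro integrable_tensor integrable_Psi_shift)
  have inner: "(LINT y|lborel. cis (y \<bullet> \<xi>) * \<Theta> y) = (\<Prod>i\<in>UNIV. cis (x $ i * \<xi> $ i)
    * psi (l $ i) 0 (\<xi> $ i))" for \<xi>
  proof -
    have "(LINT y|lborel. cis (y \<bullet> \<xi>) * \<Theta> y) = (LINT y|lborel. (\<Prod>i\<in>UNIV. cis (y $ i * \<xi> $ i)
      * Psi (l $ i) (x $ i - y $ i)))"
      by (simp add: inner_vec_def cis_sum \<Theta>_def prod.distrib)
    also have "\<dots> = (\<Prod>i\<in>UNIV. (LINT t|lborel. cis (t * \<xi> $ i) * Psi (l $ i) (x $ i - t)))"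
      by (rule integral_tensor[of "\<lambda>i t. cis (t * \<xi> $ i) * Psi (l $ i) (x $ i - t)"])
        (rule Psi_cis_integral)
    finally show ?thesis by (simp add: Psi_cis_integral)
  qed
  have "(LINT y|lborel. lp_block \<phi> g l y * \<Theta> y)
    = (LINT y|lborel. c * ((LINT \<xi>|lborel. block_symbol l \<xi> * cis (y \<bullet> \<xi>) * \<Theta> y)))"
    by (simp only: integral_mult_left_zero) (simp add: lp_block_lborel c_def mult.assoc)
  also have "\<dots> = c * (LINT y|lborel. (LINT \<xi>|lborel. block_symbol l \<xi> * cis (y \<bullet> \<xi>) * \<Theta> y))"
    by (rule integral_mult_right_zero)
  also have "(LINT y|lborel. (LINT \<xi>|lborel. block_symbol l \<xi> * cis (y \<bullet> \<xi>) * \<Theta> y))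
    = (LINT \<xi>|lborel. (LINT y|lborel. block_symbol l \<xi> * cis (y \<bullet> \<xi>) * \<Theta> y))"
    by (rule Fubini_pair_bound[OF integrable_block_symbol i\<Theta>]) (auto simp: norm_mult)
  also have "\<dots> = (LINT \<xi>|lborel. block_symbol l \<xi> * cis (x \<bullet> \<xi>))"
  proof (intro Bochner_Integration.integral_cong refl)
    fix \<xi> :: "real^'d"
    have "(LINT y|lborel. block_symbol l \<xi> * cis (y \<bullet> \<xi>) * \<Theta> y) = block_symbol l \<xi>
      * (\<Prod>i\<in>UNIV. cis (x $ i * \<xi> $ i) * psi (l $ i) 0 (\<xi> $ i))"
      by (simp add: inner[symmetric] mult.assoc)
    also have "\<dots> = block_symbol l \<xi> * (\<Prod>i\<in>UNIV. cis (x $ i * \<xi> $ i))"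
    proof (cases "block_symbol l \<xi> = 0")
      case False
      then have "psi (l $ i) 0 (\<xi> $ i) = 1" for i by (intro psi_one) (auto simp: block_symbol_def)
      then show ?thesis by simp
    qed simp
    finally show "(LINT y|lborel. block_symbol l \<xi> * cis (y \<bullet> \<xi>) * \<Theta> y) = block_symbol l \<xi>
      * cis (x \<bullet> \<xi>)"
      by (simp add: inner_vec_def cis_sum)
  qed
  finally show ?thesis by (simp add: \<Theta>_def lp_block_lborel[of l x] c_def)
qed

text \<open>The stencil has to act on the kernel before absolute values are taken, otherwise the
  gain from second differences is lost. Expanding the product of one-dimensional stencils gives the
  sum over the multi-indices \<sigma>.\<close>

lemma lp_block_stencil:
  fixes c :: "'d \<Rightarrow> nat \<Rightarrow> complex" and p :: "'d \<Rightarrow> nat \<Rightarrow> real"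
  shows "(\<Sum>\<sigma>\<in>nat_box 2. (\<Prod>i\<in>UNIV. c i (\<sigma> $ i)) * lp_block \<phi> g l (\<chi> i. p i (\<sigma> $ i))) =
    (LINT y|lborel. lp_block \<phi> g l y * (\<Prod>i\<in>UNIV. \<Sum>s\<in>{..2}. c i s * Psi (l $ i) (p i s - y $ i)))"
    (is "?L = ?R")
    and "integrable lborel (\<lambda>y. lp_block \<phi> g l y * (\<Prod>i\<in>UNIV. \<Sum>s\<in>{..2}. c i s
      * Psi (l $ i) (p i s - y $ i)))"
proof -
  let ?V = "nat_box 2 :: (nat^'d) set"
  have e: "lp_block \<phi> g l y * (\<Prod>i\<in>UNIV. \<Sum>s\<in>{..2}. c i s * Psi (l $ i) (p i s - y $ i)) =
     (\<Sum>\<sigma>\<in>?V. (\<Prod>i\<in>UNIV. c i (\<sigma> $ i)) * (lp_block \<phi> g l y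
       * (\<Prod>i\<in>UNIV. Psi (l $ i) ((\<chi> i. p i (\<sigma> $ i)) $ i - y $ i))))" for y
    by (subst prod_sum_vec) (auto simp: sum_distrib_left prod.distrib mult_ac intro!: sum.cong)
  have i: "integrable lborel (\<lambda>y. (\<Prod>i\<in>UNIV. c i (\<sigma> $ i))
    * (lp_block \<phi> g l y * (\<Prod>i\<in>UNIV. Psi (l $ i) ((\<chi> i. p i (\<sigma> $ i)) $ i - y $ i))))" for \<sigma>
    by (intro integrable_mult_right integrable_lp_block_Psi)
  show "integrable lborel (\<lambda>y. lp_block \<phi> g l y
    * (\<Prod>i\<in>UNIV. \<Sum>s\<in>{..2}. c i s * Psi (l $ i) (p i s - y $ i)))"
    unfolding e by (intro Bochner_Integration.integrable_sum i)
  have "?L = (\<Sum>\<sigma>\<in>?V. (LINT y|lborel. (\<Prod>i\<in>UNIV. c i (\<sigma> $ i))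
    * (lp_block \<phi> g l y * (\<Prod>i\<in>UNIV. Psi (l $ i) ((\<chi> i. p i (\<sigma> $ i)) $ i - y $ i)))))"
    by (subst lp_block_reproducing) (simp only: integral_mult_right_zero)
  also have "\<dots> = ?R"
    unfolding e by (rule Bochner_Integration.integral_sum[symmetric]) (rule i)
  finally show "?L = ?R" .
qed

end

text \<open>Supplies the hypothesis of \<open>peetre_kernel_bound\<close> with one constant for all
  functions, blocks and points, by inserting the decay of \<open>Psi\<close> into the reproducing
  formula.\<close>

lemma lp_block_sub_mean_value:
  "\<exists>C>0. \<forall>(g :: real^'d \<Rightarrow> complex) l x. integrable lborel g \<longrightarrow> g \<in> borel_measurable borel \<longrightarrow>
    ennreal (norm (lp_block \<phi> g l x)) \<le> ennreal C
      * (\<integral>\<^sup>+y. ennreal (norm (lp_block \<phi> g l y) * bumpW l (x - y)) \<partial>lborel)"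
proof -
  obtain C where C: "C > 0" "\<And>n t. norm (Psi n t) \<le> C * 2 ^ n / (1 + (2 ^ n * t)\<^sup>2)\<^sup>2"
    using Psi_bound by blast
  show ?thesis
  proof (intro exI[of _ "C ^ CARD('d)"] conjI allI impI)
    show "0 < C ^ CARD('d)" using C by simp
    fix g :: "real^'d \<Rightarrow> complex" and l :: "nat^'d" and x :: "real^'d"
    assume g: "integrable lborel g" and gm [measurable]: "g \<in> borel_measurable borel"
    note lp_block_measurable[OF g gm, measurable]
    have P: "norm (\<Prod>i\<in>UNIV. Psi (l $ i) (x $ i - y $ i)) \<le> C ^ CARD('d) * bumpW l (x - y)" for y
    proof -
      have "norm (\<Prod>i\<in>UNIV. Psi (l $ i) (x $ i - y $ i))
        = (\<Prod>i\<in>UNIV. norm (Psi (l $ i) (x $ i - y $ i)))"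
        by (simp add: prod_norm)
      also have "\<dots> \<le> (\<Prod>i\<in>UNIV. C * (2 ^ (l $ i) / (1 + (2 ^ (l $ i) * (x $ i - y $ i))\<^sup>2)\<^sup>2))"
        using C(2) by (intro prod_mono) auto
      also have "\<dots> = C ^ CARD('d) * bumpW l (x - y)"
        unfolding bumpW_prod by (simp only: prod.distrib prod_constant)
      finally show ?thesis .
    qed
    have "ennreal (norm (lp_block \<phi> g l x)) \<le> (\<integral>\<^sup>+y.
      ennreal (norm (lp_block \<phi> g l y * (\<Prod>i\<in>UNIV. Psi (l $ i) (x $ i - y $ i)))) \<partial>lborel)"
      by (subst lp_block_reproducing[OF g gm])
        (rule integral_norm_bound_ennreal[OF integrable_lp_block_Psi[OF g gm]])
    also have "\<dots> \<le> (\<integral>\<^sup>+y. ennreal (C ^ CARD('d)) * ennreal (norm (lp_block \<phi> g l y)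
      * bumpW l (x - y)) \<partial>lborel)"
    proof (rule nn_integral_mono)
      fix y
      have "norm (lp_block \<phi> g l y * (\<Prod>i\<in>UNIV. Psi (l $ i) (x $ i - y $ i)))
        \<le> norm (lp_block \<phi> g l y) * (C ^ CARD('d) * bumpW l (x - y))"
        unfolding norm_mult by (intro mult_left_mono P) auto
      then show "ennreal (norm (lp_block \<phi> g l y * (\<Prod>i\<in>UNIV. Psi (l $ i) (x $ i - y $ i))))
        \<le> ennreal (C ^ CARD('d)) * ennreal (norm (lp_block \<phi> g l y) * bumpW l (x - y))"
        using C bump_nonneg(1)[of l] by (subst ennreal_mult[symmetric])
          (auto intro!: ennreal_leI simp: mult_ac)
    qed
    also have "\<dots> = ennreal (C ^ CARD('d)) * (\<integral>\<^sup>+y. ennreal (norm (lp_block \<phi> g l y)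
      * bumpW l (x - y)) \<partial>lborel)"
      by (rule nn_integral_cmult) measurable
    finally show "ennreal (norm (lp_block \<phi> g l x)) \<le> ennreal (C ^ CARD('d))
      * (\<integral>\<^sup>+y. ennreal (norm (lp_block \<phi> g l y) * bumpW l (x - y)) \<partial>lborel)" .
  qed
qed

text \<open>The constant is independent of N, so that N can tend to infinity, and of \<mu> and
  \<alpha>, so that nodes may be contracted and translated. Scales, nodes and stencil indices all
  range over product sets, so the total weight factorises and each coordinate contributes one
  constant from \<open>stencil_kappa_sum\<close>.\<close>

lemma stencil_sum_bound:
  "\<exists>C>0. \<forall>(g :: real^'d \<Rightarrow> complex). integrable lborel g \<longrightarrow> g \<in> borel_measurable borel \<longrightarrow>
    (\<forall>N (j::int^'d) \<mu> (\<alpha>::'d \<Rightarrow> real). (\<forall>i. -1 \<le> j $ i) \<longrightarrow> 1/2 \<le> \<mu> \<longrightarrow> \<mu> \<le> 1 \<longrightarrow>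
      (\<Sum>l\<in>nat_box N. \<Sum>k\<in>faber_idx j.
        ennreal (norm (\<Sum>\<sigma>\<in>nat_box 2. stencil_prod j \<sigma> *
          lp_block \<phi> g l (\<chi> i. \<mu> * stencil_node (j $ i) (k $ i) (\<sigma> $ i) + \<alpha> i)))) \<le> ennreal C
            * SF_norm \<phi> g)"
proof -
  obtain C0 where C0: "C0 > 0" "\<And>(g :: real^'d \<Rightarrow> complex) l x. integrable lborel g
    \<Longrightarrow> g \<in> borel_measurable borel \<Longrightarrow>
    ennreal (norm (lp_block \<phi> g l x)) \<le> ennreal C0
      * (\<integral>\<^sup>+y. ennreal (norm (lp_block \<phi> g l y) * bumpW l (x - y)) \<partial>lborel)"
    using lp_block_sub_mean_value[where 'd='d] by blast
  obtain C1 where C1: "C1 > 0" "\<And>j \<mu> \<alpha> n k. -1 \<le> j \<Longrightarrow> 0 \<le> \<mu> \<Longrightarrow> \<mu> \<le> 1 \<Longrightarrow>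
     norm (\<Sum>s\<in>{..2}. stencil_coeff j s * Psi n (\<mu> * stencil_node j k s + \<alpha>))
     \<le> C1 * scale_weight (nat j) n * (\<Sum>s\<in>{..2}. 2 ^ n /
       (1 + (2 ^ n * (\<mu> * stencil_node j k s + \<alpha>))\<^sup>2)\<^sup>2)"
    using stencil_Psi_bound by blast
  obtain C2 where C2: "C2 > 0" "\<And>(l::nat^'d) (u :: real^'d \<Rightarrow> complex) B x.
    u \<in> borel_measurable borel \<Longrightarrow> (\<forall>x. norm (u x) \<le> B) \<Longrightarrow>
    (\<forall>x. ennreal (norm (u x)) \<le> ennreal C0 * (\<integral>\<^sup>+y. ennreal (norm (u y) * bumpW l (x - y)) \<partial>lborel))
      \<Longrightarrow>
    (\<integral>\<^sup>+y. ennreal (norm (u y) * bumpW l (x - y)) \<partial>lborel)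
        \<le> ennreal C2 * (\<integral>\<^sup>+y. ennreal (norm (u y) * bumpV l (x - y)) \<partial>lborel)"
    using peetre_kernel_bound[OF C0(1), where 'd='d] by blast
  obtain C3 where C3: "C3 > 0" "\<And>j \<mu> \<alpha> N. -1 \<le> j \<Longrightarrow> 1/2 \<le> \<mu> \<Longrightarrow>
     (\<Sum>n\<le>N. \<Sum>k\<in>faber_idx1 j. \<Sum>s\<in>{..2}. scale_weight (nat j) n
       * kappa (2 ^ n * (\<mu> * stencil_node j k s + \<alpha>))) \<le> C3"
    using stencil_kappa_sum by blast
  define c where "c = C2 * C1 ^ CARD('d)"
  have c: "c > 0" using C1 C2 by (simp add: c_def)
  show ?thesis
  proof (intro exI[of _ "c * C3 ^ CARD('d)"] conjI allI impI)
    show "0 < c * C3 ^ CARD('d)" using c C3 by simp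
    fix g :: "real^'d \<Rightarrow> complex" and N :: nat and j :: "int^'d" and \<mu> :: real and \<alpha> :: "'d \<Rightarrow> real"
    assume g: "integrable lborel g" and gm [measurable]: "g \<in> borel_measurable borel"
      and j: "\<forall>i. -1 \<le> j $ i" and \<mu>: "1/2 \<le> \<mu>" "\<mu> \<le> 1"
    note lp_block_measurable[OF g gm, measurable]
    let ?V = "nat_box 2 :: (nat^'d) set"
    let ?L = "nat_box N :: (nat^'d) set"
    have finL: "finite ?L" and finV: "finite ?V" by (rule finite_vec_components; simp)+
    define u where "u l = lp_block \<phi> g l" for l
    have [measurable]: "u l \<in> borel_measurable borel" for l unfolding u_def by measurable
    define p where "p k \<sigma> = (\<chi> i. \<mu> * stencil_node (j $ i) (k $ i) (\<sigma> $ i) + \<alpha> i)"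
      for k \<sigma> :: "nat^'d"
    \<comment> \<open>A supremum over finitely many scales is measurable at once, and it is
      dominated by the supremum in \<open>SF_norm\<close>.\<close>
    define h where "h y = (SUP l\<in>?L. ennreal (2 ^ (\<Sum>i\<in>UNIV. l $ i) * norm (u l y)))" for y
    have hm [measurable]: "h \<in> borel_measurable borel"
      unfolding h_def by (intro borel_measurable_SUP countable_finite finL) measurable
    define T where "T y i n k s = scale_weight (nat (j $ i)) n
      * kappa (2 ^ n * (\<mu> * stencil_node (j $ i) k s + (\<alpha> i - y $ i)))"
      for y :: "real^'d" and i n k s
    have T0: "T y i n k s \<ge> 0" for y i n k s by (simp add: T_def scale_weight_nonneg kappa_nonneg)
    have pe: "p k \<sigma> $ i - y $ i = \<mu> * stencil_node (j $ i) (k $ i) (\<sigma> $ i) + (\<alpha> i - y $ i)"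
      for k \<sigma> i and y :: "real^'d"
      by (simp add: p_def)
    have one: "ennreal (norm (\<Sum>\<sigma>\<in>?V. stencil_prod j \<sigma> * u l (p k \<sigma>)))
        \<le> (\<integral>\<^sup>+y. h y * ennreal (c * (\<Sum>\<sigma>\<in>?V. \<Prod>i\<in>UNIV. T y i (l $ i) (k $ i) (\<sigma> $ i))) \<partial>lborel)"
      if l: "l \<in> ?L" for l k
    proof -
      define K where "K = C1 ^ CARD('d) * (\<Prod>i\<in>UNIV. scale_weight (nat (j $ i)) (l $ i))"
      have K: "K \<ge> 0" using C1 by (auto simp: K_def scale_weight_nonneg intro!:
        prod_nonneg mult_nonneg_nonneg)
      have "ennreal (norm (\<Sum>\<sigma>\<in>?V. stencil_prod j \<sigma> * u l (p k \<sigma>)))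
        \<le> (\<integral>\<^sup>+y. ennreal (norm (u l y * (\<Prod>i\<in>UNIV. \<Sum>s\<in>{..2}. stencil_coeff (j $ i) s
          * Psi (l $ i) (\<mu> * stencil_node (j $ i) (k $ i) s + \<alpha> i - y $ i)))) \<partial>lborel)"
        unfolding u_def p_def
        by (subst lp_block_stencil(1)[OF g gm]) (rule integral_norm_bound_ennreal[OF
          lp_block_stencil(2)[OF g gm]])
      also have "\<dots> \<le> (\<integral>\<^sup>+y. ennreal K * (\<Sum>\<sigma>\<in>?V. ennreal (norm (u l y) * bumpW l (p k \<sigma> - y)))
        \<partial>lborel)"
      proof (rule nn_integral_mono)
        fix y
        have "norm (\<Prod>i\<in>UNIV. \<Sum>s\<in>{..2}. stencil_coeff (j $ i) s
          * Psi (l $ i) (\<mu> * stencil_node (j $ i) (k $ i) s + \<alpha> i - y $ i))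
          = (\<Prod>i\<in>UNIV. norm (\<Sum>s\<in>{..2}. stencil_coeff (j $ i) s
            * Psi (l $ i) (\<mu> * stencil_node (j $ i) (k $ i) s + (\<alpha> i - y $ i))))"
          by (simp add: prod_norm add_diff_eq)
        also have "\<dots> \<le> (\<Prod>i\<in>UNIV. C1 * scale_weight (nat (j $ i)) (l $ i)
          * (\<Sum>s\<in>{..2}. 2 ^ (l $ i) / (1 + (2 ^ (l $ i) * (\<mu> * stencil_node (j $ i) (k $ i) s
          + (\<alpha> i - y $ i)))\<^sup>2)\<^sup>2))"
          using C1(2) j \<mu> by (intro prod_mono) auto
        also have "\<dots> = K * (\<Prod>i\<in>UNIV. \<Sum>s\<in>{..2}. 2 ^ (l $ i) /
          (1 + (2 ^ (l $ i) * (\<mu> * stencil_node (j $ i) (k $ i) s + (\<alpha> i - y $ i)))\<^sup>2)\<^sup>2)"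
          by (simp only: K_def prod.distrib prod_constant)
        also have "(\<Prod>i\<in>UNIV. \<Sum>s\<in>{..2}. 2 ^ (l $ i) / (1
          + (2 ^ (l $ i) * (\<mu> * stencil_node (j $ i) (k $ i) s + (\<alpha> i - y $ i)))\<^sup>2)\<^sup>2)
          = (\<Sum>\<sigma>\<in>?V. bumpW l (p k \<sigma> - y))"
          by (subst prod_sum_vec) (simp_all only: bumpW_prod pe finite_atMost)
        finally have "norm (u l y) * norm (\<Prod>i\<in>UNIV. \<Sum>s\<in>{..2}. stencil_coeff (j $ i) s
          * Psi (l $ i) (\<mu> * stencil_node (j $ i) (k $ i) s + \<alpha> i - y $ i))
           \<le> norm (u l y) * (K * (\<Sum>\<sigma>\<in>?V. bumpW l (p k \<sigma> - y)))"
          by (rule mult_left_mono) auto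
        also have "\<dots> = K * (\<Sum>\<sigma>\<in>?V. norm (u l y) * bumpW l (p k \<sigma> - y))"
          by (simp add: sum_distrib_left mult_ac)
        finally show "ennreal (norm (u l y * (\<Prod>i\<in>UNIV. \<Sum>s\<in>{..2}. stencil_coeff (j $ i) s
          * Psi (l $ i) (\<mu> * stencil_node (j $ i) (k $ i) s + \<alpha> i - y $ i))))
          \<le> ennreal K * (\<Sum>\<sigma>\<in>?V. ennreal (norm (u l y) * bumpW l (p k \<sigma> - y)))"
          using K bump_nonneg(1)[of l]
          by (subst sum_ennreal) (auto simp: norm_mult ennreal_mult[symmetric] sum_nonneg intro!:
            ennreal_leI)
      qed
      also have "\<dots> = ennreal K * (\<Sum>\<sigma>\<in>?V. \<integral>\<^sup>+y. ennreal (norm (u l y) * bumpW l (p k \<sigma> - y))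
        \<partial>lborel)"
        by (subst nn_integral_cmult, measurable, subst nn_integral_sum) auto
      also have "\<dots> \<le> ennreal K * (\<Sum>\<sigma>\<in>?V. ennreal C2
        * (\<integral>\<^sup>+y. ennreal (norm (u l y) * bumpV l (p k \<sigma> - y)) \<partial>lborel))"
      proof (intro mult_left_mono sum_mono)
        fix \<sigma>
        obtain B where "\<forall>x. norm (u l x) \<le> B" using lp_block_bounded[OF g gm]
          unfolding u_def by blast
        then show "(\<integral>\<^sup>+y. ennreal (norm (u l y) * bumpW l (p k \<sigma> - y)) \<partial>lborel) \<le> ennreal C2
          * (\<integral>\<^sup>+y. ennreal (norm (u l y) * bumpV l (p k \<sigma> - y)) \<partial>lborel)"
          by (rule C2(2)[rotated]) (use C0(2)[OF g gm] in \<open>auto simp: u_def\<close>)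
      qed auto
      also have "\<dots> \<le> ennreal K * (\<Sum>\<sigma>\<in>?V. ennreal C2
        * (\<integral>\<^sup>+y. h y * ennreal (\<Prod>i\<in>UNIV. kappa (2 ^ (l $ i) * (p k \<sigma> $ i - y $ i))) \<partial>lborel))"
      proof (intro mult_left_mono sum_mono nn_integral_mono)
        fix \<sigma> y
        \<comment> \<open>The normalising factors of \<open>bumpV\<close> are moved to the block,
          where they form the weight of \<open>SF_norm\<close>. Only the bounded profile
          \<open>kappa\<close> is left to be summed over l.\<close>
        have "norm (u l y) * bumpV l (p k \<sigma> - y) = (2 ^ (\<Sum>i\<in>UNIV. l $ i) * norm (u l y))
          * (\<Prod>i\<in>UNIV. kappa (2 ^ (l $ i) * (p k \<sigma> $ i - y $ i)))"
          by (simp add: bumpV_def prod.distrib power_sum)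
        then have "ennreal (norm (u l y) * bumpV l (p k \<sigma> - y)) = ennreal (2 ^ (\<Sum>i\<in>UNIV. l $ i)
          * norm (u l y)) * ennreal (\<Prod>i\<in>UNIV. kappa (2 ^ (l $ i) * (p k \<sigma> $ i - y $ i)))"
          by (subst ennreal_mult[symmetric]) (simp_all only:
            zero_le_mult_iff zero_le_power norm_ge_zero prod_nonneg kappa_nonneg zero_le_numeral
            simp_thms)
        also have "\<dots> \<le> h y * ennreal (\<Prod>i\<in>UNIV. kappa (2 ^ (l $ i) * (p k \<sigma> $ i - y $ i)))"
          unfolding h_def using l by (intro mult_right_mono SUP_upper) auto
        finally show "ennreal (norm (u l y) * bumpV l (p k \<sigma> - y)) \<le> h y
          * ennreal (\<Prod>i\<in>UNIV. kappa (2 ^ (l $ i) * (p k \<sigma> $ i - y $ i)))" .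
      qed auto
      also have "\<dots> = (\<Sum>\<sigma>\<in>?V. \<integral>\<^sup>+y. ennreal (K * C2)
        * (h y * ennreal (\<Prod>i\<in>UNIV. kappa (2 ^ (l $ i) * (p k \<sigma> $ i - y $ i)))) \<partial>lborel)"
        using K C2 by (subst nn_integral_cmult) (auto simp:
          sum_distrib_left ennreal_mult mult.assoc)
      also have "\<dots> = (\<integral>\<^sup>+y. (\<Sum>\<sigma>\<in>?V. ennreal (K * C2)
        * (h y * ennreal (\<Prod>i\<in>UNIV. kappa (2 ^ (l $ i) * (p k \<sigma> $ i - y $ i))))) \<partial>lborel)"
        by (rule nn_integral_sum[symmetric]) measurable
      also have "\<dots> = (\<integral>\<^sup>+y. h y * ennreal (c * (\<Sum>\<sigma>\<in>?V. \<Prod>i\<in>UNIV. T y i (l $ i) (k $ i) (\<sigma> $ i)))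
        \<partial>lborel)"
      proof (rule nn_integral_cong)
        fix y
        have "ennreal (K * C2) * (h y * ennreal (\<Prod>i\<in>UNIV. kappa (2 ^ (l $ i)
          * (p k \<sigma> $ i - y $ i)))) = h y * ennreal (c * (\<Prod>i\<in>UNIV. T y i (l $ i) (k $ i) (\<sigma> $ i)))"
          for \<sigma>
        proof -
          have "c * (\<Prod>i\<in>UNIV. T y i (l $ i) (k $ i) (\<sigma> $ i)) = (K * C2)
            * (\<Prod>i\<in>UNIV. kappa (2 ^ (l $ i) * (p k \<sigma> $ i - y $ i)))"
            unfolding T_def pe[symmetric] by (simp add: c_def K_def prod.distrib)
          then show ?thesis
            using K C2 by (simp add: ennreal_mult prod_nonneg kappa_nonneg mult_ac)
        qed
        then have "(\<Sum>\<sigma>\<in>?V. ennreal (K * C2) * (h y * ennreal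
          (\<Prod>i\<in>UNIV. kappa (2 ^ (l $ i) * (p k \<sigma> $ i - y $ i)))))
            = h y * (\<Sum>\<sigma>\<in>?V. ennreal (c * (\<Prod>i\<in>UNIV. T y i (l $ i) (k $ i) (\<sigma> $ i))))"
          by (simp only: sum_distrib_left)
        also have "(\<Sum>\<sigma>\<in>?V. ennreal (c * (\<Prod>i\<in>UNIV. T y i (l $ i) (k $ i) (\<sigma> $ i))))
          = ennreal (c * (\<Sum>\<sigma>\<in>?V. \<Prod>i\<in>UNIV. T y i (l $ i) (k $ i) (\<sigma> $ i)))"
          unfolding sum_distrib_left by (rule sum_ennreal)
            (intro mult_nonneg_nonneg prod_nonneg T0 less_imp_le[OF c])
        finally show "(\<Sum>\<sigma>\<in>?V. ennreal (K * C2) * (h y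
          * ennreal (\<Prod>i\<in>UNIV. kappa (2 ^ (l $ i) * (p k \<sigma> $ i - y $ i))))) = h y
          * ennreal (c * (\<Sum>\<sigma>\<in>?V. \<Prod>i\<in>UNIV. T y i (l $ i) (k $ i) (\<sigma> $ i)))" .
      qed
      finally show ?thesis .
    qed
    have Tm: "(\<lambda>y. \<Prod>i\<in>UNIV. T y i (l $ i) (k $ i) (\<sigma> $ i)) \<in> borel_measurable borel"
      for l k \<sigma> :: "nat^'d"
      unfolding T_def by measurable
    have "(\<Sum>l\<in>?L. \<Sum>k\<in>faber_idx j. ennreal (norm (\<Sum>\<sigma>\<in>?V. stencil_prod j \<sigma> * u l (p k \<sigma>))))
      \<le> (\<Sum>l\<in>?L. \<Sum>k\<in>faber_idx j. \<integral>\<^sup>+y. h y * ennreal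
        (c * (\<Sum>\<sigma>\<in>?V. \<Prod>i\<in>UNIV. T y i (l $ i) (k $ i) (\<sigma> $ i))) \<partial>lborel)"
      by (intro sum_mono one)
    also have "\<dots> = (\<integral>\<^sup>+y. (\<Sum>l\<in>?L. \<Sum>k\<in>faber_idx j. h y
      * ennreal (c * (\<Sum>\<sigma>\<in>?V. \<Prod>i\<in>UNIV. T y i (l $ i) (k $ i) (\<sigma> $ i)))) \<partial>lborel)"
      using Tm by (subst nn_integral_sum, measurable, subst nn_integral_sum) auto
    also have "\<dots> \<le> (\<integral>\<^sup>+y. ennreal (c * C3 ^ CARD('d)) * h y \<partial>lborel)"
    proof (rule nn_integral_mono)
      fix y
      have "(\<Sum>l\<in>?L. \<Sum>k\<in>faber_idx j. h y * ennreal (c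
        * (\<Sum>\<sigma>\<in>?V. \<Prod>i\<in>UNIV. T y i (l $ i) (k $ i) (\<sigma> $ i))))
          = h y * ennreal (c * (\<Sum>l\<in>?L. \<Sum>k\<in>faber_idx j. \<Sum>\<sigma>\<in>?V. \<Prod>i\<in>UNIV. T y i (l $ i) (k $ i)
            (\<sigma> $ i)))"
      proof -
        have "(\<Sum>l\<in>?L. \<Sum>k\<in>faber_idx j. ennreal (c * (\<Sum>\<sigma>\<in>?V. \<Prod>i\<in>UNIV. T y i (l $ i) (k $ i) (\<sigma> $ i))))
          = ennreal (\<Sum>l\<in>?L. \<Sum>k\<in>faber_idx j. c * (\<Sum>\<sigma>\<in>?V. \<Prod>i\<in>UNIV. T y i (l $ i) (k $ i) (\<sigma> $ i)))"
          by (subst sum_ennreal, (intro mult_nonneg_nonneg sum_nonneg prod_nonneg T0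
            less_imp_le[OF c]),
              subst sum_ennreal, (intro mult_nonneg_nonneg sum_nonneg prod_nonneg T0
                less_imp_le[OF c]), rule refl)
        then show ?thesis by (simp only: sum_distrib_left[symmetric])
      qed
      also have "(\<Sum>l\<in>?L. \<Sum>k\<in>faber_idx j. \<Sum>\<sigma>\<in>?V. \<Prod>i\<in>UNIV. T y i (l $ i) (k $ i) (\<sigma> $ i))
          = (\<Prod>i\<in>UNIV. \<Sum>n\<le>N. \<Sum>k\<in>faber_idx1 (j $ i). \<Sum>s\<in>{..2}. T y i n k s)"
      proof -
        have f: "finite (faber_idx1 a)" for a by (simp add: faber_idx1_def)
        show ?thesis
          unfolding faber_idx_def
          by (subst prod_sum_vec, simp, intro sum.cong refl, subst prod_sum_vec, rule f,
            intro sum.cong refl, subst prod_sum_vec) simp_all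
      qed
      also have "h y * ennreal (c * \<dots>) \<le> h y * ennreal (c * (\<Prod>i\<in>(UNIV::'d set). C3))"
      proof (intro mult_left_mono ennreal_leI prod_mono conjI)
        fix i
        show "0 \<le> (\<Sum>n\<le>N. \<Sum>k\<in>faber_idx1 (j $ i). \<Sum>s\<in>{..2}. T y i n k s)" by (intro sum_nonneg T0)
        show "(\<Sum>n\<le>N. \<Sum>k\<in>faber_idx1 (j $ i). \<Sum>s\<in>{..2}. T y i n k s) \<le> C3"
          unfolding T_def using j \<mu> by (intro C3(2)) auto
      qed (use c in auto)
      finally show "(\<Sum>l\<in>?L. \<Sum>k\<in>faber_idx j. h y * ennreal
        (c * (\<Sum>\<sigma>\<in>?V. \<Prod>i\<in>UNIV. T y i (l $ i) (k $ i) (\<sigma> $ i)))) \<le> ennreal (c * C3 ^ CARD('d)) * h y"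
        by (simp add: mult.commute)
    qed
    also have "\<dots> = ennreal (c * C3 ^ CARD('d)) * (\<integral>\<^sup>+y. h y \<partial>lborel)"
      by (rule nn_integral_cmult) measurable
    also have "(\<integral>\<^sup>+y. h y \<partial>lborel) = (\<integral>\<^sup>+y. h y \<partial>lebesgue)"
      by (rule nn_integral_completion[symmetric]) measurable
    also have "\<dots> \<le> SF_norm \<phi> g"
      unfolding SF_norm_def h_def u_def by (intro nn_integral_mono SUP_subset_mono) auto
    finally show "(\<Sum>l\<in>?L. \<Sum>k\<in>faber_idx j. ennreal
      (norm (\<Sum>\<sigma>\<in>?V. stencil_prod j \<sigma> * lp_block \<phi> g l (\<chi> i. \<mu> * stencil_node (j $ i) (k $ i) (\<sigma> $ i)
      + \<alpha> i))))
       \<le> ennreal (c * C3 ^ CARD('d)) * SF_norm \<phi> g"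
      unfolding u_def p_def by (simp add: mult_left_mono)
  qed
qed

end

section \<open>Gaussian smoothing\<close>

definition gauss :: "real \<Rightarrow> real \<Rightarrow> real" where
  "gauss \<delta> t = std_normal_density (t / \<delta>) / \<delta>"

lemma gauss_nonneg: "\<delta> > 0 \<Longrightarrow> gauss \<delta> t \<ge> 0"
  by (simp add: gauss_def)

lemma gauss_measurable [measurable]: "gauss \<delta> \<in> borel_measurable borel"
  unfolding gauss_def[abs_def] by measurable

lemma gauss_fourier:
  assumes "\<delta> > 0"
  shows "(LINT t|lborel. of_real (gauss \<delta> t) * cis (- (t * x))) = of_real (exp (- (\<delta> * x)\<^sup>2 / 2))"
proof -
  have "(LINT t|lborel. of_real (gauss \<delta> t) * cis (- (t * x))) =
      \<bar>\<delta>\<bar> *\<^sub>R (LINT s|lborel. of_real (gauss \<delta> (0 + \<delta> * s)) * cis (- ((0 + \<delta> * s) * x)))"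
    by (rule lborel_integral_real_affine) (use assms in auto)
  also have "\<dots> = (LINT s|lborel. \<bar>\<delta>\<bar> *\<^sub>R (of_real (gauss \<delta> (0 + \<delta> * s))
    * cis (- ((0 + \<delta> * s) * x))))"
    by (rule integral_scaleR_right[symmetric])
  also have "\<dots> = (LINT s|lborel. of_real (std_normal_density s) * cis ((- \<delta> * x) * s))"
    using assms by (intro Bochner_Integration.integral_cong refl)
      (simp add: gauss_def scaleR_conv_of_real mult_ac)
  finally show ?thesis unfolding char_normal_integral by simp
qed

lemma integrable_gauss: "\<delta> > 0 \<Longrightarrow> integrable lborel (gauss \<delta>)"
  using lborel_integrable_real_affine[of std_normal_density "1 / \<delta>" 0]
  unfolding gauss_def[abs_def] by (intro integrable_divide) simp

lemma integral_gauss: "\<delta> > 0 \<Longrightarrow> (LINT t|lborel. of_real (gauss \<delta> t)) = (1 :: complex)"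
  using gauss_fourier[of \<delta> 0] by simp

lemma exp_eq_density: "exp (- (\<delta> * t)\<^sup>2 / 2) = sqrt (2 * pi) * std_normal_density (0 + \<delta> * t)"
  by (simp add: std_normal_density_def)

lemma integrable_gauss_exp:
  assumes "\<delta> > 0"
  shows "integrable lborel (\<lambda>t. complex_of_real (exp (- (\<delta> * t)\<^sup>2 / 2)))"
proof -
  have "integrable lborel (\<lambda>x. std_normal_density (0 + \<delta> * x))"
    by (rule lborel_integrable_real_affine) (use assms in auto)
  then show ?thesis unfolding exp_eq_density by (intro integrable_of_real integrable_mult_right)
qed

lemma gauss_exp_fourier:
  assumes "\<delta> > 0"
  shows "(LINT t|lborel. of_real (exp (- (\<delta> * t)\<^sup>2 / 2)) * cis (s * t))
    = of_real (2 * pi * gauss \<delta> s)"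
proof -
  have "(LINT t|lborel. of_real (std_normal_density t) * cis ((s / \<delta>) * t)) = 
      \<bar>\<delta>\<bar> *\<^sub>R (LINT t|lborel. of_real (std_normal_density (0 + \<delta> * t))
        * cis ((s / \<delta>) * (0 + \<delta> * t)))"
    by (rule lborel_integral_real_affine) (use assms in auto)
  then have e: "(LINT t|lborel. of_real (std_normal_density (0 + \<delta> * t)) * cis (s * t))
    = of_real (exp (- (s / \<delta>)\<^sup>2 / 2)) / of_real \<delta>"
    unfolding char_normal_integral using assms by (simp add: scaleR_conv_of_real field_simps)
  have "(LINT t|lborel. of_real (exp (- (\<delta> * t)\<^sup>2 / 2)) * cis (s * t)) =
      (LINT t|lborel. of_real (sqrt (2 * pi)) * (of_real (std_normal_density (0 + \<delta> * t))
        * cis (s * t)))"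
    unfolding exp_eq_density by (simp add: mult.assoc)
  also have "\<dots> = of_real (sqrt (2 * pi)) * (of_real (exp (- (s / \<delta>)\<^sup>2 / 2)) / of_real \<delta>)"
    unfolding e[symmetric] by (rule integral_mult_right_zero)
  also have "\<dots> = of_real (sqrt (2 * pi) * (exp (- (s / \<delta>)\<^sup>2 / 2) / \<delta>))" by simp
  also have "sqrt (2 * pi) * (exp (- (s / \<delta>)\<^sup>2 / 2) / \<delta>) = 2 * pi * gauss \<delta> s"
  proof -
    have "sqrt (2 * pi) * sqrt (2 * pi) = 2 * pi" by simp
    then show ?thesis using assms
      by (simp only: gauss_def std_normal_density_def) (simp add: field_simps)
  qed
  finally show ?thesis .
qed

text \<open>With \<eta> = 0 this is the bound 1/\<delta> on the maximum; with \<eta> > 0 it is the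
  decay away from the centre.\<close>

lemma gauss_tail:
  assumes "\<delta> > 0" "\<delta> \<le> 1" "\<eta> \<le> \<bar>t\<bar>" "0 \<le> \<eta>"
  shows "gauss \<delta> t \<le> (1 / \<delta>) * exp (- (\<eta> / \<delta>)\<^sup>2 / 2)"
proof -
  have "std_normal_density (t / \<delta>) \<le> 1 * exp (- (\<eta> / \<delta>)\<^sup>2 / 2)"
    unfolding std_normal_density_def
  proof (intro mult_mono)
    have "sqrt (2 * pi) \<ge> 1" using pi_gt3 by simp
    then show "1 / sqrt (2 * pi) \<le> 1" by simp
    have "(\<eta> / \<delta>)\<^sup>2 \<le> (\<bar>t\<bar> / \<delta>)\<^sup>2"
      using assms by (intro power_mono divide_right_mono) auto
    then show "exp (- (t / \<delta>)\<^sup>2 / 2) \<le> exp (- (\<eta> / \<delta>)\<^sup>2 / 2)" by (simp add: power_divide)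
  qed auto
  then show ?thesis unfolding gauss_def using assms by (simp add: divide_right_mono)
qed

lemma lborel_integral_affine:
  fixes h :: "'a::euclidean_space \<Rightarrow> complex"
  assumes [measurable]: "h \<in> borel_measurable borel" and c: "c \<noteq> 0"
  shows "(LINT y|lborel. h y) = \<bar>c\<bar> ^ DIM('a) *\<^sub>R (LINT x|lborel. h (t + c *\<^sub>R x))"
proof -
  have "(LINT y|lborel. h y) = (LINT y|density (distr lborel borel (\<lambda>x. t + c *\<^sub>R x))
    (\<lambda>_. ennreal (\<bar>c\<bar> ^ DIM('a))). h y)"
    by (subst lborel_affine[OF c, of t]) (simp add: ennreal_power)
  also have "\<dots> = (LINT y|distr lborel borel (\<lambda>x. t + c *\<^sub>R x). \<bar>c\<bar> ^ DIM('a) *\<^sub>R h y)"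
    by (rule integral_density) auto
  also have "\<dots> = (LINT x|lborel. \<bar>c\<bar> ^ DIM('a) *\<^sub>R h (t + c *\<^sub>R x))"
    by (rule integral_distr) auto
  finally show ?thesis by simp
qed

section \<open>Gaussian approximate identities\<close>

definition gauss_prod :: "real \<Rightarrow> real^'d \<Rightarrow> complex" where
  "gauss_prod \<delta> z = (\<Prod>i\<in>UNIV. of_real (gauss \<delta> (z $ i)))"

lemma gauss_prod_measurable [measurable]: "gauss_prod \<delta> \<in> borel_measurable borel"
  unfolding gauss_prod_def[abs_def] by measurable

lemma integrable_gauss_prod: "\<delta> > 0 \<Longrightarrow> integrable lborel (gauss_prod \<delta>)"
  unfolding gauss_prod_def[abs_def] by (intro integrable_tensor integrable_of_real integrable_gauss)

text \<open>The weight is the size of a Gaussian product of width 1/(m + 1) at distance \<eta> from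
  its centre: d maxima m + 1 against one exponentially small factor.\<close>

lemma gauss_weight_tendsto:
  assumes "\<eta> > 0"
  shows "(\<lambda>m. real (Suc m) ^ d * exp (- (\<eta> * real (Suc m))\<^sup>2 / 2)) \<longlonglongrightarrow> 0"
proof -
  define c where "c = \<eta>\<^sup>2 / 2"
  have c: "c > 0" using assms by (simp add: c_def)
  have t: "filterlim (\<lambda>m. c * real (Suc m)) at_top sequentially"
    using c by (intro filterlim_tendsto_pos_mult_at_top[OF tendsto_const]
      filterlim_compose[OF filterlim_real_sequentially] filterlim_Suc) auto
  have "(\<lambda>m. (c * real (Suc m)) ^ d / exp (c * real (Suc m))) \<longlonglongrightarrow> 0"
    by (rule filterlim_compose[OF tendsto_power_div_exp_0 t])
  then have l: "(\<lambda>m. (1 / c ^ d) * ((c * real (Suc m)) ^ d / exp (c * real (Suc m)))) \<longlonglongrightarrow> (1 / c ^ d)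
    * 0"
    by (rule tendsto_mult_left)
  show ?thesis
  proof (rule tendsto_sandwich[OF _ _ tendsto_const l[simplified mult_zero_right]])
    show "\<forall>\<^sub>F m in sequentially. 0 \<le> real (Suc m) ^ d * exp (- (\<eta> * real (Suc m))\<^sup>2 / 2)" by simp
    have "real (Suc m) ^ d * exp (- (\<eta> * real (Suc m))\<^sup>2 / 2) \<le> 1 / c ^ d
      * ((c * real (Suc m)) ^ d / exp (c * real (Suc m)))" for m
    proof -
      have "real (Suc m) \<le> (real (Suc m))\<^sup>2" using self_le_power[of "real (Suc m)" 2] by simp
      then have "c * real (Suc m) \<le> c * (real (Suc m))\<^sup>2" using c by (intro mult_left_mono) auto
      then have "exp (- (\<eta> * real (Suc m))\<^sup>2 / 2) \<le> exp (- (c * real (Suc m)))"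
        by (simp add: c_def power_mult_distrib)
      then have "real (Suc m) ^ d * exp (- (\<eta> * real (Suc m))\<^sup>2 / 2) \<le> real (Suc m) ^ d
        * exp (- (c * real (Suc m)))"
        by (intro mult_left_mono) auto
      also have "\<dots> = 1 / c ^ d * ((c * real (Suc m)) ^ d / exp (c * real (Suc m)))"
        using c by (simp only: exp_minus power_mult_distrib) (simp add: divide_simps)
      finally show ?thesis .
    qed
    then show "\<forall>\<^sub>F m in sequentially. real (Suc m) ^ d * exp (- (\<eta> * real (Suc m))\<^sup>2 / 2)
      \<le> 1 / c ^ d * ((c * real (Suc m)) ^ d / exp (c * real (Suc m)))"
      by simp
  qed
qed

text \<open>Nothing is known about g outside the cube except integrability. Inside, the bounded
  function F, continuous at x, is averaged by an approximate identity. The remainder G lives at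
  distance at least \<eta> > 0 from x in some coordinate, where the Gaussian is exponentially small;
  this is why x must be interior.\<close>

lemma gauss_approximation:
  fixes f g :: "real^'d \<Rightarrow> complex"
  assumes f: "continuous_on unit_cube f" and g: "integrable lborel g" and gm [measurable]: "g \<in>
    borel_measurable borel"
    and ae: "AE x in lborel. x \<in> unit_cube \<longrightarrow> g x = f x"
    and x: "\<And>i. 0 < x $ i" "\<And>i. x $ i < 1"
  shows "(\<lambda>m. LINT y|lborel. g y * gauss_prod (1 / real (Suc m)) (x - y)) \<longlonglongrightarrow> f x"
proof -
  define F where "F y = indicator unit_cube y *\<^sub>R f y" for y
  define G where "G y = indicator (- unit_cube) y *\<^sub>R g y" for y
  define \<gamma> where "\<gamma> m y = (\<Prod>i\<in>UNIV. complex_of_real (gauss (1 / real (Suc m)) (x $ i - y $ i)))"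
    for m and y :: "real^'d"
  have [measurable]: "F \<in> borel_measurable borel"
    unfolding F_def by (rule borel_measurable_continuous_on_indicator[OF _ f]) simp
  have [measurable]: "G \<in> borel_measurable borel" unfolding G_def by measurable
  have [measurable]: "\<gamma> m \<in> borel_measurable borel" for m unfolding \<gamma>_def by measurable
  have FG: "AE y in lborel. g y = F y + G y"
    using ae by eventually_elim (auto simp: F_def G_def indicator_def)
  have iG: "integrable lborel G"
    by (rule Bochner_Integration.integrable_bound[OF g]) (auto simp: G_def indicator_def)
  have iF: "integrable lborel F"
  proof (rule Bochner_Integration.integrable_bound[OF g])
    show "AE y in lborel. norm (F y) \<le> norm (g y)"
      using ae by eventually_elim (auto simp: F_def indicator_def)
  qed simp
  have \<gamma>b: "norm (\<gamma> m y) \<le> real (Suc m) ^ CARD('d)" for m y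
  proof -
    have "norm (\<gamma> m y) = (\<Prod>i\<in>UNIV. gauss (1 / real (Suc m)) (x $ i - y $ i))"
      unfolding \<gamma>_def prod_norm[symmetric] by (intro prod.cong refl) (simp add: gauss_nonneg)
    also have "\<dots> \<le> (\<Prod>i\<in>(UNIV::'d set). real (Suc m))"
      using gauss_tail[of "1 / real (Suc m)" 0] by (intro prod_mono) (auto simp: gauss_nonneg)
    finally show ?thesis by simp
  qed
  have i1: "integrable lborel (\<lambda>y. F y * \<gamma> m y)" and i2: "integrable lborel (\<lambda>y. G y * \<gamma> m y)" for m
  proof -
    have *: "integrable lborel (\<lambda>y. H y * \<gamma> m y)" if H: "integrable lborel H" for H
    proof -
      have "integrable lborel (\<lambda>y. H y * of_real (real (Suc m) ^ CARD('d)))" using H by auto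
      then show ?thesis
      proof (rule Bochner_Integration.integrable_bound)
        show "AE y in lborel. norm (H y * \<gamma> m y) \<le> norm (H y * of_real (real (Suc m) ^ CARD('d)))"
          using \<gamma>b[of m] by (intro AE_I2) (simp add: norm_mult norm_power mult_left_mono del:
            of_nat_Suc)
      qed (use H in auto)
    qed
    show "integrable lborel (\<lambda>y. F y * \<gamma> m y)" "integrable lborel (\<lambda>y. G y * \<gamma> m y)"
      by (rule * iF iG)+
  qed
  have eq: "(LINT y|lborel. g y * \<gamma> m y) = (LINT y|lborel. F y * \<gamma> m y)
    + (LINT y|lborel. G y * \<gamma> m y)" for m
  proof -
    have "(LINT y|lborel. g y * \<gamma> m y) = (LINT y|lborel. F y * \<gamma> m y + G y * \<gamma> m y)"
      by (rule integral_cong_AE) (use FG in \<open>auto simp: distrib_right\<close>)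
    then show ?thesis using i1 i2 by simp
  qed
  obtain M where M: "M \<ge> 0" "\<And>y. norm (F y) \<le> M"
  proof -
    have "compact (f ` unit_cube)" by (intro compact_continuous_image f compact_cbox)
    then obtain M where "\<And>y. y \<in> unit_cube \<Longrightarrow> norm (f y) \<le> M"
      using compact_imp_bounded bounded_iff by (metis imageI)
    then have "norm (F y) \<le> max M 0" for y by (auto simp: F_def indicator_def le_max_iff_disj)
    then show ?thesis using that[of "max M 0"] by auto
  qed
  have lim1: "(\<lambda>m. LINT y|lborel. F y * \<gamma> m y) \<longlonglongrightarrow> f x"
  proof -
    define S where "S s = (\<Prod>i\<in>UNIV. complex_of_real (std_normal_density (s $ i)))"
      for s :: "real^'d"
    have iS: "integrable lborel S" and S1: "(LINT s|lborel. S s) = 1"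
      unfolding S_def using integrable_tensor[of "\<lambda>(_::'d) t. complex_of_real
        (std_normal_density t)"]
        integral_tensor[of "\<lambda>(_::'d) t. complex_of_real (std_normal_density t)"]
          char_normal_integral[of 0]
      by auto
    have sub: "(LINT y|lborel. F y * \<gamma> m y) = (LINT s|lborel. F (x - (1 / real (Suc m)) *\<^sub>R s)
      * S s)" for m
    proof -
      define \<delta> where "\<delta> = 1 / real (Suc m)"
      have \<delta>: "\<delta> > 0" by (simp add: \<delta>_def)
      have "(LINT y|lborel. F y * \<gamma> m y) = \<bar>- \<delta>\<bar> ^ DIM(real^'d)
        *\<^sub>R (LINT s|lborel. F (x + (- \<delta>) *\<^sub>R s) * \<gamma> m (x + (- \<delta>) *\<^sub>R s))"
        by (rule lborel_integral_affine) (use \<delta> in auto)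
      also have "\<dots> = (LINT s|lborel. \<bar>- \<delta>\<bar> ^ DIM(real^'d)
        *\<^sub>R (F (x + (- \<delta>) *\<^sub>R s) * \<gamma> m (x + (- \<delta>) *\<^sub>R s)))"
        by (rule integral_scaleR_right[symmetric])
      also have "\<dots> = (LINT s|lborel. F (x - \<delta> *\<^sub>R s) * S s)"
      proof (intro Bochner_Integration.integral_cong refl)
        fix s :: "real^'d"
        have "\<gamma> m (x + (- \<delta>) *\<^sub>R s) = (\<Prod>i\<in>UNIV. complex_of_real (std_normal_density (s $ i))
          * of_real (1 / \<delta>))"
          unfolding \<gamma>_def \<delta>_def[symmetric] using \<delta> by (intro prod.cong refl) (simp add: gauss_def)
        also have "\<dots> = S s * of_real (1 / \<delta>) ^ CARD('d)"
          by (simp only: prod.distrib prod_constant S_def)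
        finally have "\<gamma> m (x + (- \<delta>) *\<^sub>R s) = S s / of_real \<delta> ^ CARD('d)"
          by (simp add: power_one_over)
        then show "\<bar>- \<delta>\<bar> ^ DIM(real^'d) *\<^sub>R (F (x + (- \<delta>) *\<^sub>R s) * \<gamma> m (x + (- \<delta>) *\<^sub>R s))
          = F (x - \<delta> *\<^sub>R s) * S s"
          using \<delta> by (simp add: scaleR_conv_of_real)
      qed
      finally show ?thesis by (simp add: \<delta>_def)
    qed
    have "(\<lambda>m. LINT s|lborel. F (x - (1 / real (Suc m)) *\<^sub>R s) * S s) \<longlonglongrightarrow> (LINT s|lborel. F x * S s)"
    proof (rule integral_dominated_convergence[where w="\<lambda>s. M * norm (S s)"])
      show "AE s in lborel. (\<lambda>m. F (x - (1 / real (Suc m)) *\<^sub>R s) * S s) \<longlonglongrightarrow> F x * S s"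
      proof (rule AE_I2)
        fix s :: "real^'d"
        have "x \<in> box 0 1" using x by (simp add: mem_box_cart)
        moreover have "continuous_on (box 0 1) F"
        proof -
          have "continuous_on (box 0 1) f" by (rule continuous_on_subset[OF f box_subset_cbox])
          then show ?thesis
            by (rule continuous_on_cong[THEN iffD1, rotated -1])
              (auto simp: F_def indicator_def dest: box_subset_cbox[THEN subsetD])
        qed
        ultimately have "isCont F x"
          using continuous_on_eq_continuous_at[OF open_box, of 0 1 F] by blast
        moreover have "(\<lambda>m. x - (1 / real (Suc m)) *\<^sub>R s) \<longlonglongrightarrow> x - 0 *\<^sub>R s"
          by (intro tendsto_diff tendsto_scaleR tendsto_const LIMSEQ_Suc[OF lim_1_over_n])
        ultimately have "(\<lambda>m. F (x - (1 / real (Suc m)) *\<^sub>R s)) \<longlonglongrightarrow> F x"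
          using isCont_tendsto_compose[of x F] by simp
        then show "(\<lambda>m. F (x - (1 / real (Suc m)) *\<^sub>R s) * S s) \<longlonglongrightarrow> F x * S s"
          by (rule tendsto_mult_right)
      qed
    qed (use iS M in \<open>auto simp: norm_mult intro!: mult_right_mono\<close>)
    moreover have "(LINT s|lborel. F x * S s) = f x"
    proof -
      have "x \<in> unit_cube" using x by (simp add: mem_box_cart less_imp_le)
      then show ?thesis using S1 by (simp add: F_def)
    qed
    ultimately show ?thesis unfolding sub by simp
  qed
  have lim2: "(\<lambda>m. LINT y|lborel. G y * \<gamma> m y) \<longlonglongrightarrow> 0"
  proof -
    define \<eta> where "\<eta> = Min (range (\<lambda>i. min (x $ i) (1 - x $ i)))"
    have \<eta>: "\<eta> > 0" unfolding \<eta>_def using x by (subst Min_gr_iff) auto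
    have \<eta>_le: "\<eta> \<le> min (x $ i) (1 - x $ i)" for i unfolding \<eta>_def by (intro Min_le) auto
    define E where "E m = real (Suc m) ^ CARD('d) * exp (- (\<eta> * real (Suc m))\<^sup>2 / 2)" for m
    have E: "norm (G y * \<gamma> m y) \<le> E m * norm (G y)" for m y
    proof (cases "y \<in> unit_cube")
      case True
      then show ?thesis by (simp add: G_def)
    next
      case False
      then obtain i where i: "y $ i < 0 \<or> y $ i > 1" by (auto simp: mem_box_cart not_le)
      then have i': "\<eta> \<le> \<bar>x $ i - y $ i\<bar>" using \<eta>_le[of i] x[of i] by auto
      have "norm (\<gamma> m y) = (\<Prod>i\<in>UNIV. gauss (1 / real (Suc m)) (x $ i - y $ i))"
        unfolding \<gamma>_def prod_norm[symmetric] by (intro prod.cong refl) (simp add: gauss_nonneg)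
      \<comment> \<open>The coordinate i in which y leaves the cube gives the exponential; the
        others are bounded by the maximum of the Gaussian.\<close>
      also have "\<dots> \<le> (\<Prod>j\<in>UNIV. if j = i then real (Suc m) * exp (- (\<eta> * real (Suc m))\<^sup>2 / 2)
        else real (Suc m))"
        using gauss_tail[of "1 / real (Suc m)" 0] gauss_tail[of "1 / real (Suc m)" \<eta>] i' \<eta>
        by (intro prod_mono) (auto simp: gauss_nonneg)
      also have "\<dots> = (real (Suc m) * exp (- (\<eta> * real (Suc m))\<^sup>2 / 2))
        * (\<Prod>j\<in>UNIV - {i}. real (Suc m))"
        by (subst prod.remove[of _ i]) (auto intro!: prod.cong arg_cong2[where f="(*)"])
      also have "\<dots> = E m"
        unfolding E_def by (simp add: power_eq_if[of _ "CARD('d)"] card_Diff_singleton)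
      finally have "norm (G y) * norm (\<gamma> m y) \<le> norm (G y) * E m" by (intro mult_left_mono) auto
      then show ?thesis by (simp add: norm_mult mult.commute)
    qed
    have "norm (LINT y|lborel. G y * \<gamma> m y) \<le> E m * (LINT y|lborel. norm (G y))" for m
    proof -
      have "norm (LINT y|lborel. G y * \<gamma> m y) \<le> (LINT y|lborel. E m * norm (G y))"
        by (rule Bochner_Integration.integral_norm_bound_integral[OF i2]) (use iG E in auto)
      then show ?thesis by simp
    qed
    moreover have "(\<lambda>m. E m * (LINT y|lborel. norm (G y))) \<longlonglongrightarrow> 0 * (LINT y|lborel. norm (G y))"
      unfolding E_def by (intro tendsto_mult_right gauss_weight_tendsto \<eta>)
    ultimately show ?thesis
      by (intro Lim_null_comparison[of "\<lambda>m. LINT y|lborel. G y * \<gamma> m y" "\<lambda>m. E m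
        * (LINT y|lborel. norm (G y))"]) simp_all
  qed
  have "(\<lambda>m. LINT y|lborel. g y * \<gamma> m y) \<longlonglongrightarrow> f x"
    using tendsto_add[OF lim1 lim2] by (simp only: eq add_0_right)
  then show ?thesis by (simp only: \<gamma>_def gauss_prod_def vector_minus_component)
qed

section \<open>Convergence of smoothed Littlewood-Paley sums\<close>

context dyadic
begin

definition phi_sum :: "nat \<Rightarrow> real \<Rightarrow> complex" where
  "phi_sum N x = (\<Sum>n\<le>N. \<phi> n x)"

lemma phi_sum_tendsto: "(\<lambda>N. phi_sum N x) \<longlonglongrightarrow> 1"
  using sys unfolding dyadic_system_def phi_sum_def[abs_def] by (simp add: sums_def_le)

lemma phi_sum_measurable [measurable]: "phi_sum N \<in> borel_measurable borel"
  unfolding phi_sum_def[abs_def] by measurable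

text \<open>At most three symbols are non-zero at any point. Uniformity in N is what dominated
  convergence in \<open>smoothed_partial_sums\<close> requires.\<close>

lemma phi_sum_bounded: "\<exists>B\<ge>0. \<forall>N x. norm (phi_sum N x) \<le> B"
proof -
  obtain B where B: "B \<ge> 0" "\<And>n x. norm (\<phi> n x) \<le> B"
    using phi_deriv_bound[of 0] by auto
  have "norm (phi_sum N x) \<le> 3 * B" for N x
  proof (cases "\<exists>n. \<phi> n x \<noteq> 0")
    case True
    then obtain n where n: "\<phi> n x \<noteq> 0" by blast
    let ?A = "{m\<in>{..N}. \<phi> m x \<noteq> 0}"
    have "?A \<subseteq> {n - 1..n + 1}" using phi_neighbours[OF n] phi_neighbours[OF _ n] by force
    then have card: "card ?A \<le> card {n - 1..n + 1}" by (intro card_mono) auto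
    have "phi_sum N x = (\<Sum>m\<in>?A. \<phi> m x)" unfolding phi_sum_def by (rule sum.mono_neutral_right) auto
    then have "norm (phi_sum N x) \<le> real (card ?A) * B" by (simp add: B sum_norm_bound)
    also have "\<dots> \<le> 3 * B" using card B by (intro mult_right_mono) auto
    finally show ?thesis .
  next
    case False
    then show ?thesis using B by (simp add: phi_sum_def)
  qed
  then show ?thesis using B by (intro exI[of _ "3 * B"]) auto
qed

text \<open>The transform of g need not be integrable, so the series of blocks is not summed
  pointwise. Convolving with a Gaussian multiplies the symbol by the integrable factor
  \<open>E\<close>, and dominated convergence on the Fourier side lets the partial products of
  symbols tend to 1.\<close>

lemma smoothed_partial_sums:
  fixes g :: "real^'d \<Rightarrow> complex" and x :: "real^'d"
  assumes g: "integrable lborel g" and gm [measurable]: "g \<in> borel_measurable borel" and \<delta>: "\<delta> > 0"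
  shows "(\<lambda>N. LINT z|lborel. (\<Sum>l\<in>nat_box N. lp_block \<phi> g l (x - z)) * gauss_prod \<delta> z)
    \<longlonglongrightarrow> (LINT y|lborel. g y * gauss_prod \<delta> (x - y))"
proof -
  define c :: complex where "c = of_real ((2 * pi) powr (- real CARD('d) / 2))"
  define X where "X N \<xi> = (\<Prod>i\<in>UNIV. phi_sum N (\<xi> $ i))" for N and \<xi> :: "real^'d"
  define E where "E \<xi> = (\<Prod>i\<in>UNIV. complex_of_real (exp (- (\<delta> * \<xi> $ i)\<^sup>2 / 2)))" for \<xi> :: "real^'d"
  define \<gamma> :: "real^'d \<Rightarrow> complex" where "\<gamma> = gauss_prod \<delta>"
  note fourier_measurable[OF gm, measurable]
  have [measurable]: "X N \<in> borel_measurable borel" for N unfolding X_def by measurable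
  have [measurable]: "E \<in> borel_measurable borel" unfolding E_def by measurable
  have [measurable]: "\<gamma> \<in> borel_measurable borel" unfolding \<gamma>_def by measurable
  have iE: "integrable lborel E" unfolding E_def by (intro integrable_tensor integrable_gauss_exp \<delta>)
  have i\<gamma>: "integrable lborel \<gamma>" unfolding \<gamma>_def by (rule integrable_gauss_prod[OF \<delta>])
  have Xf: "(\<Sum>l\<in>nat_box N. block_symbol g l \<xi>) = X N \<xi> * fourier g \<xi>" for N \<xi>
    unfolding block_symbol_def[OF g gm] X_def phi_sum_def
      by (subst prod_sum_vec) (auto simp: sum_distrib_right)
  have iX: "integrable lborel (\<lambda>\<xi>. X N \<xi> * fourier g \<xi>)" for N
    unfolding Xf[symmetric] by (intro Bochner_Integration.integrable_sum
      integrable_block_symbol[OF g gm])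
  have S: "(\<Sum>l\<in>nat_box N. lp_block \<phi> g l w) = c * (LINT \<xi>|lborel. X N \<xi> * fourier g \<xi>
    * cis (w \<bullet> \<xi>))" for N w
  proof -
    have "integrable lborel (\<lambda>\<xi>. block_symbol g l \<xi> * cis (w \<bullet> \<xi>))" for l
      by (rule Bochner_Integration.integrable_bound[OF integrable_block_symbol[OF g gm, of l]])
        (use block_symbol_measurable[OF g gm] in \<open>auto simp: norm_mult\<close>)
    then show ?thesis
      unfolding Xf[symmetric] sum_distrib_right
      by (subst Bochner_Integration.integral_sum) (auto simp: lp_block_lborel[OF g gm]
        c_def sum_distrib_left)
  qed
  have cE: "(LINT z|lborel. cis (- (z \<bullet> \<xi>)) * \<gamma> z) = E \<xi>" for \<xi> :: "real^'d"
  proof -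
    have "(LINT z|lborel. cis (- (z \<bullet> \<xi>)) * \<gamma> z) =
      (LINT z|lborel. (\<Prod>i\<in>UNIV. of_real (gauss \<delta> (z $ i)) * cis (- (z $ i * \<xi> $ i))))"
      by (simp add: inner_vec_def sum_negf[symmetric] cis_sum
        \<gamma>_def gauss_prod_def prod.distrib mult.commute del: sum_negf)
    also have "\<dots> = (\<Prod>i\<in>UNIV. (LINT t|lborel. of_real (gauss \<delta> t) * cis (- (t * \<xi> $ i))))"
      by (rule integral_tensor[of "\<lambda>i t. of_real (gauss \<delta> t) * cis (- (t * \<xi> $ i))"],
          rule Bochner_Integration.integrable_bound[OF integrable_gauss[OF \<delta>]])
            (auto simp: norm_mult)
    finally show ?thesis by (simp add: gauss_fourier[OF \<delta>] E_def)
  qed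
  have 1: "(LINT z|lborel. (\<Sum>l\<in>nat_box N. lp_block \<phi> g l (x - z)) * \<gamma> z)
      = c * (LINT \<xi>|lborel. X N \<xi> * fourier g \<xi> * cis (x \<bullet> \<xi>) * E \<xi>)" for N
  proof -
    have "(LINT z|lborel. (\<Sum>l\<in>nat_box N. lp_block \<phi> g l (x - z)) * \<gamma> z)
        = (LINT z|lborel. c * (LINT \<xi>|lborel. X N \<xi> * fourier g \<xi> * cis ((x - z) \<bullet> \<xi>) * \<gamma> z))"
      by (simp only: integral_mult_left_zero) (simp only: S mult.assoc)
    also have "\<dots> = c * (LINT z|lborel. (LINT \<xi>|lborel. X N \<xi> * fourier g \<xi> * cis ((x - z) \<bullet> \<xi>)
      * \<gamma> z))"
      by (rule integral_mult_right_zero)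
    also have "(LINT z|lborel. (LINT \<xi>|lborel. X N \<xi> * fourier g \<xi> * cis ((x - z) \<bullet> \<xi>) * \<gamma> z))
        = (LINT \<xi>|lborel. (LINT z|lborel. X N \<xi> * fourier g \<xi> * cis ((x - z) \<bullet> \<xi>) * \<gamma> z))"
      by (rule Fubini_pair_bound[OF iX i\<gamma>]) (auto simp: norm_mult)
    also have "\<dots> = (LINT \<xi>|lborel. X N \<xi> * fourier g \<xi> * cis (x \<bullet> \<xi>) * E \<xi>)"
    proof (intro Bochner_Integration.integral_cong refl)
      fix \<xi>
      have "cis ((x - z) \<bullet> \<xi>) = cis (x \<bullet> \<xi>) * cis (- (z \<bullet> \<xi>))" for z
        by (simp add: cis_mult inner_diff_left)
      then have "(LINT z|lborel. X N \<xi> * fourier g \<xi> * cis ((x - z) \<bullet> \<xi>) * \<gamma> z)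
        = (LINT z|lborel. X N \<xi> * fourier g \<xi> * cis (x \<bullet> \<xi>) * (cis (- (z \<bullet> \<xi>)) * \<gamma> z))"
        by (simp only: mult.assoc)
      then show "(LINT z|lborel. X N \<xi> * fourier g \<xi> * cis ((x - z) \<bullet> \<xi>) * \<gamma> z) = X N \<xi>
        * fourier g \<xi> * cis (x \<bullet> \<xi>) * E \<xi>"
        by (simp only: integral_mult_right_zero cE)
    qed
    finally show ?thesis .
  qed
  \<comment> \<open>The limit is identified by a second use of Fubini, now on the integral defining
    \<open>fourier g\<close>; this stands in for an inversion theorem for g.\<close>
  have 2: "(LINT \<xi>|lborel. fourier g \<xi> * cis (x \<bullet> \<xi>) * E \<xi>) * c = (LINT y|lborel. g y * \<gamma> (x - y))"
  proof -
    have b: "(LINT \<xi>|lborel. cis ((x - y) \<bullet> \<xi>) * E \<xi>) = of_real ((2 * pi) ^ CARD('d)) * \<gamma> (x - y)"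
      for y
    proof -
      have "(LINT \<xi>|lborel. cis ((x - y) \<bullet> \<xi>) * E \<xi>)
        = (LINT \<xi>|lborel. (\<Prod>i\<in>UNIV. of_real (exp (- (\<delta> * \<xi> $ i)\<^sup>2 / 2))
        * cis ((x - y) $ i * \<xi> $ i)))"
        by (simp only: inner_vec_def inner_real_def cis_sum E_def prod.distrib mult.commute)
      also have "\<dots> = (\<Prod>i\<in>UNIV. (LINT t|lborel. of_real (exp (- (\<delta> * t)\<^sup>2 / 2))
        * cis ((x - y) $ i * t)))"
        by (rule integral_tensor[of "\<lambda>i t. of_real (exp (- (\<delta> * t)\<^sup>2 / 2))
          * cis ((x - y) $ i * t)"],
          rule Bochner_Integration.integrable_bound[OF integrable_gauss_exp[OF \<delta>]])
            (auto simp: norm_mult)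
      also have "\<dots> = (\<Prod>i\<in>UNIV. of_real (2 * pi) * of_real (gauss \<delta> ((x - y) $ i)))"
        unfolding gauss_exp_fourier[OF \<delta>] by simp
      finally show ?thesis by (simp only: prod.distrib prod_constant
        \<gamma>_def gauss_prod_def of_real_power)
    qed
    \<comment> \<open>The normalising factors of the transform and of its inverse cancel the power
      of 2 pi produced by the Gaussian integrals.\<close>
    have cc: "c * c * of_real ((2 * pi) ^ CARD('d)) = 1"
    proof -
      have "b powr (- real CARD('d) / 2) * b powr (- real CARD('d) / 2) * b ^ CARD('d) = 1"
        if "b > 0" for b :: real
        using that by (simp add: powr_add[symmetric] powr_realpow[symmetric])
      from this[of "2 * pi"]
      have "((2 * pi) powr (- real CARD('d) / 2)) * ((2 * pi) powr (- real CARD('d) / 2))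
        * (2 * pi) ^ CARD('d) = 1"
        by simp
      then show ?thesis unfolding c_def by (metis of_real_1 of_real_mult)
    qed
    have "(LINT \<xi>|lborel. fourier g \<xi> * cis (x \<bullet> \<xi>) * E \<xi>)
      = (LINT \<xi>|lborel. c * (LINT y|lborel. g y * cis ((x - y) \<bullet> \<xi>) * E \<xi>))"
    proof (intro Bochner_Integration.integral_cong refl)
      fix \<xi>
      have "cis (- (\<xi> \<bullet> y)) * (cis (x \<bullet> \<xi>) * E \<xi>) = cis ((x - y) \<bullet> \<xi>) * E \<xi>" for y
        unfolding mult.assoc[symmetric] cis_mult by (simp add: inner_diff_left inner_diff_right
          inner_commute)
      then have "(LINT y|lborel. g y * cis (- (\<xi> \<bullet> y)) * (cis (x \<bullet> \<xi>) * E \<xi>))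
        = (LINT y|lborel. g y * cis ((x - y) \<bullet> \<xi>) * E \<xi>)"
        by (simp only: mult.assoc)
      then show "fourier g \<xi> * cis (x \<bullet> \<xi>) * E \<xi> = c * (LINT y|lborel. g y * cis ((x - y) \<bullet> \<xi>)
        * E \<xi>)"
        unfolding fourier_lborel[OF gm] c_def[symmetric] integral_mult_left_zero
          by (simp only: mult.assoc)
    qed
    also have "\<dots> = c * (LINT \<xi>|lborel. (LINT y|lborel. g y * cis ((x - y) \<bullet> \<xi>) * E \<xi>))"
      by (rule integral_mult_right_zero)
    also have "(LINT \<xi>|lborel. (LINT y|lborel. g y * cis ((x - y) \<bullet> \<xi>) * E \<xi>))
      = (LINT y|lborel. (LINT \<xi>|lborel. g y * cis ((x - y) \<bullet> \<xi>) * E \<xi>))"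
      by (rule Fubini_pair_bound[OF g iE]) (auto simp: norm_mult)
    also have "\<dots> = (LINT y|lborel. of_real ((2 * pi) ^ CARD('d)) * (g y * \<gamma> (x - y)))"
    proof (intro Bochner_Integration.integral_cong refl)
      fix y
      have "(LINT \<xi>|lborel. g y * cis ((x - y) \<bullet> \<xi>) * E \<xi>) = g y * (LINT \<xi>|lborel. cis ((x - y) \<bullet> \<xi>)
        * E \<xi>)"
        unfolding mult.assoc by (rule integral_mult_right_zero)
      then show "(LINT \<xi>|lborel. g y * cis ((x - y) \<bullet> \<xi>) * E \<xi>) = of_real ((2 * pi) ^ CARD('d))
        * (g y * \<gamma> (x - y))"
        unfolding b by (simp only: mult_ac)
    qed
    also have "\<dots> = of_real ((2 * pi) ^ CARD('d)) * (LINT y|lborel. g y * \<gamma> (x - y))"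
      by (rule integral_mult_right_zero)
    finally have "(LINT \<xi>|lborel. fourier g \<xi> * cis (x \<bullet> \<xi>) * E \<xi>) * c
      = (c * c * of_real ((2 * pi) ^ CARD('d))) * (LINT y|lborel. g y * \<gamma> (x - y))"
      by (simp only: mult_ac)
    then show ?thesis unfolding cc by simp
  qed
  obtain K where K: "K \<ge> 0" "\<And>\<xi>. norm (fourier g \<xi>) \<le> K" using fourier_bounded[OF g gm] by blast
  obtain B where B: "B \<ge> 0" "\<And>N x. norm (phi_sum N x) \<le> B" using phi_sum_bounded by blast
  have "(\<lambda>N. LINT \<xi>|lborel. X N \<xi> * fourier g \<xi> * cis (x \<bullet> \<xi>) * E \<xi>) \<longlonglongrightarrow> (LINT \<xi>|lborel. fourier g \<xi>
    * cis (x \<bullet> \<xi>) * E \<xi>)"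
  proof (rule integral_dominated_convergence[where w="\<lambda>\<xi>. B ^ CARD('d) * K * norm (E \<xi>)"])
    show "AE \<xi> in lborel. (\<lambda>N. X N \<xi> * fourier g \<xi> * cis (x \<bullet> \<xi>) * E \<xi>) \<longlonglongrightarrow> fourier g \<xi> * cis (x \<bullet> \<xi>)
      * E \<xi>"
    proof (rule AE_I2)
      fix \<xi> :: "real^'d"
      have "(\<lambda>N. X N \<xi>) \<longlonglongrightarrow> (\<Prod>i\<in>(UNIV::'d set). 1)" unfolding X_def
        by (intro tendsto_prod phi_sum_tendsto)
      then have "(\<lambda>N. X N \<xi> * (fourier g \<xi> * cis (x \<bullet> \<xi>) * E \<xi>)) \<longlonglongrightarrow> 1 * (fourier g \<xi> * cis (x \<bullet> \<xi>)
        * E \<xi>)"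
        by (intro tendsto_mult_right) simp
      then show "(\<lambda>N. X N \<xi> * fourier g \<xi> * cis (x \<bullet> \<xi>) * E \<xi>) \<longlonglongrightarrow> fourier g \<xi> * cis (x \<bullet> \<xi>) * E \<xi>"
        by (simp add: mult.assoc)
    qed
    show "AE \<xi> in lborel. norm (X N \<xi> * fourier g \<xi> * cis (x \<bullet> \<xi>) * E \<xi>) \<le> B ^ CARD('d) * K
      * norm (E \<xi>)" for N
    proof (rule AE_I2)
      fix \<xi> :: "real^'d"
      have "norm (X N \<xi>) \<le> (\<Prod>i\<in>(UNIV::'d set). B)"
        unfolding X_def prod_norm[symmetric] by (intro prod_mono) (auto simp: B)
      then show "norm (X N \<xi> * fourier g \<xi> * cis (x \<bullet> \<xi>) * E \<xi>) \<le> B ^ CARD('d) * K * norm (E \<xi>)"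
        using K B by (simp add: norm_mult) (intro mult_right_mono mult_mono, auto)
    qed
  qed (use iE in auto)
  then have "(\<lambda>N. c * (LINT \<xi>|lborel. X N \<xi> * fourier g \<xi> * cis (x \<bullet> \<xi>) * E \<xi>)) \<longlonglongrightarrow> c
    * (LINT \<xi>|lborel. fourier g \<xi> * cis (x \<bullet> \<xi>) * E \<xi>)"
    by (rule tendsto_mult_left)
  then show ?thesis using 2 unfolding 1[symmetric] by (simp add: \<gamma>_def mult.commute)
qed

end

section \<open>Summability of the Faber coefficients\<close>

text \<open>Members of \<open>SF_space\<close> are only Lebesgue measurable, whereas the arguments
  on product spaces are for Borel functions. Real and imaginary parts are replaced
  separately.\<close>

lemma borel_representative:
  fixes g :: "real^'d \<Rightarrow> complex"
  assumes g: "integrable lebesgue g"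
  obtains g' where "g' \<in> borel_measurable borel" "integrable lborel g'" "AE x in lborel. g x = g' x"
proof -
  have gm [measurable]: "g \<in> borel_measurable lebesgue" using g by auto
  have re: "(\<lambda>x. Re (g x)) \<in> borel_measurable lebesgue" and im: "(\<lambda>x. Im (g x)) \<in>
    borel_measurable lebesgue" by measurable
  from completion_ex_borel_measurable_real[OF re] obtain r where [measurable]: "r \<in>
    borel_measurable lborel"
    and r: "AE x in lborel. Re (g x) = r x" by blast
  from completion_ex_borel_measurable_real[OF im] obtain i where [measurable]: "i \<in>
    borel_measurable lborel"
    and i: "AE x in lborel. Im (g x) = i x" by blast
  define g' where "g' x = of_real (r x) + \<i> * of_real (i x)" for x
  have m: "g' \<in> borel_measurable lborel" unfolding g'_def by measurable
  have ae: "AE x in lborel. g x = g' x"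
    using r i by eventually_elim (simp add: g'_def complex_eq_iff)
  have "integrable lebesgue g'"
    by (rule integrable_cong_AE_imp[OF g]) (use m ae in \<open>auto intro:
      measurable_completion AE_completion simp: eq_commute\<close>)
  then have "integrable lborel g'" using m by (simp add: integrable_completion)
  then show ?thesis using that m ae by simp
qed

text \<open>The Fourier integral does not see null sets, so the blocks of the two functions coincide
  at every point and not merely almost everywhere.\<close>

lemma SF_norm_cong_AE:
  fixes g g' :: "real^'d \<Rightarrow> complex"
  assumes [measurable]: "g \<in> borel_measurable lebesgue" "g' \<in> borel_measurable lebesgue"
    and ae: "AE x in lborel. g x = g' x"
  shows "SF_norm \<phi> g = SF_norm \<phi> g'"
proof -
  have "fourier g \<xi> = fourier g' \<xi>" for \<xi>
  proof -
    have "(\<lambda>x :: real^'d. cis (- (\<xi> \<bullet> x))) \<in> borel_measurable lborel" by measurable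
    then have [measurable]: "(\<lambda>x :: real^'d. cis (- (\<xi> \<bullet> x))) \<in> borel_measurable lebesgue"
      by (rule measurable_completion)
    have "AE x in lebesgue. g x * cis (- (\<xi> \<bullet> x)) = g' x * cis (- (\<xi> \<bullet> x))"
      by (rule AE_completion) (use ae in \<open>eventually_elim, simp\<close>)
    then have "(LINT x|lebesgue. g x * cis (- (\<xi> \<bullet> x))) = (LINT x|lebesgue. g' x * cis (- (\<xi> \<bullet> x)))"
      by (intro integral_cong_AE) auto
    then show ?thesis by (simp add: fourier_def)
  qed
  then have "fourier g = fourier g'" by (rule ext)
  then show ?thesis by (simp add: SF_norm_def lp_block_def)
qed

lemma stencil_node_bounds:
  assumes "-1 \<le> j" "k \<in> faber_idx1 j" "s \<le> 2"
  shows "0 \<le> stencil_node j k s" "stencil_node j k s \<le> 1"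
proof -
  show "0 \<le> stencil_node j k s" by (simp add: stencil_node_def)
  show "stencil_node j k s \<le> 1"
  proof (cases "j = -1")
    case True
    then show ?thesis using assms by (auto simp: stencil_node_def faber_idx1_def)
  next
    case False
    then obtain i where i: "j = int i" using assms(1) by (intro that[of "nat j"]) auto
    have p: "2 powi (- (j + 1)) = (1 / (2 * 2 ^ i) :: real)" "2 powi (- j) = (1 / 2 ^ i :: real)"
      using i by (simp_all add: power_int_minus power_int_diff divide_simps)
    have "k + 1 \<le> 2 ^ i" using assms(2) i by (simp add: faber_idx1_def)
    then have "real k + 1 \<le> 2 ^ i" using of_nat_mono[of "k + 1" "2 ^ i", where 'a=real] by simp
    moreover have "real s \<le> 2" using assms(3) by simp
    ultimately have "real s + 2 * real k \<le> 2 * 2 ^ i" by linarith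
    then show ?thesis unfolding stencil_node_def p using False by (simp add: field_simps)
  qed
qed

context dyadic
begin

text \<open>The nodes are contracted towards the centre by a factor \<open>\<mu> < 1\<close>, because \<open>f\<close> can only be
  recovered from \<open>g\<close> by smoothing at interior points of the cube.\<close>

lemma faber_stencil_bound:
  "\<exists>C>0. \<forall>(f :: real^'d \<Rightarrow> complex) g (j::int^'d). continuous_on unit_cube f \<longrightarrow> g \<in> SF_extensions \<phi> f
    \<longrightarrow> (\<forall>i. -1 \<le> j $ i) \<longrightarrow>
    (\<Sum>k\<in>faber_idx j. norm (\<Sum>\<sigma>\<in>nat_box 2. stencil_prod j \<sigma> *
          f (\<chi> i. stencil_node (j $ i) (k $ i) (\<sigma> $ i)))) \<le> C * enn2real (SF_norm \<phi> g)"
proof -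
  let ?V = "nat_box 2 :: (nat^'d) set"
  have finV: "finite ?V" by (rule finite_vec_components) simp
  obtain C where C0: "C > 0" and C_all: "\<forall>(g :: real^'d \<Rightarrow> complex). integrable lborel g
    \<longrightarrow> g \<in> borel_measurable borel \<longrightarrow>
    (\<forall>N (j::int^'d) \<mu> (\<alpha>::'d \<Rightarrow> real). (\<forall>i. -1 \<le> j $ i) \<longrightarrow> 1/2 \<le> \<mu> \<longrightarrow> \<mu> \<le> 1 \<longrightarrow>
      (\<Sum>l\<in>nat_box N. \<Sum>k\<in>faber_idx j.
        ennreal (norm (\<Sum>\<sigma>\<in>?V. stencil_prod j \<sigma> *
          lp_block \<phi> g l (\<chi> i. \<mu> * stencil_node (j $ i) (k $ i) (\<sigma> $ i) + \<alpha> i)))) \<le> ennreal C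
            * SF_norm \<phi> g)"
    using stencil_sum_bound[where 'd='d] by (elim exE conjE)
  note C = C0 C_all[rule_format]
  show ?thesis
  proof (intro exI[of _ C] conjI allI impI C(1))
    fix f g0 :: "real^'d \<Rightarrow> complex" and j :: "int^'d"
    assume f: "continuous_on unit_cube f" and ext: "g0 \<in> SF_extensions \<phi> f" and j: "\<forall>i. -1 \<le> j $ i"
    have g0: "integrable lebesgue g0" "SF_norm \<phi> g0 < \<infinity>" and g0f: "AE x in lebesgue. x \<in> unit_cube
      \<longrightarrow> g0 x = f x"
      using ext by (auto simp: SF_extensions_def SF_space_def)
    obtain g where gm [measurable]: "g \<in> borel_measurable borel" and g: "integrable lborel g"
      and gg: "AE x in lborel. g0 x = g x"
      using borel_representative[OF g0(1)] .
    have N: "SF_norm \<phi> g0 = SF_norm \<phi> g"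
      by (rule SF_norm_cong_AE[OF _ _ gg]) (use g0 gm in \<open>auto intro: measurable_completion\<close>)
    define M where "M = enn2real (SF_norm \<phi> g0)"
    have M: "SF_norm \<phi> g = ennreal M" "M \<ge> 0" using g0(2) by (auto simp: M_def N)
    have gf: "AE x in lborel. x \<in> unit_cube \<longrightarrow> g x = f x"
    proof -
      have "AE x in lborel. x \<in> unit_cube \<longrightarrow> g0 x = f x" using g0f by (simp add: AE_completion_iff)
      with gg show ?thesis by eventually_elim auto
    qed
    define c where "c \<sigma> = stencil_prod j \<sigma>" for \<sigma> :: "nat^'d"
    define p where "p \<mu> \<alpha> k \<sigma> = (\<chi> i. \<mu> * stencil_node (j $ i) (k $ i) (\<sigma> $ i) + \<alpha>)"
      for \<mu> \<alpha> and k \<sigma> :: "nat^'d"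
    define S where "S N w = (\<Sum>l\<in>nat_box N. lp_block \<phi> g l w)" for N w
    note lp_block_measurable[OF g gm, measurable]
    have [measurable]: "S N \<in> borel_measurable borel" for N unfolding S_def by measurable
    have finL: "finite (nat_box N :: (nat^'d) set)" for N by (rule finite_vec_components) simp
    have Sb: "\<exists>B. \<forall>w. norm (S N w) \<le> B" for N
    proof -
      obtain B where B: "\<And>l w. norm (lp_block \<phi> g l w) \<le> B l" using lp_block_bounded[OF g gm]
        by metis
      have "norm (S N w) \<le> (\<Sum>l\<in>nat_box N. B l)" for w
        unfolding S_def by (intro sum_norm_le B)
      then show ?thesis by blast
    qed
    \<comment> \<open>The triangle inequality over the scales turns the bound for blocks into one
      for their partial sum at translated nodes, with a constant free of N and z.\<close>
    have step1: "(\<Sum>k\<in>faber_idx j. norm (\<Sum>\<sigma>\<in>?V. c \<sigma> * S N (p \<mu> \<alpha> k \<sigma> - z))) \<le> C * M"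
      if \<mu>: "1/2 \<le> \<mu>" "\<mu> \<le> 1" for N \<mu> \<alpha> z
    proof -
      define a where "a l k = norm (\<Sum>\<sigma>\<in>?V. c \<sigma> * lp_block \<phi> g l (\<chi> i. \<mu>
        * stencil_node (j $ i) (k $ i) (\<sigma> $ i) + (\<alpha> - z $ i)))" for l k
      have e: "p \<mu> \<alpha> k \<sigma> - z = (\<chi> i. \<mu> * stencil_node (j $ i) (k $ i) (\<sigma> $ i) + (\<alpha> - z $ i))"
        for k \<sigma>
        by (simp add: p_def vec_eq_iff)
      have "(\<Sum>k\<in>faber_idx j. norm (\<Sum>\<sigma>\<in>?V. c \<sigma> * S N (p \<mu> \<alpha> k \<sigma> - z)))
          \<le> (\<Sum>k\<in>faber_idx j. \<Sum>l\<in>nat_box N. a l k)"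
      proof (rule sum_mono)
        fix k
        have "(\<Sum>\<sigma>\<in>?V. c \<sigma> * S N (p \<mu> \<alpha> k \<sigma> - z)) =
           (\<Sum>l\<in>nat_box N. \<Sum>\<sigma>\<in>?V. c \<sigma> * lp_block \<phi> g l (\<chi> i. \<mu> * stencil_node (j $ i) (k $ i) (\<sigma> $ i)
             + (\<alpha> - z $ i)))"
          unfolding S_def e sum_distrib_left by (rule sum.swap)
        then show "norm (\<Sum>\<sigma>\<in>?V. c \<sigma> * S N (p \<mu> \<alpha> k \<sigma> - z)) \<le> (\<Sum>l\<in>nat_box N. a l k)"
          unfolding a_def by (simp only: norm_sum)
      qed
      also have "\<dots> = (\<Sum>l\<in>nat_box N. \<Sum>k\<in>faber_idx j. a l k)" by (rule sum.swap)
      also have "\<dots> \<le> C * M"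
      proof -
        have "ennreal (\<Sum>l\<in>nat_box N. \<Sum>k\<in>faber_idx j. a l k)
          = (\<Sum>l\<in>nat_box N. \<Sum>k\<in>faber_idx j. ennreal (a l k))"
          unfolding a_def by (subst sum_ennreal, rule norm_ge_zero, subst sum_ennreal,
            intro sum_nonneg norm_ge_zero, rule refl)
        also have "\<dots> \<le> ennreal C * SF_norm \<phi> g"
          unfolding a_def c_def by (rule C(2)[OF g gm j[rule_format] \<mu>])
        also have "\<dots> = ennreal (C * M)" using C M by (simp add: ennreal_mult)
        finally show ?thesis using C M by (subst (asm) ennreal_le_iff) auto
      qed
      finally show ?thesis .
    qed
    \<comment> \<open>The Gaussian product is nonnegative with total mass 1, so averaging over the
      translation z keeps the constant.\<close>
    have step2: "(\<Sum>k\<in>faber_idx j. norm (\<Sum>\<sigma>\<in>?V. c \<sigma> * (LINT z|lborel. S N (p \<mu> \<alpha> k \<sigma> - z)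
      * gauss_prod \<delta> z))) \<le> C * M"
      if \<mu>: "1/2 \<le> \<mu>" "\<mu> \<le> 1" and \<delta>: "\<delta> > 0" for N \<mu> \<alpha> \<delta>
    proof -
      define \<gamma> :: "real^'d \<Rightarrow> complex" where "\<gamma> = gauss_prod \<delta>"
      have [measurable]: "\<gamma> \<in> borel_measurable borel" unfolding \<gamma>_def by measurable
      have i\<gamma>: "integrable lborel \<gamma>" unfolding \<gamma>_def by (rule integrable_gauss_prod[OF \<delta>])
      have n\<gamma>: "\<gamma> z = of_real (norm (\<gamma> z))" for z
        unfolding \<gamma>_def gauss_prod_def prod_norm[symmetric] using \<delta> by (simp add: gauss_nonneg)
      have \<gamma>1: "(LINT z|lborel. norm (\<gamma> z)) = 1"
      proof -
        have "complex_of_real (LINT z|lborel. norm (\<gamma> z)) = (LINT z|lborel. \<gamma> z)"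
          by (subst n\<gamma>) (rule integral_complex_of_real[symmetric])
        also have "\<dots> = (\<Prod>i\<in>(UNIV::'d set). (LINT t|lborel. of_real (gauss \<delta> t)))"
          unfolding \<gamma>_def gauss_prod_def by (rule integral_tensor[of "\<lambda>_ t. of_real (gauss \<delta> t)"])
            (intro integrable_of_real integrable_gauss \<delta>)
        finally show ?thesis using integral_gauss[OF \<delta>] by simp
      qed
      obtain B where B: "\<And>w. norm (S N w) \<le> B" using Sb by blast
      have i1: "integrable lborel (\<lambda>z. S N (w - z) * \<gamma> z)" for w
      proof (rule Bochner_Integration.integrable_bound[of _ "\<lambda>z. of_real B * \<gamma> z"])
        show "AE z in lborel. norm (S N (w - z) * \<gamma> z) \<le> norm (of_real B * \<gamma> z)"
          using B order_trans[OF B abs_ge_self] by (auto simp: norm_mult intro!: mult_right_mono)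
      qed (use i\<gamma> in auto)
      have i2: "integrable lborel (\<lambda>z. (\<Sum>\<sigma>\<in>?V. c \<sigma> * S N (p \<mu> \<alpha> k \<sigma> - z)) * \<gamma> z)" for k
        unfolding sum_distrib_right mult.assoc by (intro Bochner_Integration.integrable_sum
          integrable_mult_right i1)
      have "(\<Sum>k\<in>faber_idx j. norm (\<Sum>\<sigma>\<in>?V. c \<sigma> * (LINT z|lborel. S N (p \<mu> \<alpha> k \<sigma> - z) * \<gamma> z)))
          = (\<Sum>k\<in>faber_idx j. norm (LINT z|lborel. (\<Sum>\<sigma>\<in>?V. c \<sigma> * S N (p \<mu> \<alpha> k \<sigma> - z)) * \<gamma> z))"
        unfolding sum_distrib_right mult.assoc
        by (subst Bochner_Integration.integral_sum) (auto intro!: integrable_mult_right i1)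
      also have "\<dots> \<le> (\<Sum>k\<in>faber_idx j. (LINT z|lborel. norm ((\<Sum>\<sigma>\<in>?V. c \<sigma> * S N (p \<mu> \<alpha> k \<sigma> - z))
        * \<gamma> z)))"
        by (intro sum_mono integral_norm_bound)
      also have "\<dots> = (LINT z|lborel. (\<Sum>k\<in>faber_idx j. norm ((\<Sum>\<sigma>\<in>?V. c \<sigma> * S N (p \<mu> \<alpha> k \<sigma> - z))
        * \<gamma> z)))"
        by (rule Bochner_Integration.integral_sum[symmetric]) (intro integrable_norm i2)
      also have "\<dots> \<le> (LINT z|lborel. C * M * norm (\<gamma> z))"
      proof (rule integral_mono)
        show "integrable lborel (\<lambda>z. \<Sum>k\<in>faber_idx j. norm ((\<Sum>\<sigma>\<in>?V. c \<sigma> * S N (p \<mu> \<alpha> k \<sigma> - z))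
          * \<gamma> z))"
          by (intro Bochner_Integration.integrable_sum integrable_norm i2)
        show "integrable lborel (\<lambda>z. C * M * norm (\<gamma> z))" using i\<gamma> by auto
        show "(\<Sum>k\<in>faber_idx j. norm ((\<Sum>\<sigma>\<in>?V. c \<sigma> * S N (p \<mu> \<alpha> k \<sigma> - z)) * \<gamma> z)) \<le> C * M
          * norm (\<gamma> z)" for z
          unfolding norm_mult sum_distrib_right[symmetric] by (intro mult_right_mono step1 \<mu>) auto
      qed
      also have "\<dots> = C * M" using \<gamma>1 by simp
      finally show ?thesis unfolding \<gamma>_def .
    qed
    have step3: "(\<Sum>k\<in>faber_idx j. norm (\<Sum>\<sigma>\<in>?V. c \<sigma>
      * (LINT y|lborel. g y * gauss_prod \<delta> (p \<mu> \<alpha> k \<sigma> - y)))) \<le> C * M"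
      if \<mu>: "1/2 \<le> \<mu>" "\<mu> \<le> 1" and \<delta>: "\<delta> > 0" for \<mu> \<alpha> \<delta>
    proof (rule LIMSEQ_le_const2)
      show "(\<lambda>N. \<Sum>k\<in>faber_idx j. norm (\<Sum>\<sigma>\<in>?V. c \<sigma> * (LINT z|lborel. S N (p \<mu> \<alpha> k \<sigma> - z)
        * gauss_prod \<delta> z)))
        \<longlonglongrightarrow> (\<Sum>k\<in>faber_idx j. norm (\<Sum>\<sigma>\<in>?V. c \<sigma> * (LINT y|lborel. g y * gauss_prod \<delta> (p \<mu> \<alpha> k \<sigma> - y))))"
        unfolding S_def by (intro tendsto_sum tendsto_norm tendsto_mult tendsto_const
          smoothed_partial_sums g gm \<delta>)
      show "\<exists>N0. \<forall>N\<ge>N0. (\<Sum>k\<in>faber_idx j. norm (\<Sum>\<sigma>\<in>?V. c \<sigma> * (LINT z|lborel. S N (p \<mu> \<alpha> k \<sigma> - z)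
        * gauss_prod \<delta> z))) \<le> C * M"
        using step2[OF \<mu> \<delta>] by blast
    qed
    \<comment> \<open>The shift (1 - \<mu>)/2 centres the contraction: nodes in [0, 1] go to
      [(1 - \<mu>)/2, (1 + \<mu>)/2], strictly inside the unit interval.\<close>
    have step4: "(\<Sum>k\<in>faber_idx j. norm (\<Sum>\<sigma>\<in>?V. c \<sigma> * f (p \<mu> ((1 - \<mu>) / 2) k \<sigma>))) \<le> C * M"
      if \<mu>: "1/2 \<le> \<mu>" "\<mu> < 1" for \<mu>
    proof (rule LIMSEQ_le_const2)
      have lim: "(\<lambda>m. LINT y|lborel. g y * gauss_prod (1 / real (Suc m)) (p \<mu> ((1 - \<mu>) / 2) k \<sigma>
        - y)) \<longlonglongrightarrow> f (p \<mu> ((1 - \<mu>) / 2) k \<sigma>)"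
        if k: "k \<in> faber_idx j" and \<sigma>: "\<sigma> \<in> ?V" for k \<sigma>
      proof (rule gauss_approximation[OF f g gm gf])
        fix i
        have n: "0 \<le> stencil_node (j $ i) (k $ i) (\<sigma> $ i)" "stencil_node (j $ i) (k $ i) (\<sigma> $ i)
          \<le> 1"
          using stencil_node_bounds[of "j $ i" "k $ i" "\<sigma> $ i"] j k \<sigma> by (auto simp: faber_idx_def)
        define t where "t = \<mu> * stencil_node (j $ i) (k $ i) (\<sigma> $ i)"
        have "0 \<le> t" "t \<le> \<mu>"
          using n \<mu> mult_left_mono[of "stencil_node (j $ i) (k $ i) (\<sigma> $ i)" 1 \<mu>]
            by (auto simp: t_def)
        then have "0 < t + (1 - \<mu>) / 2 \<and> t + (1 - \<mu>) / 2 < 1" using \<mu> by (simp add: field_simps)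
        then have *: "0 < p \<mu> ((1 - \<mu>) / 2) k \<sigma> $ i \<and> p \<mu> ((1 - \<mu>) / 2) k \<sigma> $ i < 1"
          by (simp only: p_def t_def vec_lambda_beta)
        from * show "0 < p \<mu> ((1 - \<mu>) / 2) k \<sigma> $ i" by (rule conjunct1)
        from * show "p \<mu> ((1 - \<mu>) / 2) k \<sigma> $ i < 1" by (rule conjunct2)
      qed
      show "(\<lambda>m. \<Sum>k\<in>faber_idx j. norm (\<Sum>\<sigma>\<in>?V. c \<sigma> * (LINT y|lborel. g y
        * gauss_prod (1 / real (Suc m)) (p \<mu> ((1 - \<mu>) / 2) k \<sigma> - y))))
         \<longlonglongrightarrow> (\<Sum>k\<in>faber_idx j. norm (\<Sum>\<sigma>\<in>?V. c \<sigma> * f (p \<mu> ((1 - \<mu>) / 2) k \<sigma>)))"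
        by (intro tendsto_sum tendsto_norm tendsto_mult tendsto_const lim)
      show "\<exists>N0. \<forall>m\<ge>N0. (\<Sum>k\<in>faber_idx j. norm (\<Sum>\<sigma>\<in>?V. c \<sigma>
        * (LINT y|lborel. g y * gauss_prod (1 / real (Suc m)) (p \<mu> ((1 - \<mu>) / 2) k \<sigma> - y)))) \<le> C
        * M"
        using step3[of \<mu>] \<mu> by (auto simp del: of_nat_Suc)
    qed
    show "(\<Sum>k\<in>faber_idx j. norm (\<Sum>\<sigma>\<in>?V. stencil_prod j \<sigma>
      * f (\<chi> i. stencil_node (j $ i) (k $ i) (\<sigma> $ i)))) \<le> C * enn2real (SF_norm \<phi> g0)"
      unfolding c_def[symmetric] M_def[symmetric]
    proof (rule LIMSEQ_le_const2)
      define \<mu> where "\<mu> m = 1 - 1 / real (Suc (Suc m))" for m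
      have \<mu>: "1/2 \<le> \<mu> m" "\<mu> m < 1" for m by (auto simp: \<mu>_def field_simps)
      have \<mu>1: "\<mu> \<longlonglongrightarrow> 1"
      proof -
        have "\<mu> \<longlonglongrightarrow> 1 - 0" unfolding \<mu>_def[abs_def]
          by (intro tendsto_diff tendsto_const LIMSEQ_Suc[OF LIMSEQ_Suc[OF lim_1_over_n]])
        then show ?thesis by simp
      qed
      have lim: "(\<lambda>m. f (p (\<mu> m) ((1 - \<mu> m) / 2) k \<sigma>))
        \<longlonglongrightarrow> f (\<chi> i. stencil_node (j $ i) (k $ i) (\<sigma> $ i))"
        if k: "k \<in> faber_idx j" and \<sigma>: "\<sigma> \<in> ?V" for k \<sigma>
      proof (rule continuous_on_tendsto_compose[OF f])
        have n: "0 \<le> stencil_node (j $ i) (k $ i) (\<sigma> $ i)" "stencil_node (j $ i) (k $ i) (\<sigma> $ i)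
          \<le> 1" for i
          using stencil_node_bounds[of "j $ i" "k $ i" "\<sigma> $ i"] j k \<sigma> by (auto simp: faber_idx_def)
        have "(\<lambda>m. \<mu> m * stencil_node (j $ i) (k $ i) (\<sigma> $ i) + (1 - \<mu> m) / 2) \<longlonglongrightarrow> 1
          * stencil_node (j $ i) (k $ i) (\<sigma> $ i) + (1 - 1) / 2" for i
          by (intro tendsto_add tendsto_mult tendsto_divide tendsto_diff tendsto_const \<mu>1) auto
        then show "(\<lambda>m. p (\<mu> m) ((1 - \<mu> m) / 2) k \<sigma>) \<longlonglongrightarrow> (\<chi> i. stencil_node (j $ i) (k $ i) (\<sigma> $ i))"
          by (intro vec_tendstoI) (simp add: p_def)
        show "(\<chi> i. stencil_node (j $ i) (k $ i) (\<sigma> $ i)) \<in> unit_cube"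
          using n by (simp add: mem_box_cart)
        have "0 \<le> \<mu> m * stencil_node (j $ i) (k $ i) (\<sigma> $ i) + (1 - \<mu> m) / 2 \<and> \<mu> m
          * stencil_node (j $ i) (k $ i) (\<sigma> $ i) + (1 - \<mu> m) / 2 \<le> 1" for m i
        proof -
          define t where "t = \<mu> m * stencil_node (j $ i) (k $ i) (\<sigma> $ i)"
          have "0 \<le> t" "t \<le> \<mu> m"
            using n[of i] \<mu>[of m] mult_left_mono[of "stencil_node (j $ i) (k $ i) (\<sigma> $ i)" 1 "\<mu> m"]
              by (auto simp: t_def)
          then show ?thesis unfolding t_def[symmetric] using \<mu>[of m] by (simp add: field_simps)
        qed
        then show "\<forall>\<^sub>F m in sequentially. (p (\<mu> m) ((1 - \<mu> m) / 2) k \<sigma>) \<in> unit_cube"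
          by (simp add: p_def mem_box_cart)
      qed
      show "(\<lambda>m. \<Sum>k\<in>faber_idx j. norm (\<Sum>\<sigma>\<in>?V. c \<sigma> * f (p (\<mu> m) ((1 - \<mu> m) / 2) k \<sigma>)))
         \<longlonglongrightarrow> (\<Sum>k\<in>faber_idx j. norm (\<Sum>\<sigma>\<in>?V. c \<sigma> * f (\<chi> i. stencil_node (j $ i) (k $ i) (\<sigma> $ i))))"
        by (intro tendsto_sum tendsto_norm tendsto_mult tendsto_const lim)
      show "\<exists>N0. \<forall>m\<ge>N0. (\<Sum>k\<in>faber_idx j. norm (\<Sum>\<sigma>\<in>?V. c \<sigma> * f (p (\<mu> m) ((1 - \<mu> m) / 2) k \<sigma>))) \<le> C
        * M"
        using step4 \<mu> by blast
    qed
  qed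
qed

end

section \<open>Faber series and interpolation\<close>

text \<open>An identity between two finite linear combinations of point evaluations on \<open>real^'d\<close> only
  has to be checked on products of functions of one variable, because indicators of points are
  such products.\<close>

definition point_functional :: "((real^'d \<Rightarrow> complex) \<Rightarrow> complex) \<Rightarrow> bool" where
  "point_functional L \<longleftrightarrow> (\<exists>Q c. finite Q \<and> (\<forall>f. L f = (\<Sum>q\<in>Q. c q * f q)))"

lemma point_functional_eval: "point_functional (\<lambda>f. f p)"
  unfolding point_functional_def by (rule exI[of _ "{p}"], rule exI[of _ "\<lambda>_. 1"]) simp

lemma point_functional_cmult:
  assumes "point_functional L"
  shows "point_functional (\<lambda>f. a * L f)"
proof -
  obtain Q c where "finite Q" "\<And>f. L f = (\<Sum>q\<in>Q. c q * f q)"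
    using assms unfolding point_functional_def by blast
  then show ?thesis unfolding point_functional_def
    by (intro exI[of _ Q] exI[of _ "\<lambda>q. a * c q"]) (simp add: sum_distrib_left mult.assoc)
qed

lemma point_functional_add:
  assumes "point_functional L" "point_functional L'"
  shows "point_functional (\<lambda>f. L f + L' f)"
proof -
  obtain Q c where Q: "finite Q" "\<And>f. L f = (\<Sum>q\<in>Q. c q * f q)"
    using assms(1) unfolding point_functional_def by blast
  obtain Q' c' where Q': "finite Q'" "\<And>f. L' f = (\<Sum>q\<in>Q'. c' q * f q)"
    using assms(2) unfolding point_functional_def by blast
  have "L f + L' f = (\<Sum>q\<in>Q \<union> Q'. ((if q \<in> Q then c q else 0) + (if q \<in> Q' then c' q else 0)) * f q)"
    for f
  proof -
    have "L f = (\<Sum>q\<in>Q \<union> Q'. (if q \<in> Q then c q else 0) * f q)"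
      unfolding Q by (rule sum.mono_neutral_cong_left) (use Q Q' in auto)
    moreover have "L' f = (\<Sum>q\<in>Q \<union> Q'. (if q \<in> Q' then c' q else 0) * f q)"
      unfolding Q' by (rule sum.mono_neutral_cong_left) (use Q Q' in auto)
    ultimately show ?thesis by (simp add: distrib_right sum.distrib)
  qed
  then show ?thesis unfolding point_functional_def using Q(1) Q'(1)
    by (intro exI[of _ "Q \<union> Q'"] exI[of _ "\<lambda>q. (if q \<in> Q then c q else 0)
      + (if q \<in> Q' then c' q else 0)"]) simp
qed

lemma point_functional_zero: "point_functional (\<lambda>f. 0)"
  unfolding point_functional_def by (rule exI[of _ "{}"]) simp

lemma point_functional_sum:
  assumes "\<And>a. a \<in> A \<Longrightarrow> point_functional (L a)"
  shows "point_functional (\<lambda>f. \<Sum>a\<in>A. L a f)"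
  using assms
  by (induction A rule: infinite_finite_induct)
    (auto intro: point_functional_zero point_functional_add)

lemma point_functional_eqI:
  fixes L L' :: "(real^'d \<Rightarrow> complex) \<Rightarrow> complex"
  assumes "point_functional L" "point_functional L'"
    and eq: "\<And>F :: 'd \<Rightarrow> real \<Rightarrow> complex. L (\<lambda>x. \<Prod>i\<in>UNIV. F i (x $ i))
      = L' (\<lambda>x. \<Prod>i\<in>UNIV. F i (x $ i))"
  shows "L f = L' f"
proof -
  obtain Q c where Q: "finite Q" "\<And>f. L f - L' f = (\<Sum>q\<in>Q. c q * f q)"
    using point_functional_add[OF assms(1) point_functional_cmult[OF assms(2), of "-1"]]
    unfolding point_functional_def by auto
  have "c q = 0" if q: "q \<in> Q" for q
  proof -
    have ind: "(\<Prod>i\<in>UNIV. if x $ i = q $ i then 1 else 0) = (if x = q then 1 else (0::complex))"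
      for x :: "real^'d"
      by (auto simp: vec_eq_iff)
    have "0 = L (\<lambda>x. if x = q then 1 else 0) - L' (\<lambda>x. if x = q then 1 else 0)"
      using eq[of "\<lambda>i t. if t = q $ i then 1 else 0"] by (simp only: ind) simp
    also have "\<dots> = (\<Sum>x\<in>Q. if x = q then c q else 0)" unfolding Q by (rule sum.cong) auto
    also have "\<dots> = c q" using q Q(1) by simp
    finally show ?thesis by simp
  qed
  then have "L f - L' f = 0" unfolding Q by simp
  then show ?thesis by simp
qed

section \<open>Faber coefficients as stencils\<close>

lemma fold_diff2_insert:
  fixes h :: "'d::finite \<Rightarrow> real"
  assumes "a \<notin> A"
  shows "Finite_Set.fold (\<lambda>i. diff2 i (h i)) f (insert a A) x =
    Finite_Set.fold (\<lambda>i. diff2 i (h i)) f A (x + (2 * h a) *\<^sub>R axis a 1)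
    - 2 * Finite_Set.fold (\<lambda>i. diff2 i (h i)) f A (x + h a *\<^sub>R axis a 1)
    + Finite_Set.fold (\<lambda>i. diff2 i (h i)) f A x"
proof -
  have "Finite_Set.fold (\<lambda>i. diff2 i (h i)) f (insert a A)
    = diff2 a (h a) (Finite_Set.fold (\<lambda>i. diff2 i (h i)) f A)"
    by (rule comp_fun_commute_on.fold_insert[where S=UNIV])
      (use assms comp_fun_commute_diff2[of h] in \<open>auto simp: comp_fun_commute_def'\<close>)
  then show ?thesis by (simp only:) (rule diff2_def)
qed

lemma point_functional_fold_diff2:
  fixes A :: "'d::finite set"
  shows "point_functional (\<lambda>f. Finite_Set.fold (\<lambda>i. diff2 i (h i)) f A x)"
proof (induction A arbitrary: x rule: infinite_finite_induct)
  case (insert a A)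
  have "point_functional (\<lambda>f. Finite_Set.fold (\<lambda>i. diff2 i (h i)) f A (x + (2 * h a) *\<^sub>R axis a 1)
     + (-2) * Finite_Set.fold (\<lambda>i. diff2 i (h i)) f A (x + h a *\<^sub>R axis a 1)
     + Finite_Set.fold (\<lambda>i. diff2 i (h i)) f A x)"
    by (intro point_functional_add point_functional_cmult insert.IH)
  then show ?case
    by (simp only: fold_diff2_insert[OF insert.hyps(2)] diff_conv_add_uminus mult_minus_left)
qed (simp_all add: point_functional_eval)

lemma fold_diff2_tensor:
  fixes F :: "'d::finite \<Rightarrow> real \<Rightarrow> complex"
  shows "Finite_Set.fold (\<lambda>i. diff2 i (h i)) (\<lambda>x. \<Prod>i\<in>UNIV. F i (x $ i)) A x =
    (\<Prod>i\<in>UNIV. if i \<in> A then F i (x $ i + 2 * h i) - 2 * F i (x $ i + h i)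
      + F i (x $ i) else F i (x $ i))"
proof (induction A arbitrary: x rule: infinite_finite_induct)
  case (insert a A)
  define P where "P x = (\<Prod>i\<in>UNIV - {a}. if i \<in> A then F i (x $ i + 2 * h i) - 2 * F i (x $ i + h i)
    + F i (x $ i) else F i (x $ i))" for x :: "real^'d"
  have sp: "(\<Prod>i\<in>UNIV. if i \<in> A then F i (x $ i + 2 * h i) - 2 * F i (x $ i + h i)
    + F i (x $ i) else F i (x $ i)) = F a (x $ a) * P x" for x :: "real^'d"
    using insert.hyps by (subst prod.remove[of _ a]) (auto simp: P_def)
  have Pt: "P (x + t *\<^sub>R axis a 1) = P x" for t
    unfolding P_def by (intro prod.cong refl) (auto simp: axis_def)
  have xa: "(x + t *\<^sub>R axis a 1) $ a = x $ a + t" for t by (simp add: axis_def)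
  have R: "(\<Prod>i\<in>UNIV. if i \<in> insert a A then F i (x $ i + 2 * h i) - 2 * F i (x $ i + h i)
    + F i (x $ i) else F i (x $ i))
     = (F a (x $ a + 2 * h a) - 2 * F a (x $ a + h a) + F a (x $ a)) * P x"
    by (subst prod.remove[of _ a]) (auto simp: P_def intro!: prod.cong)
  show ?case
    unfolding R fold_diff2_insert[OF insert.hyps(2)] insert.IH sp Pt xa by (simp add: algebra_simps)
qed simp_all

definition stencil_value :: "int \<Rightarrow> nat \<Rightarrow> (real \<Rightarrow> complex) \<Rightarrow> complex" where
  "stencil_value j k F = (\<Sum>s\<in>{..2}. stencil_coeff j s * F (stencil_node j k s))"

text \<open>A difference in one direction acts on the factor of that coordinate alone, and the power
  of -2 is shared out as -1/2 per active coordinate. An inactive coordinate contributes the plain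
  value at the node, as the stencil of level -1 does.\<close>

lemma faber_coeff_tensor:
  fixes j :: "int^'d"
  assumes j: "\<And>i. -1 \<le> j $ i"
  shows "faber_coeff j k (\<lambda>x. \<Prod>i\<in>UNIV. F i (x $ i))
    = (\<Prod>i\<in>UNIV. stencil_value (j $ i) (k $ i) (F i))"
proof -
  have "(-2 :: complex) powi (- int (card (active j))) = (\<Prod>i\<in>active j. -1/2)"
  proof -
    have "inverse (-2) = (-1/2 :: complex)" by simp
    then show ?thesis by (simp only: power_int_minus power_int_of_nat power_inverse[symmetric]
      prod_constant)
  qed
  also have "\<dots> = (\<Prod>i\<in>UNIV. if i \<in> active j then -1/2 else 1)"
    by (simp add: prod.If_cases)
  finally have "faber_coeff j k (\<lambda>x. \<Prod>i\<in>UNIV. F i (x $ i))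
    = (\<Prod>i\<in>UNIV. (if i \<in> active j then -1/2 else 1) *
     (if i \<in> active j then F i (faber_node j k $ i + 2 * 2 powi (- (j $ i + 1))) - 2
       * F i (faber_node j k $ i + 2 powi (- (j $ i + 1))) + F i (faber_node j k $ i) else F i
       (faber_node j k $ i)))"
    unfolding faber_coeff_def fold_diff2_tensor[of "\<lambda>i. 2 powi (- (j $ i + 1))" F]
      by (simp only: prod.distrib)
  also have "\<dots> = (\<Prod>i\<in>UNIV. stencil_value (j $ i) (k $ i) (F i))"
  proof (intro prod.cong refl)
    fix i
    have s3: "{..2::nat} = {0, 1, 2}" by auto
    show "(if i \<in> active j then -1/2 else 1) *
     (if i \<in> active j then F i (faber_node j k $ i + 2 * 2 powi (- (j $ i + 1))) - 2
       * F i (faber_node j k $ i + 2 powi (- (j $ i + 1))) + F i (faber_node j k $ i) else F i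
       (faber_node j k $ i)) = stencil_value (j $ i) (k $ i) (F i)"
    proof (cases "j $ i = -1")
      case True
      then show ?thesis by (simp add: active_def faber_node_def stencil_value_def s3
        stencil_coeff_def stencil_node_def)
    next
      case False
      then have "max (j $ i) 0 = j $ i" using j[of i] by simp
      then show ?thesis using False
        by (simp add: active_def faber_node_def stencil_value_def s3 stencil_coeff_def
          stencil_node_def) (simp add: field_simps)
    qed
  qed
  finally show ?thesis .
qed

lemma point_functional_faber_coeff: "point_functional (faber_coeff j k)"
  unfolding faber_coeff_def[abs_def]
  by (intro point_functional_cmult point_functional_fold_diff2[of "\<lambda>i. 2 powi (- (j $ i + 1))"])

text \<open>Brings the coefficient into the form estimated by \<open>faber_stencil_bound\<close>.
  Both sides are finite combinations of point values, so tensor products decide.\<close>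

lemma faber_coeff_stencil:
  fixes j :: "int^'d"
  assumes j: "\<And>i. -1 \<le> j $ i"
  shows "faber_coeff j k f = (\<Sum>\<sigma>\<in>nat_box 2. stencil_prod j \<sigma>
    * f (\<chi> i. stencil_node (j $ i) (k $ i) (\<sigma> $ i)))"
proof (rule point_functional_eqI[of "faber_coeff j k"])
  show "point_functional (faber_coeff j k)" by (rule point_functional_faber_coeff)
  show "point_functional (\<lambda>f. \<Sum>\<sigma>\<in>nat_box 2. stencil_prod j \<sigma>
    * f (\<chi> i. stencil_node (j $ i) (k $ i) (\<sigma> $ i)))"
    by (intro point_functional_sum point_functional_cmult point_functional_eval)
  show "faber_coeff j k (\<lambda>x. \<Prod>i\<in>UNIV. F i (x $ i)) = (\<Sum>\<sigma>\<in>nat_box 2. stencil_prod j \<sigma>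
    * (\<Prod>i\<in>UNIV. F i ((\<chi> i. stencil_node (j $ i) (k $ i) (\<sigma> $ i)) $ i)))" for F
    unfolding faber_coeff_tensor[OF j] stencil_value_def
      by (subst prod_sum_vec) (simp_all add: prod.distrib)
qed

section \<open>Hierarchical sums as piecewise linear interpolation\<close>

definition tent :: "real \<Rightarrow> real" where
  "tent y = max 0 (1 - \<bar>y\<bar>)"

lemma tent_nonneg: "0 \<le> tent y" by (simp add: tent_def)

lemma hat_eq_tent: "hat y = tent (2 * y - 1)"
  by (auto simp: hat_def tent_def max_def abs_if)

text \<open>The two-scale relation of the piecewise linear nodal function; it drives the induction
  in \<open>interpolation_1d\<close>.\<close>

lemma tent_refine: "tent y = tent (2 * y) + (tent (2 * y - 1) + tent (2 * y + 1)) / 2"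
  by (auto simp: tent_def max_def abs_if)

lemma sum_even_odd: "(\<Sum>t\<le>2 * K. G t) = (\<Sum>m\<le>K. G (2 * m)) + (\<Sum>m<K. G (2 * m + 1 :: nat))"
  for G :: "nat \<Rightarrow> 'a::comm_monoid_add"
  by (induction K) (simp_all add: algebra_simps)

text \<open>When the grid is refined, the old interpolant takes at a new midpoint the mean of the
  two neighbouring values, and the stencil of level N is exactly the difference between F and this
  mean. So the hierarchical sum is the piecewise linear interpolant on the grid of mesh
  2^-N.\<close>

lemma interpolation_1d:
  fixes F :: "real \<Rightarrow> complex"
  assumes x: "0 \<le> x" "x \<le> 1"
  shows "(\<Sum>j\<in>{-1..int N - 1}. \<Sum>k\<in>faber_idx1 j. stencil_value j k F * of_real (faber1 j k x)) =
    (\<Sum>t\<le>2 ^ N. of_real (tent (2 ^ N * x - real t)) * F (real t / 2 ^ N))"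
proof (induction N)
  case 0
  have s3: "{..2::nat} = {0, 1, 2}" by auto
  have "{..Suc 0} = {0, 1}" by auto
  moreover have "tent (x - 1) = x" "tent x = 1 - x" using x by (auto simp: tent_def)
  ultimately show ?case
    by (simp add: faber_idx1_def stencil_value_def stencil_coeff_def stencil_node_def faber1_def s3
      mult.commute)
next
  case (Suc N)
  define K :: nat where "K = 2 ^ N"
  define y where "y = 2 ^ N * x"
  define F' where "F' t = F (real t / 2 ^ Suc N)" for t
  define T where "T z = complex_of_real (tent z)" for z
  have y: "0 \<le> y" "y \<le> real K" using x by (auto simp: y_def K_def mult_left_le)
  have "{-1..int (Suc N) - 1} = insert (int N) {-1..int N - 1}" by auto
  then have "(\<Sum>j\<in>{-1..int (Suc N) - 1}. \<Sum>k\<in>faber_idx1 j. stencil_value j k F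
    * of_real (faber1 j k x)) =
     (\<Sum>k\<in>faber_idx1 (int N). stencil_value (int N) k F * of_real (faber1 (int N) k x))
       + (\<Sum>t\<le>2 ^ N. of_real (tent (2 ^ N * x - real t)) * F (real t / 2 ^ N))"
    by (simp add: Suc.IH)
  also have "(\<Sum>k\<in>faber_idx1 (int N). stencil_value (int N) k F * of_real (faber1 (int N) k x)) =
     (\<Sum>m<K. (F' (2 * m + 1) - (F' (2 * m) + F' (2 * m + 2)) / 2) * T (2 * y - real (2 * m + 1)))"
  proof (rule sum.cong)
    show "faber_idx1 (int N) = {..<K}" by (auto simp: faber_idx1_def K_def)
    fix m
    have s3: "{..2::nat} = {0, 1, 2}" by auto
    have p: "2 powi (- (int N + 1)) = (1 / (2 * 2 ^ N) :: real)" "2 powi (- int N)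
      = (1 / 2 ^ N :: real)"
      by (simp_all add: power_int_minus power_int_diff divide_simps)
    have "stencil_node (int N) m s = real (2 * m + s) / 2 ^ Suc N" for s
      unfolding stencil_node_def p by (simp add: field_simps)
    then have "stencil_value (int N) m F = F' (2 * m + 1) - (F' (2 * m) + F' (2 * m + 2)) / 2"
      by (simp add: stencil_value_def s3 stencil_coeff_def F'_def del: One_nat_def)
        (simp add: field_simps)
    moreover have "faber1 (int N) m x = tent (2 * y - real (2 * m + 1))"
      by (simp add: faber1_def hat_eq_tent y_def algebra_simps)
    ultimately show "stencil_value (int N) m F * of_real (faber1 (int N) m x)
      = (F' (2 * m + 1) - (F' (2 * m) + F' (2 * m + 2)) / 2) * T (2 * y - real (2 * m + 1))"
      by (simp add: T_def)
  qed
  also have "(\<Sum>t\<le>2 ^ N. of_real (tent (2 ^ N * x - real t)) * F (real t / 2 ^ N)) =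
     (\<Sum>m\<le>K. T (2 * y - real (2 * m)) * F' (2 * m)) + (\<Sum>m<K. T (2 * y - real (2 * m + 1))
       * ((F' (2 * m) + F' (2 * m + 2)) / 2))"
  proof -
    have "(\<Sum>t\<le>2 ^ N. of_real (tent (2 ^ N * x - real t)) * F (real t / 2 ^ N)) =
       (\<Sum>m\<le>K. T (2 * y - real (2 * m)) * F' (2 * m) + T (2 * y - real (2 * m + 1)) * F' (2 * m) / 2
         + T (2 * y - real (2 * m) + 1) * F' (2 * m) / 2)"
    proof (rule sum.cong)
      fix m
      have e: "tent (y - real m) = tent (2 * y - real (2 * m)) + (tent (2 * y - real (2 * m + 1))
        + tent (2 * y - real (2 * m) + 1)) / 2"
        using tent_refine[of "y - real m"] by (simp add: algebra_simps)
      have F2: "F (real m / 2 ^ N) = F' (2 * m)" by (simp add: F'_def)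
      show "of_real (tent (2 ^ N * x - real m)) * F (real m / 2 ^ N) = T (2 * y - real (2 * m))
        * F' (2 * m) + T (2 * y - real (2 * m + 1)) * F' (2 * m) / 2 + T (2 * y - real (2 * m) + 1)
        * F' (2 * m) / 2"
        unfolding y_def[symmetric] e F2 T_def by (simp add: distrib_right add_divide_distrib)
    qed (simp add: K_def)
    also have "\<dots> = (\<Sum>m\<le>K. T (2 * y - real (2 * m)) * F' (2 * m))
      + (\<Sum>m\<le>K. T (2 * y - real (2 * m + 1)) * F' (2 * m) / 2) + (\<Sum>m\<le>K. T (2 * y - real (2 * m) + 1)
      * F' (2 * m) / 2)"
      by (simp add: sum.distrib)
    \<comment> \<open>The term m = K is 0 because y \<le> K. In the next step the term m = 0 is 0
      because y \<ge> 0, which allows the index shift.\<close>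
    also have "(\<Sum>m\<le>K. T (2 * y - real (2 * m + 1)) * F' (2 * m) / 2)
      = (\<Sum>m<K. T (2 * y - real (2 * m + 1)) * F' (2 * m) / 2)"
      using y by (subst lessThan_Suc_atMost[symmetric], subst sum.lessThan_Suc)
        (simp add: T_def tent_def)
    also have "(\<Sum>m\<le>K. T (2 * y - real (2 * m) + 1) * F' (2 * m) / 2)
      = (\<Sum>m<K. T (2 * y - real (2 * m + 1)) * F' (2 * m + 2) / 2)"
      using y by (subst lessThan_Suc_atMost[symmetric], subst sum.lessThan_Suc_shift)
        (simp add: T_def tent_def algebra_simps)
    finally show ?thesis by (simp add: sum.distrib[symmetric] algebra_simps add_divide_distrib)
  qed
  also have "(\<Sum>m<K. (F' (2 * m + 1) - (F' (2 * m) + F' (2 * m + 2)) / 2)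
    * T (2 * y - real (2 * m + 1))) +
     ((\<Sum>m\<le>K. T (2 * y - real (2 * m)) * F' (2 * m)) + (\<Sum>m<K. T (2 * y - real (2 * m + 1))
       * ((F' (2 * m) + F' (2 * m + 2)) / 2)))
     = (\<Sum>m\<le>K. T (2 * y - real (2 * m)) * F' (2 * m)) + (\<Sum>m<K. T (2 * y - real (2 * m + 1))
       * F' (2 * m + 1))"
    by (simp add: sum.distrib[symmetric] algebra_simps)
  also have "\<dots> = (\<Sum>t\<le>2 * K. T (2 * y - real t) * F' t)"
    by (rule sum_even_odd[symmetric])
  finally show ?case by (simp add: K_def T_def F'_def y_def mult.assoc)
qed

text \<open>This is the interpolation of the constant 1: stencils of levels j \<ge> 0 annihilate
  constants, and level -1 gives (1 - x) + x.\<close>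

lemma tent_partition_of_unity:
  assumes x: "0 \<le> x" "x \<le> 1"
  shows "(\<Sum>t\<le>2 ^ N. tent (2 ^ N * x - real t)) = 1"
proof -
  have s3: "{..2::nat} = {0, 1, 2}" by auto
  have d: "stencil_value j k (\<lambda>_. 1) = (if j = -1 then 1 else 0)"
    for j k by (simp add: stencil_value_def s3 stencil_coeff_def)
  have "(\<Sum>t\<le>2 ^ N. complex_of_real (tent (2 ^ N * x - real t))) =
     (\<Sum>j\<in>{-1..int N - 1}. \<Sum>k\<in>faber_idx1 j. stencil_value j k (\<lambda>_. 1) * of_real (faber1 j k x))"
    using interpolation_1d[OF x, where N=N and F="\<lambda>_. 1"] by simp
  also have "\<dots> = (\<Sum>j\<in>{-1..int N - 1}. if j = -1 then 1 else 0)"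
    by (intro sum.cong refl) (auto simp: d faber_idx1_def faber1_def)
  also have "\<dots> = 1" by simp
  finally show ?thesis by (metis of_real_1 of_real_eq_iff of_real_sum)
qed

lemma interpolation:
  fixes f :: "real^'d \<Rightarrow> complex"
  assumes x: "x \<in> unit_cube"
  shows "(\<Sum>j\<in>level_box N. \<Sum>k\<in>faber_idx j. faber_coeff j k f * of_real (faber j k x)) =
    (\<Sum>t\<in>nat_box (2 ^ N). (\<Prod>i\<in>UNIV. of_real (tent (2 ^ N * x $ i - real (t $ i))))
      * f (\<chi> i. real (t $ i) / 2 ^ N))"
proof (rule point_functional_eqI[of "\<lambda>f. \<Sum>j\<in>level_box N. \<Sum>k\<in>faber_idx j. faber_coeff j k f
  * of_real (faber j k x)"])
  show "point_functional (\<lambda>f. \<Sum>j\<in>level_box N. \<Sum>k\<in>faber_idx j. faber_coeff j k f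
    * of_real (faber j k x))"
    unfolding mult.commute[of _ "of_real _"]
    by (intro point_functional_sum point_functional_cmult point_functional_faber_coeff)
  show "point_functional (\<lambda>f. \<Sum>t\<in>nat_box (2 ^ N).
    (\<Prod>i\<in>UNIV. of_real (tent (2 ^ N * x $ i - real (t $ i)))) * f (\<chi> i. real (t $ i) / 2 ^ N))"
    by (intro point_functional_sum point_functional_cmult point_functional_eval)
  fix F :: "'d \<Rightarrow> real \<Rightarrow> complex"
  have xi: "0 \<le> x $ i" "x $ i \<le> 1" for i using x by (auto simp: mem_box_cart)
  have fin: "finite (faber_idx1 a)" for a by (simp add: faber_idx1_def)
  have "(\<Sum>j\<in>level_box N. \<Sum>k\<in>faber_idx j. faber_coeff j k (\<lambda>x. \<Prod>i\<in>UNIV. F i (x $ i))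
    * of_real (faber j k x))
     = (\<Sum>j\<in>level_box N. \<Sum>k\<in>faber_idx j. \<Prod>i\<in>UNIV. stencil_value (j $ i) (k $ i) (F i)
       * of_real (faber1 (j $ i) (k $ i) (x $ i)))"
    by (intro sum.cong refl) (auto simp: faber_coeff_tensor faber_def prod.distrib)
  also have "\<dots> = (\<Sum>j\<in>level_box N. \<Prod>i\<in>UNIV. \<Sum>k\<in>faber_idx1 (j $ i). stencil_value (j $ i) k (F i)
    * of_real (faber1 (j $ i) k (x $ i)))"
    unfolding faber_idx_def by (intro sum.cong refl) (simp add: prod_sum_vec fin)
  also have "\<dots> = (\<Prod>i\<in>UNIV. \<Sum>j\<in>{-1..int N - 1}. \<Sum>k\<in>faber_idx1 j. stencil_value j k (F i)
    * of_real (faber1 j k (x $ i)))"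
    by (subst prod_sum_vec) auto
  also have "\<dots> = (\<Prod>i\<in>UNIV. \<Sum>t\<le>2 ^ N. of_real (tent (2 ^ N * x $ i - real t))
    * F i (real t / 2 ^ N))"
    by (simp only: interpolation_1d[OF xi])
  also have "\<dots> = (\<Sum>t\<in>nat_box (2 ^ N). (\<Prod>i\<in>UNIV. of_real (tent (2 ^ N * x $ i - real (t $ i))))
    * (\<Prod>i\<in>UNIV. F i ((\<chi> i. real (t $ i) / 2 ^ N) $ i)))"
    by (subst prod_sum_vec) (simp_all add: prod.distrib)
  finally show "(\<Sum>j\<in>level_box N. \<Sum>k\<in>faber_idx j. faber_coeff j k (\<lambda>x. \<Prod>i\<in>UNIV. F i (x $ i))
    * of_real (faber j k x)) =
    (\<Sum>t\<in>nat_box (2 ^ N). (\<Prod>i\<in>UNIV. of_real (tent (2 ^ N * x $ i - real (t $ i))))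
      * (\<Prod>i\<in>UNIV. F i ((\<chi> i. real (t $ i) / 2 ^ N) $ i)))" .
qed

text \<open>The weights are nonnegative, add up to 1 and charge only grid points within 2^-N of x in
  every coordinate, so the sum is an average of values of f near x.\<close>

lemma interpolation_tendsto:
  fixes f :: "real^'d \<Rightarrow> complex"
  assumes f: "continuous_on unit_cube f" and x: "x \<in> unit_cube"
  shows "(\<lambda>N. \<Sum>t\<in>nat_box (2 ^ N). (\<Prod>i\<in>UNIV. of_real (tent (2 ^ N * x $ i - real (t $ i))))
    * f (\<chi> i. real (t $ i) / 2 ^ N)) \<longlonglongrightarrow> f x"
proof (rule LIMSEQ_I)
  fix e :: real assume e: "e > 0"
  then have e2: "e / 2 > 0" by simp
  have "\<exists>d>0. \<forall>y\<in>unit_cube. dist y x < d \<longrightarrow> dist (f y) (f x) < e / 2"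
    using f x e2 unfolding continuous_on_iff by blast
  then obtain d where d: "d > 0" "\<And>y. y \<in> unit_cube \<Longrightarrow> dist y x < d \<Longrightarrow> dist (f y) (f x) < e / 2"
    by blast
  have xi: "0 \<le> x $ i" "x $ i \<le> 1" for i using x by (auto simp: mem_box_cart)
  obtain M where M: "real CARD('d) / d < 2 ^ M" using real_arch_pow[of 2] by force
  show "\<exists>N0. \<forall>N\<ge>N0. norm ((\<Sum>t\<in>nat_box (2 ^ N). (\<Prod>i\<in>UNIV.
    of_real (tent (2 ^ N * x $ i - real (t $ i)))) * f (\<chi> i. real (t $ i) / 2 ^ N)) - f x) < e"
  proof (intro exI[of _ M] allI impI)
    fix N assume N: "N \<ge> M"
    let ?T = "nat_box (2 ^ N) :: (nat^'d) set"
    define w where "w t = (\<Prod>i\<in>UNIV. tent (2 ^ N * x $ i - real (t $ i)))" for t :: "nat^'d"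
    define p where "p t = (\<chi> i. real (t $ i) / 2 ^ N)" for t :: "nat^'d"
    have w0: "w t \<ge> 0" for t unfolding w_def by (intro prod_nonneg tent_nonneg)
    have w1: "(\<Sum>t\<in>?T. w t) = 1"
    proof -
      have "(\<Prod>i\<in>(UNIV::'d set). \<Sum>t\<le>2 ^ N. tent (2 ^ N * x $ i - real t)) = (\<Sum>t\<in>?T. w t)"
        unfolding w_def by (rule prod_sum_vec) simp
      then show ?thesis by (simp add: tent_partition_of_unity xi)
    qed
    have near: "norm (f (p t) - f x) \<le> e / 2" if t: "t \<in> ?T" and nz: "w t \<noteq> 0" for t
    proof -
      have ti: "\<bar>p t $ i - x $ i\<bar> \<le> 1 / 2 ^ N" for i
      proof -
        have "tent (2 ^ N * x $ i - real (t $ i)) \<noteq> 0" using nz by (auto simp: w_def)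
        then have "\<bar>2 ^ N * x $ i - real (t $ i)\<bar> \<le> 1"
          by (auto simp: tent_def max_def split: if_splits)
        moreover have "\<bar>2 ^ N * x $ i - real (t $ i)\<bar> = 2 ^ N * \<bar>p t $ i - x $ i\<bar>"
        proof -
          have "2 ^ N * x $ i - real (t $ i) = - (2 ^ N * (p t $ i - x $ i))"
            by (simp add: p_def field_simps)
          then show ?thesis by (simp add: abs_mult)
        qed
        ultimately show ?thesis by (simp add: field_simps)
      qed
      have "dist (p t) x \<le> (\<Sum>i\<in>UNIV. \<bar>(p t - x) $ i\<bar>)" unfolding dist_norm by (rule norm_le_l1_cart)
      also have "\<dots> \<le> (\<Sum>i\<in>(UNIV::'d set). 1 / 2 ^ N)" using ti by (intro sum_mono) simp
      also have "\<dots> = real CARD('d) / 2 ^ N" by simp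
      also have "\<dots> \<le> real CARD('d) / 2 ^ M" using N
        by (intro divide_left_mono power_increasing) auto
      also have "\<dots> < d" using M d(1) by (simp add: field_simps)
      finally have "dist (p t) x < d" .
      moreover have "p t \<in> unit_cube"
      proof -
        have "real (t $ i) \<le> 2 ^ N" for i
          using t of_nat_mono[of "t $ i" "2 ^ N", where 'a=real] by simp
        then show ?thesis by (simp add: p_def mem_box_cart)
      qed
      ultimately show ?thesis using d(2)[of "p t"] by (simp add: dist_norm)
    qed
    have "(\<Sum>t\<in>?T. of_real (w t) * f (p t)) - f x = (\<Sum>t\<in>?T. of_real (w t) * (f (p t) - f x))"
    proof -
      have "(\<Sum>t\<in>?T. of_real (w t) * f x) = of_real (\<Sum>t\<in>?T. w t) * f x"
        by (simp add: sum_distrib_right)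
      then show ?thesis unfolding w1 by (simp add: right_diff_distrib sum_subtractf)
    qed
    then have "norm ((\<Sum>t\<in>?T. of_real (w t) * f (p t)) - f x) \<le> (\<Sum>t\<in>?T. w t * (e / 2))"
    proof (simp only:, intro sum_norm_le)
      fix t assume t: "t \<in> ?T"
      show "norm (of_real (w t) * (f (p t) - f x)) \<le> w t * (e / 2)"
        using near[OF t] w0[of t] by (cases "w t = 0") (auto simp: norm_mult intro!: mult_left_mono)
    qed
    also have "\<dots> = e / 2" by (simp only: sum_distrib_right[symmetric] w1 mult_1)
    also have "\<dots> < e" using e by simp
    finally show "norm ((\<Sum>t\<in>?T. (\<Prod>i\<in>UNIV. of_real (tent (2 ^ N * x $ i - real (t $ i))))
      * f (\<chi> i. real (t $ i) / 2 ^ N)) - f x) < e"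
      by (simp add: w_def p_def)
  qed
qed

section \<open>Sums over dyadic boxes\<close>

abbreviation vsum :: "nat^'d \<Rightarrow> nat" where
  "vsum m \<equiv> \<Sum>i\<in>UNIV. m $ i"

abbreviation high_box :: "nat \<Rightarrow> nat \<Rightarrow> (nat^'d) set" where
  "high_box n L \<equiv> {m. (\<forall>i. m $ i \<in> {..L}) \<and> n < vsum m}"

lemma card_vec_set:
  fixes X :: "'d::finite \<Rightarrow> 'a set"
  assumes "\<And>i. finite (X i)"
  shows "card {k :: 'a^'d. \<forall>i. k $ i \<in> X i} = (\<Prod>i\<in>UNIV. card (X i))"
  using prod_sum_vec[of X "\<lambda>_ _. 1::nat"] assms by simp

section \<open>Dyadic cells and their intersections\<close>

definition cell1 :: "int \<Rightarrow> nat \<Rightarrow> real \<Rightarrow> real" where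
  "cell1 j k t = (if j = -1 then indicator {0..1} t
     else indicator {real k / 2 ^ nat j..(real k + 1) / 2 ^ nat j} t)"

definition cell :: "int^'d \<Rightarrow> nat^'d \<Rightarrow> real^'d \<Rightarrow> real" where
  "cell j k x = (\<Prod>i\<in>UNIV. cell1 (j $ i) (k $ i) (x $ i))"

lemma cell1_measurable [measurable]: "cell1 j k \<in> borel_measurable borel"
  unfolding cell1_def[abs_def] by measurable

lemma cell1_bounds: "0 \<le> cell1 j k t" "cell1 j k t \<le> 1"
  by (auto simp: cell1_def indicator_def)

lemma cell_nonneg: "0 \<le> cell j k x"
  unfolding cell_def by (intro prod_nonneg cell1_bounds)

lemma cell_measurable [measurable]: "cell j k \<in> borel_measurable borel"
  unfolding cell_def[abs_def] by measurable

lemma faber1_le_cell1: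
  assumes "0 \<le> t" "t \<le> 1"
  shows "\<bar>faber1 j k t\<bar> \<le> cell1 j k t"
proof (cases "j = -1")
  case True
  then show ?thesis using assms by (auto simp: faber1_def cell1_def)
next
  case False
  have h: "\<bar>hat y\<bar> \<le> 1" "hat y \<noteq> 0 \<Longrightarrow> 0 \<le> y \<and> y \<le> 1" for y by (auto simp: hat_def split: if_splits)
  show ?thesis
  proof (cases "hat (2 ^ nat j * t - real k) = 0")
    case True
    then show ?thesis using False cell1_bounds(1)[of j k t] by (simp add: faber1_def)
  next
    case nz: False
    from h(2)[OF this] have "t \<in> {real k / 2 ^ nat j..(real k + 1) / 2 ^ nat j}"
      by (auto simp: field_simps)
    then show ?thesis using False h(1) by (simp add: faber1_def cell1_def)
  qed
qed

lemma faber_le_cell: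
  assumes "x \<in> unit_cube"
  shows "\<bar>faber j k x\<bar> \<le> cell j k x"
  unfolding faber_def cell_def abs_prod
  using assms by (intro prod_mono conjI faber1_le_cell1) (auto simp: mem_box_cart)

text \<open>The factor 2 pays for the convention that level -1 has absolute value 1: its cell has
  length 1, which is twice 1/2.\<close>

lemma nn_integral_cell1: "-1 \<le> j \<Longrightarrow> (\<integral>\<^sup>+t. ennreal (cell1 j k t) \<partial>lborel)
  \<le> ennreal (2 * (1/2) ^ nat \<bar>j\<bar>)"
proof (cases "j = -1")
  case True
  then show ?thesis by (simp add: cell1_def ennreal_indicator)
next
  case False
  assume "-1 \<le> j"
  then obtain i where i: "j = int i" using False by (intro that[of "nat j"]) auto
  have "(\<integral>\<^sup>+t. ennreal (cell1 j k t) \<partial>lborel) = emeasure lborel {real k / 2 ^ i..(real k + 1) / 2 ^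
    i}"
    using i by (simp add: cell1_def ennreal_indicator)
  also have "\<dots> = ennreal ((real k + 1) / 2 ^ i - real k / 2 ^ i)"
    by (rule emeasure_lborel_Icc) (simp add: divide_right_mono)
  also have "\<dots> \<le> ennreal (2 * (1/2) ^ nat \<bar>j\<bar>)"
    using i by (intro ennreal_leI) (simp add: diff_divide_distrib[symmetric]
      power_one_over field_simps)
  finally show ?thesis .
qed

text \<open>The product of \<open>b\<close> cells is contained in a box whose side in direction \<open>i\<close> is the
  smallest of the \<open>b\<close> sides.\<close>

lemma nn_integral_prod_cells:
  fixes J :: "nat \<Rightarrow> int^'d"
  assumes J: "\<And>r i. r < b \<Longrightarrow> -1 \<le> J r $ i" and b: "b \<noteq> 0"
  shows "(\<integral>\<^sup>+x. ennreal (\<Prod>r<b. cell (J r) (K r) x) \<partial>lborel)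
     \<le> ennreal (\<Prod>i\<in>UNIV. 2 * (1/2) ^ Max ((\<lambda>r. nat \<bar>J r $ i\<bar>) ` {..<b}))"
proof -
  have "(\<integral>\<^sup>+x. ennreal (\<Prod>r<b. cell (J r) (K r) x) \<partial>lborel)
      = (\<integral>\<^sup>+x. (\<Prod>i\<in>UNIV. ennreal (\<Prod>r<b. cell1 (J r $ i) (K r $ i) (x $ i))) \<partial>lborel)"
  proof (rule nn_integral_cong)
    fix x :: "real^'d"
    have "(\<Prod>r<b. cell (J r) (K r) x) = (\<Prod>i\<in>UNIV. \<Prod>r<b. cell1 (J r $ i) (K r $ i) (x $ i))"
      unfolding cell_def by (rule prod.swap)
    then show "ennreal (\<Prod>r<b. cell (J r) (K r) x)
      = (\<Prod>i\<in>UNIV. ennreal (\<Prod>r<b. cell1 (J r $ i) (K r $ i) (x $ i)))"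
      by (simp add: prod_ennreal prod_nonneg cell1_bounds)
  qed
  also have "\<dots> = (\<Prod>i\<in>UNIV. \<integral>\<^sup>+t. ennreal (\<Prod>r<b. cell1 (J r $ i) (K r $ i) t) \<partial>lborel)"
    by (rule nn_integral_tensor) measurable
  also have "\<dots> \<le> (\<Prod>i\<in>UNIV. ennreal (2 * (1/2) ^ Max ((\<lambda>r. nat \<bar>J r $ i\<bar>) ` {..<b})))"
  proof (rule prod_mono_ennreal)
    fix i :: 'd
    have "Max ((\<lambda>r. nat \<bar>J r $ i\<bar>) ` {..<b}) \<in> (\<lambda>r. nat \<bar>J r $ i\<bar>) ` {..<b}"
      using b by (intro Max_in) auto
    then obtain r0 where r0: "r0 < b" "Max ((\<lambda>r. nat \<bar>J r $ i\<bar>) ` {..<b}) = nat \<bar>J r0 $ i\<bar>" by auto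
    have "(\<integral>\<^sup>+t. ennreal (\<Prod>r<b. cell1 (J r $ i) (K r $ i) t) \<partial>lborel)
      \<le> (\<integral>\<^sup>+t. ennreal (cell1 (J r0 $ i) (K r0 $ i) t) \<partial>lborel)"
    proof (intro nn_integral_mono ennreal_leI)
      fix t
      have "(\<Prod>r<b. cell1 (J r $ i) (K r $ i) t) = cell1 (J r0 $ i) (K r0 $ i) t
        * (\<Prod>r\<in>{..<b} - {r0}. cell1 (J r $ i) (K r $ i) t)"
        using r0 by (intro prod.remove) auto
      also have "\<dots> \<le> cell1 (J r0 $ i) (K r0 $ i) t * 1"
        by (intro mult_left_mono prod_le_1 cell1_bounds conjI)
      finally show "(\<Prod>r<b. cell1 (J r $ i) (K r $ i) t) \<le> cell1 (J r0 $ i) (K r0 $ i) t" by simp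
    qed
    also have "\<dots> \<le> ennreal (2 * (1/2) ^ nat \<bar>J r0 $ i\<bar>)" by (rule nn_integral_cell1[OF J[OF r0(1)]])
    finally show "(\<integral>\<^sup>+t. ennreal (\<Prod>r<b. cell1 (J r $ i) (K r $ i) t) \<partial>lborel)
      \<le> ennreal (2 * (1/2) ^ Max ((\<lambda>r. nat \<bar>J r $ i\<bar>) ` {..<b}))"
      by (simp only: r0)
  qed
  also have "\<dots> = ennreal (\<Prod>i\<in>UNIV. 2 * (1/2) ^ Max ((\<lambda>r. nat \<bar>J r $ i\<bar>) ` {..<b}))"
    by (rule prod_ennreal) simp
  finally show ?thesis .
qed

text \<open>The levels omitted by the truncation, cut off at L to keep the sums finite. L tends to
  infinity in \<open>faber_trunc_error\<close>.\<close>

definition high_levels :: "nat \<Rightarrow> nat \<Rightarrow> (int^'d) set" where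
  "high_levels n L = {j. (\<forall>i. j $ i \<in> {-1..int L}) \<and> int n < (\<Sum>i\<in>UNIV. \<bar>j $ i\<bar>)}"

lemma finite_high_levels: "finite (high_levels n L :: (int^'d) set)"
  by (rule finite_subset[OF _ finite_vec_components[of "\<lambda>_. {-1..int L}"]])
    (auto simp: high_levels_def)

text \<open>The deficits m_i - |j_i| are nonnegative and add up to less than |m| - n, so each takes
  at most |m| - n values; the sign of j_i gives the factor 2. If |m| \<le> n, truncated subtraction
  makes the bound 0, and indeed no such level exists.\<close>

lemma card_high_levels_below:
  fixes m :: "nat^'d"
  shows "card {j \<in> high_levels n L. \<forall>i. nat \<bar>j $ i\<bar> \<le> m $ i} \<le> (2 * (vsum m - n)) ^ CARD('d)"
proof -
  define r where "r = vsum m - n"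
  define X where "X i = (\<lambda>t. int (m $ i) - int t) ` {..<r} \<union> (\<lambda>t. - (int (m $ i) - int t)) ` {..<r}"
    for i
  have cX: "card (X i) \<le> 2 * r" for i
  proof -
    have "card (X i) \<le> card ((\<lambda>t. int (m $ i) - int t) ` {..<r})
      + card ((\<lambda>t. - (int (m $ i) - int t)) ` {..<r})"
      unfolding X_def by (rule card_Un_le)
    also have "\<dots> \<le> card {..<r} + card {..<r}" by (intro add_mono card_image_le) auto
    finally show ?thesis by simp
  qed
  have "{j \<in> high_levels n L. \<forall>i. nat \<bar>j $ i\<bar> \<le> m $ i} \<subseteq> {j :: int^'d. \<forall>i. j $ i \<in> X i}"
  proof (intro subsetI CollectI allI)
    fix j :: "int^'d" and i
    assume j: "j \<in> {j \<in> high_levels n L. \<forall>i. nat \<bar>j $ i\<bar> \<le> m $ i}"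
    have le: "\<bar>j $ i\<bar> \<le> int (m $ i)" for i using j by (auto simp: nat_le_iff)
    have "int (m $ i) - \<bar>j $ i\<bar> \<le> (\<Sum>i\<in>UNIV. int (m $ i) - \<bar>j $ i\<bar>)"
      by (rule member_le_sum) (use le in auto)
    also have "\<dots> = int (vsum m) - (\<Sum>i\<in>UNIV. \<bar>j $ i\<bar>)" by (simp add: sum_subtractf)
    also have "\<dots> < int (vsum m) - int n" using j by (simp add: high_levels_def)
    finally have "nat (int (m $ i) - \<bar>j $ i\<bar>) < r" unfolding r_def using le[of i] by linarith
    moreover have "j $ i = int (m $ i) - int (nat (int (m $ i) - \<bar>j $ i\<bar>)) \<or> j $ i =
      - (int (m $ i) - int (nat (int (m $ i) - \<bar>j $ i\<bar>)))"
      using le[of i] by linarith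
    ultimately show "j $ i \<in> X i" unfolding X_def by blast
  qed
  then have "card {j \<in> high_levels n L. \<forall>i. nat \<bar>j $ i\<bar> \<le> m $ i}
    \<le> card {j :: int^'d. \<forall>i. j $ i \<in> X i}"
    by (rule card_mono[rotated]) (rule finite_vec_components, simp add: X_def)
  also have "\<dots> = (\<Prod>i\<in>UNIV. card (X i))" by (rule card_vec_set) (simp add: X_def)
  also have "\<dots> \<le> (\<Prod>i\<in>(UNIV::'d set). 2 * r)" using cX by (intro prod_mono) auto
  finally show ?thesis by (simp add: r_def)
qed

text \<open>One coordinate is determined by the others, which saves one power of \<mu> + 1: this is
  the origin of the exponent d - 1 in the final estimate.\<close>

lemma card_vec_sum_eq:
  "card {m :: nat^'d. vsum m = \<mu>} \<le> (\<mu> + 1) ^ (CARD('d) - 1)"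
proof -
  obtain i0 :: 'd where True by blast
  define R where "R m = restrict (vec_nth m) (UNIV - {i0})" for m :: "nat^'d"
  let ?S = "{m :: nat^'d. vsum m = \<mu>}"
  have "inj_on R ?S"
  proof (rule inj_onI)
    fix m m' assume m: "m \<in> ?S" and m': "m' \<in> ?S" and e: "R m = R m'"
    have eq: "m $ i = m' $ i" if "i \<noteq> i0" for i using fun_cong[OF e, of i] that by (simp add: R_def)
    have "m $ i0 + (\<Sum>i\<in>UNIV - {i0}. m $ i) = m' $ i0 + (\<Sum>i\<in>UNIV - {i0}. m' $ i)"
      using m m' by (simp add: sum.remove[of UNIV i0, symmetric])
    moreover have "(\<Sum>i\<in>UNIV - {i0}. m $ i) = (\<Sum>i\<in>UNIV - {i0}. m' $ i)"
      using eq by (intro sum.cong) auto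
    ultimately have "m $ i0 = m' $ i0" by simp
    with eq show "m = m'" by (metis vec_eq_iff)
  qed
  moreover have "R ` ?S \<subseteq> PiE (UNIV - {i0}) (\<lambda>_. {..\<mu>})"
  proof
    fix h assume "h \<in> R ` ?S"
    then obtain m where m: "h = R m" "vsum m = \<mu>" by auto
    have "m $ i \<le> \<mu>" for i unfolding m(2)[symmetric] by (rule member_le_sum) auto
    then show "h \<in> PiE (UNIV - {i0}) (\<lambda>_. {..\<mu>})" by (auto simp: m(1) R_def)
  qed
  ultimately have "card ?S \<le> card (PiE (UNIV - {i0}) (\<lambda>_. {..\<mu>}))"
    by (metis card_inj_on_le finite_PiE finite_atMost finite)
  also have "\<dots> = (\<mu> + 1) ^ (CARD('d) - 1)" by (simp add: card_PiE card_Diff_singleton)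
  finally show ?thesis .
qed

lemma summable_geometric_poly: "summable (\<lambda>r. (1/2) ^ r * (2 * real r + 2) ^ e)"
proof -
  have "(\<lambda>r. (1 + 1 / real (Suc r)) ^ e) \<longlonglongrightarrow> (1 + 0) ^ e"
    by (intro tendsto_power tendsto_add tendsto_const LIMSEQ_Suc[OF lim_1_over_n])
  then have "eventually (\<lambda>r. (1 + 1 / real (Suc r)) ^ e < 3 / 2) sequentially"
    by (rule order_tendstoD) simp
  then obtain N where N: "\<And>r. r \<ge> N \<Longrightarrow> (1 + 1 / real (Suc r)) ^ e < 3 / 2"
    unfolding eventually_sequentially by blast
  show ?thesis
  proof (rule summable_ratio_test[where c="3/4" and N=N])
    fix r assume r: "r \<ge> N"
    have "2 * real (Suc r) + 2 = (2 * real r + 2) * (1 + 1 / real (Suc r))"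
      by (simp add: field_simps)
    then have "(1/2) ^ Suc r * (2 * real (Suc r) + 2) ^ e = (1/2) ^ r * (2 * real r + 2) ^ e
      * ((1 + 1 / real (Suc r)) ^ e / 2)"
      by (simp only: power_mult_distrib) simp
    also have "\<dots> \<le> (1/2) ^ r * (2 * real r + 2) ^ e * (3 / 4)"
      using N[OF r] by (intro mult_left_mono) auto
    finally show "norm ((1/2) ^ Suc r * (2 * real (Suc r) + 2) ^ e) \<le> 3/4
      * norm ((1/2) ^ r * (2 * real r + 2) ^ e)"
      by (simp add: mult.commute)
  qed simp
qed

text \<open>On |m| = n + r with r \<ge> 1 there are at most (n + r + 1)^(d-1) points, and n + r + 1
  \<le> n(2r + 2) separates the two variables because n \<ge> 1. What is left is a convergent series
  in r, whatever the power e.\<close>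

lemma weighted_lattice_sum:
  "\<exists>C>0. \<forall>n\<ge>1. \<forall>L. (\<Sum>m::nat^'d\<in>high_box n L.
      (1/2) ^ vsum m * real ((2 * (vsum m - n)) ^ e)) \<le> C * (1/2) ^ n * real n ^ (CARD('d) - 1)"
proof -
  define p where "p = CARD('d) - 1"
  define G where "G r = (1/2) ^ r * (2 * real r + 2) ^ (e + p)" for r
  have G0: "G r \<ge> 0" for r by (simp add: G_def)
  have sG: "summable G" unfolding G_def by (rule summable_geometric_poly)
  have "(\<Sum>m::nat^'d\<in>high_box n L.
      (1/2) ^ vsum m * real ((2 * (vsum m - n)) ^ e)) \<le> (suminf G + 1) * (1/2) ^ n * real n ^ p"
        if n: "n \<ge> 1" for n L
  proof -
    let ?M = "high_box n L :: (nat^'d) set"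
    let ?s = "\<lambda>m::nat^'d. \<Sum>i\<in>UNIV. m $ i"
    have fM: "finite ?M" by (rule finite_subset[OF _ finite_vec_components[of "\<lambda>_. {..L}"]]) auto
    define g where "g \<mu> = (1/2) ^ \<mu> * real ((2 * (\<mu> - n)) ^ e)" for \<mu>
    have "(\<Sum>m\<in>?M. g (?s m)) = (\<Sum>\<mu>\<in>?s ` ?M. \<Sum>m\<in>{m\<in>?M. ?s m = \<mu>}. g (?s m))"
      by (rule sum.image_gen[OF fM])
    also have "\<dots> \<le> (\<Sum>\<mu>\<in>?s ` ?M. (1/2) ^ n * real n ^ p * G (\<mu> - n))"
    proof (rule sum_mono)
      fix \<mu> assume "\<mu> \<in> ?s ` ?M"
      then have \<mu>: "n < \<mu>" by auto
      have "finite {m :: nat^'d. ?s m = \<mu>}"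
      proof (rule finite_subset[OF _ finite_vec_components[of "\<lambda>_. {..\<mu>}"]])
        show "{m :: nat^'d. ?s m = \<mu>} \<subseteq> {k. \<forall>i. k $ i \<in> {..\<mu>}}"
          by (auto intro: member_le_sum[of _ UNIV "($) _"])
      qed simp
      then have "card {m\<in>?M. ?s m = \<mu>} \<le> card {m :: nat^'d. ?s m = \<mu>}" by (intro card_mono) auto
      also have "\<dots> \<le> (\<mu> + 1) ^ p" unfolding p_def by (rule card_vec_sum_eq)
      finally have c: "real (card {m\<in>?M. ?s m = \<mu>}) \<le> (real \<mu> + 1) ^ p"
        using of_nat_mono[of "card {m\<in>?M. ?s m = \<mu>}" "(\<mu> + 1) ^ p", where 'a=real]
          by (simp add: add.commute)
      define r where "r = \<mu> - n"
      have r: "\<mu> = n + r" "r \<ge> 1" using \<mu> by (auto simp: r_def)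
      have "(\<Sum>m\<in>{m\<in>?M. ?s m = \<mu>}. g (?s m)) = real (card {m\<in>?M. ?s m = \<mu>}) * g \<mu>" by simp
      also have "\<dots> \<le> (real \<mu> + 1) ^ p * g \<mu>" using c by (intro mult_right_mono) (auto simp: g_def)
      also have "\<dots> \<le> (real n * (2 * real r + 2)) ^ p * g \<mu>"
      proof (intro mult_right_mono power_mono)
        have "real r + 1 \<le> real n * (real r + 1)" using n by simp
        then have "real r + 1 + real n \<le> real n * (real r + 1) + real n * (real r + 1)"
          using n by (intro add_mono) (auto simp: mult_le_cancel_left1)
        then show "real \<mu> + 1 \<le> real n * (2 * real r + 2)" unfolding r by (simp add: algebra_simps)
      qed (auto simp: g_def)
      also have "\<dots> \<le> (real n * (2 * real r + 2)) ^ p * ((1/2) ^ \<mu> * (2 * real r + 2) ^ e)"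
        unfolding g_def of_nat_power by (intro mult_left_mono power_mono) (auto simp: r)
      also have "\<dots> = (1/2) ^ n * real n ^ p * G (\<mu> - n)"
        by (simp add: r G_def power_add power_mult_distrib)
      finally show "(\<Sum>m\<in>{m\<in>?M. ?s m = \<mu>}. g (?s m)) \<le> (1/2) ^ n * real n ^ p * G (\<mu> - n)" .
    qed
    also have "\<dots> = (1/2) ^ n * real n ^ p * (\<Sum>\<mu>\<in>?s ` ?M. G (\<mu> - n))"
      by (simp only: sum_distrib_left)
    also have "(\<Sum>\<mu>\<in>?s ` ?M. G (\<mu> - n)) = sum G ((\<lambda>\<mu>. \<mu> - n) ` ?s ` ?M)"
      by (subst sum.reindex) (auto simp: inj_on_def)
    also have "(1/2) ^ n * real n ^ p * \<dots> \<le> (1/2) ^ n * real n ^ p * (suminf G + 1)"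
      using fM by (intro mult_left_mono order_trans[OF sum_le_suminf[OF sG]]) (auto simp: G0)
    finally show ?thesis by (simp add: g_def mult_ac)
  qed
  moreover have "suminf G + 1 > 0" using suminf_nonneg[OF sG G0] by simp
  ultimately show ?thesis unfolding p_def by blast
qed

text \<open>Each tuple of boxes is charged to the coordinatewise maximum m of its levels. That
  condition is then relaxed to all levels lying below m: the relaxed condition concerns each entry
  separately, so the sum over tuples becomes a b-th power.\<close>

lemma power_of_cell_sum:
  fixes a :: "int^'d \<Rightarrow> nat^'d \<Rightarrow> real"
  assumes a0: "\<And>j k. 0 \<le> a j k" and a1: "\<And>j. j \<in> high_levels n L \<Longrightarrow> (\<Sum>k\<in>faber_idx j. a j k)
    \<le> 1" and b: "b \<noteq> 0"
    and L: "L \<ge> 1"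
  shows "(\<integral>\<^sup>+x. ennreal ((\<Sum>j\<in>high_levels n L. \<Sum>k\<in>faber_idx j. a j k * cell j k x) ^ b) \<partial>lborel) \<le>
    ennreal (2 ^ CARD('d) * (\<Sum>m::nat^'d\<in>high_box n L.
      (1/2) ^ vsum m * real ((2 * (vsum m - n)) ^ (CARD('d) * b))))"
proof -
  let ?J = "high_levels n L :: (int^'d) set"
  let ?M = "high_box n L :: (nat^'d) set"
  define S where "S = Sigma ?J faber_idx"
  define P where "P = PiE {..<b} (\<lambda>_. S)"
  define A where "A s = a (fst s) (snd s)" for s
  define cl where "cl s = cell (fst s) (snd s)" for s :: "(int^'d) \<times> (nat^'d)"
  define M where "M \<tau> = (\<chi> i. Max ((\<lambda>r. nat \<bar>fst (\<tau> r) $ i\<bar>) ` {..<b}))"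
    for \<tau> :: "nat \<Rightarrow> (int^'d) \<times> (nat^'d)"
  define w where "w m = (1/2 :: real) ^ vsum m" for m :: "nat^'d"
  define below where "below m s = (if \<forall>i. nat \<bar>fst s $ i\<bar> \<le> m $ i then 1 else 0 :: real)"
    for m :: "nat^'d" and s :: "(int^'d) \<times> (nat^'d)"
  have A0: "A s \<ge> 0" for s by (simp add: A_def a0)
  have [measurable]: "cl s \<in> borel_measurable borel" for s unfolding cl_def by measurable
  have finS: "finite S" unfolding S_def by (intro finite_SigmaI finite_high_levels finite_faber_idx)
  have finP: "finite P" unfolding P_def by (intro finite_PiE finS) auto
  have finM: "finite ?M" by (rule finite_subset[OF _ finite_vec_components[of "\<lambda>_. {..L}"]]) auto
  have \<tau>S: "\<tau> r \<in> S" if "\<tau> \<in> P" "r < b" for \<tau> r using that by (auto simp: P_def)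
  have below_M: "below (M \<tau>) (\<tau> r) = 1" if r: "r < b" for \<tau> r
  proof -
    have "nat \<bar>fst (\<tau> r) $ i\<bar> \<le> M \<tau> $ i" for i unfolding M_def using r by (auto intro!: Max_ge)
    then show ?thesis by (simp add: below_def)
  qed
  have MM: "M \<tau> \<in> ?M" if \<tau>: "\<tau> \<in> P" for \<tau>
  proof (intro CollectI conjI allI)
    fix i
    have "nat \<bar>fst (\<tau> r) $ i\<bar> \<le> L" if r: "r < b" for r
    proof -
      have "fst (\<tau> r) $ i \<in> {-1..int L}" using \<tau>S[OF \<tau> r] by (auto simp: S_def high_levels_def)
      \<comment> \<open>The assumption L \<ge> 1 enters here, since level -1 has absolute value
        1.\<close>
      then show ?thesis using L by auto
    qed
    then show "M \<tau> $ i \<in> {..L}" unfolding M_def using b by (auto intro!: Max.boundedI)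
    have r0: "0 < b" using b by simp
    have "int n < (\<Sum>i\<in>UNIV. \<bar>fst (\<tau> 0) $ i\<bar>)" using \<tau>S[OF \<tau> r0]
      by (auto simp: S_def high_levels_def)
    also have "\<dots> \<le> (\<Sum>i\<in>UNIV. int (M \<tau> $ i))"
    proof (rule sum_mono)
      fix i
      have "nat \<bar>fst (\<tau> 0) $ i\<bar> \<le> M \<tau> $ i" unfolding M_def using r0 by (auto intro!: Max_ge)
      then show "\<bar>fst (\<tau> 0) $ i\<bar> \<le> int (M \<tau> $ i)" by (simp add: nat_le_iff)
    qed
    finally show "n < (\<Sum>i\<in>UNIV. M \<tau> $ i)" by (simp flip: of_nat_sum)
  qed
  have expand: "(\<Sum>j\<in>?J. \<Sum>k\<in>faber_idx j. a j k * cell j k x) ^ b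
    = (\<Sum>\<tau>\<in>P. (\<Prod>r<b. A (\<tau> r)) * (\<Prod>r<b. cl (\<tau> r) x))" for x
  proof -
    have "(\<Sum>j\<in>?J. \<Sum>k\<in>faber_idx j. a j k * cell j k x) = (\<Sum>s\<in>S. A s * cl s x)"
      unfolding S_def A_def cl_def
      by (subst sum.Sigma) (auto simp: finite_high_levels finite_faber_idx case_prod_beta)
    then have "(\<Sum>j\<in>?J. \<Sum>k\<in>faber_idx j. a j k * cell j k x) ^ b = (\<Prod>r<b. \<Sum>s\<in>S. A s * cl s x)" by simp
    also have "\<dots> = (\<Sum>\<tau>\<in>P. \<Prod>r<b. A (\<tau> r) * cl (\<tau> r) x)"
      unfolding P_def by (rule prod_sum_PiE) (auto simp: finS)
    finally show ?thesis by (simp only: prod.distrib)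
  qed
  have "(\<integral>\<^sup>+x. ennreal ((\<Sum>j\<in>?J. \<Sum>k\<in>faber_idx j. a j k * cell j k x) ^ b) \<partial>lborel)
      = (\<integral>\<^sup>+x. (\<Sum>\<tau>\<in>P. ennreal (\<Prod>r<b. A (\<tau> r)) * ennreal (\<Prod>r<b. cl (\<tau> r) x)) \<partial>lborel)"
  proof (rule nn_integral_cong)
    fix x :: "real^'d"
    have c0: "(\<Prod>r<b. cl (\<tau> r) x) \<ge> 0" for \<tau> unfolding cl_def by (intro prod_nonneg cell_nonneg)
    have p0: "(\<Prod>r<b. A (\<tau> r)) \<ge> 0" for \<tau> by (intro prod_nonneg A0)
    show "ennreal ((\<Sum>j\<in>?J. \<Sum>k\<in>faber_idx j. a j k * cell j k x) ^ b) = (\<Sum>\<tau>\<in>P. ennreal (\<Prod>r<b. A (\<tau> r))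
      * ennreal (\<Prod>r<b. cl (\<tau> r) x))"
      unfolding expand ennreal_mult[OF p0 c0, symmetric]
      by (rule sum_ennreal[symmetric]) (intro mult_nonneg_nonneg p0 c0)
  qed
  also have "\<dots> = (\<Sum>\<tau>\<in>P. ennreal (\<Prod>r<b. A (\<tau> r)) * (\<integral>\<^sup>+x. ennreal (\<Prod>r<b. cl (\<tau> r) x) \<partial>lborel))"
    by (subst nn_integral_sum) (auto simp: nn_integral_cmult)
  also have "\<dots> \<le> (\<Sum>\<tau>\<in>P. ennreal (\<Prod>r<b. A (\<tau> r)) * ennreal (2 ^ CARD('d) * w (M \<tau>)))"
  proof (intro sum_mono mult_left_mono)
    fix \<tau> assume \<tau>: "\<tau> \<in> P"
    have "(\<integral>\<^sup>+x. ennreal (\<Prod>r<b. cl (\<tau> r) x) \<partial>lborel)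
      \<le> ennreal (\<Prod>i\<in>UNIV. 2 * (1/2) ^ Max ((\<lambda>r. nat \<bar>fst (\<tau> r) $ i\<bar>) ` {..<b}))"
      unfolding cl_def
      by (rule nn_integral_prod_cells[OF _ b]) (use \<tau>S[OF \<tau>] in \<open>force simp: S_def high_levels_def\<close>)
    also have "(\<Prod>i\<in>UNIV. 2 * (1/2) ^ Max ((\<lambda>r. nat \<bar>fst (\<tau> r) $ i\<bar>) ` {..<b})) = 2 ^ CARD('d)
      * w (M \<tau>)"
      unfolding w_def M_def by (simp add: prod.distrib power_sum)
    finally show "(\<integral>\<^sup>+x. ennreal (\<Prod>r<b. cl (\<tau> r) x) \<partial>lborel) \<le> ennreal (2 ^ CARD('d) * w (M \<tau>))" .
  qed auto
  also have "\<dots> = ennreal (\<Sum>\<tau>\<in>P. (\<Prod>r<b. A (\<tau> r)) * (2 ^ CARD('d) * w (M \<tau>)))"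
  proof -
    have p0: "(\<Prod>r<b. A (\<tau> r)) \<ge> 0" for \<tau> by (intro prod_nonneg A0)
    have w0: "2 ^ CARD('d) * w m \<ge> 0" for m by (simp add: w_def)
    show ?thesis unfolding ennreal_mult[OF p0 w0, symmetric]
      by (rule sum_ennreal) (intro mult_nonneg_nonneg p0 w0)
  qed
  also have "\<dots> \<le> ennreal (2 ^ CARD('d) * (\<Sum>m\<in>?M. w m * real ((2 * (vsum m - n)) ^ (CARD('d) * b))))"
  proof (rule ennreal_leI)
    have "(\<Sum>\<tau>\<in>P. (\<Prod>r<b. A (\<tau> r)) * (2 ^ CARD('d) * w (M \<tau>))) = 2 ^ CARD('d)
      * (\<Sum>\<tau>\<in>P. (\<Prod>r<b. A (\<tau> r)) * w (M \<tau>))"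
      by (simp add: sum_distrib_left mult_ac)
    also have "(\<Sum>\<tau>\<in>P. (\<Prod>r<b. A (\<tau> r)) * w (M \<tau>)) \<le> (\<Sum>\<tau>\<in>P. \<Sum>m\<in>?M. w m
      * (\<Prod>r<b. A (\<tau> r) * below m (\<tau> r)))"
    proof (rule sum_mono)
      fix \<tau> assume \<tau>: "\<tau> \<in> P"
      have "(\<Prod>r<b. A (\<tau> r)) * w (M \<tau>) = w (M \<tau>) * (\<Prod>r<b. A (\<tau> r) * below (M \<tau>) (\<tau> r))"
        using below_M by (simp add: mult.commute)
      also have "\<dots> \<le> (\<Sum>m\<in>?M. w m * (\<Prod>r<b. A (\<tau> r) * below m (\<tau> r)))"
        by (rule member_le_sum[OF MM[OF \<tau>] _ finM])
          (auto simp: w_def below_def A0 intro!: mult_nonneg_nonneg prod_nonneg)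
      finally show "(\<Prod>r<b. A (\<tau> r)) * w (M \<tau>) \<le> (\<Sum>m\<in>?M. w m * (\<Prod>r<b. A (\<tau> r) * below m (\<tau> r)))" .
    qed
    also have "\<dots> = (\<Sum>m\<in>?M. w m * (\<Sum>\<tau>\<in>P. \<Prod>r<b. A (\<tau> r) * below m (\<tau> r)))"
      by (subst sum.swap) (simp add: sum_distrib_left)
    also have "\<dots> \<le> (\<Sum>m\<in>?M. w m * real ((2 * (vsum m - n)) ^ (CARD('d) * b)))"
    proof (intro sum_mono mult_left_mono)
      fix m assume "m \<in> ?M"
      have "(\<Sum>\<tau>\<in>P. \<Prod>r<b. A (\<tau> r) * below m (\<tau> r)) = (\<Prod>r<b. \<Sum>s\<in>S. A s * below m s)"
        unfolding P_def by (rule prod_sum_PiE[symmetric]) (auto simp: finS)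
      also have "\<dots> = (\<Sum>s\<in>S. A s * below m s) ^ b" by simp
      also have "\<dots> \<le> (real ((2 * (vsum m - n)) ^ CARD('d))) ^ b"
      proof (rule power_mono)
        have "(\<Sum>s\<in>S. A s * below m s) = (\<Sum>j\<in>?J. \<Sum>k\<in>faber_idx j. a j k * below m (j, k))"
          unfolding S_def A_def by (subst sum.Sigma) (auto simp:
            finite_high_levels finite_faber_idx case_prod_beta)
        also have "\<dots> = (\<Sum>j\<in>?J. (if \<forall>i. nat \<bar>j $ i\<bar> \<le> m $ i then (\<Sum>k\<in>faber_idx j. a j k) else 0))"
          by (intro sum.cong refl) (auto simp: below_def)
        \<comment> \<open>The coefficients of one level contribute at most 1 in total, so it remains
          to count the levels below m.\<close>
        also have "\<dots> \<le> (\<Sum>j\<in>?J. (if \<forall>i. nat \<bar>j $ i\<bar> \<le> m $ i then 1 else 0))"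
          using a1 by (intro sum_mono) auto
        also have "\<dots> = real (card {j\<in>?J. \<forall>i. nat \<bar>j $ i\<bar> \<le> m $ i})"
          by (simp add: sum.If_cases finite_high_levels Int_def)
        also have "\<dots> \<le> real ((2 * (vsum m - n)) ^ CARD('d))"
          by (intro of_nat_mono card_high_levels_below)
        finally show "(\<Sum>s\<in>S. A s * below m s) \<le> real ((2 * (vsum m - n)) ^ CARD('d))" .
      qed (auto intro!: sum_nonneg mult_nonneg_nonneg simp: A0 below_def)
      also have "\<dots> = real ((2 * (vsum m - n)) ^ (CARD('d) * b))"
        by (simp add: power_mult)
      finally show "(\<Sum>\<tau>\<in>P. \<Prod>r<b. A (\<tau> r) * below m (\<tau> r))
        \<le> real ((2 * (vsum m - n)) ^ (CARD('d) * b))" .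
    qed (simp add: w_def)
    finally show "(\<Sum>\<tau>\<in>P. (\<Prod>r<b. A (\<tau> r)) * (2 ^ CARD('d) * w (M \<tau>))) \<le> 2 ^ CARD('d)
      * (\<Sum>m\<in>?M. w m * real ((2 * (vsum m - n)) ^ (CARD('d) * b)))"
      by simp
  qed
  finally show ?thesis unfolding w_def .
qed

section \<open>Error estimates\<close>

text \<open>The comparison of x^q with x + x^b is not homogeneous, so it is applied to coefficients
  normalised to 1 on each level. The scaling by B takes place in
  \<open>faber_trunc_error\<close>.\<close>

lemma cell_sum_Lq:
  assumes q: "1 \<le> q"
  shows "\<exists>C>0. \<forall>n\<ge>1. \<forall>L\<ge>1. \<forall>a :: int^'d \<Rightarrow> nat^'d \<Rightarrow> real. (\<forall>j k. 0 \<le> a j k) \<longrightarrow>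
    (\<forall>j\<in>high_levels n L. (\<Sum>k\<in>faber_idx j. a j k) \<le> 1) \<longrightarrow>
    (\<integral>\<^sup>+x. ennreal ((\<Sum>j\<in>high_levels n L. \<Sum>k\<in>faber_idx j. a j k * cell j k x) powr q) \<partial>lborel)
      \<le> ennreal (C * (1/2) ^ n * real n ^ (CARD('d) - 1))"
proof -
  define b where "b = nat \<lceil>q\<rceil>"
  have b: "b \<noteq> 0" "q \<le> real b" using q by (auto simp: b_def)
  have W: "\<exists>C>0. \<forall>n\<ge>1. \<forall>L. (\<Sum>m::nat^'d\<in>high_box n L.
      (1/2) ^ vsum m * real ((2 * (vsum m - n)) ^ (CARD('d) * e))) \<le> C * (1/2) ^ n
        * real n ^ (CARD('d) - 1)" for e
    by (rule weighted_lattice_sum)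
  from W[of b] obtain C1 where C1: "C1 > 0" "\<And>n L. n \<ge> 1 \<Longrightarrow> (\<Sum>m::nat^'d\<in>high_box n L.
      (1/2) ^ vsum m * real ((2 * (vsum m - n)) ^ (CARD('d) * b))) \<le> C1 * (1/2) ^ n
        * real n ^ (CARD('d) - 1)"
    by (elim exE conjE) (rule that, auto)
  from W[of 1] obtain C2 where C2: "C2 > 0" "\<And>n L. n \<ge> 1 \<Longrightarrow> (\<Sum>m::nat^'d\<in>high_box n L.
      (1/2) ^ vsum m * real ((2 * (vsum m - n)) ^ (CARD('d) * 1))) \<le> C2 * (1/2) ^ n
        * real n ^ (CARD('d) - 1)"
    by (elim exE conjE) (rule that, auto)
  show ?thesis
  proof (intro exI[of _ "2 ^ CARD('d) * (C1 + C2)"] conjI allI impI)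
    show "0 < 2 ^ CARD('d) * (C1 + C2)" using C1 C2 by simp
    fix n L :: nat and a :: "int^'d \<Rightarrow> nat^'d \<Rightarrow> real"
    assume n: "1 \<le> n" and L: "1 \<le> L" and a0: "\<forall>j k. 0 \<le> a j k" and a1: "\<forall>j\<in>high_levels n L.
      (\<Sum>k\<in>faber_idx j. a j k) \<le> 1"
    define F where "F x = (\<Sum>j\<in>high_levels n L. \<Sum>k\<in>faber_idx j. a j k * cell j k x)" for x
    define K where "K = (1/2 :: real) ^ n * real n ^ (CARD('d) - 1)"
    have K: "K \<ge> 0" by (simp add: K_def)
    have F0: "F x \<ge> 0" for x unfolding F_def using a0
      by (intro sum_nonneg mult_nonneg_nonneg cell_nonneg) auto
    have [measurable]: "F \<in> borel_measurable borel" unfolding F_def[abs_def] by measurable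
    have pw: "x powr q \<le> x + x ^ b" if x: "0 \<le> x" for x :: real
    proof (cases "x \<le> 1")
      case True
      have "x powr q \<le> x powr 1" using q x True by (intro powr_mono') auto
      then show ?thesis using x by (simp add: add_increasing2)
    next
      case False
      have "x powr q \<le> x powr real b" using b False by (intro powr_mono) auto
      then show ?thesis using x False by (simp add: powr_realpow)
    qed
    have I: "(\<integral>\<^sup>+x. ennreal (F x ^ e) \<partial>lborel) \<le> ennreal (2 ^ CARD('d) * (c * K))"
      if "e \<noteq> 0" and c: "(\<Sum>m::nat^'d\<in>high_box n L.
      (1/2) ^ vsum m * real ((2 * (vsum m - n)) ^ (CARD('d) * e))) \<le> c * (1/2) ^ n
        * real n ^ (CARD('d) - 1)" for e c
    proof -
      have "(\<integral>\<^sup>+x. ennreal (F x ^ e) \<partial>lborel) \<le> ennreal (2 ^ CARD('d) * (\<Sum>m::nat^'d\<in>high_box n L.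
      (1/2) ^ vsum m * real ((2 * (vsum m - n)) ^ (CARD('d) * e))))"
        unfolding F_def by (rule power_of_cell_sum) (use a0 a1 L \<open>e \<noteq> 0\<close> in auto)
      also have "\<dots> \<le> ennreal (2 ^ CARD('d) * (c * K))"
        using c by (intro ennreal_leI mult_left_mono) (auto simp: K_def mult.assoc)
      finally show ?thesis .
    qed
    have "(\<integral>\<^sup>+x. ennreal (F x powr q) \<partial>lborel) \<le> (\<integral>\<^sup>+x. ennreal (F x ^ 1)
      + ennreal (F x ^ b) \<partial>lborel)"
    proof (rule nn_integral_mono)
      fix x
      have "ennreal (F x powr q) \<le> ennreal (F x ^ 1 + F x ^ b)" using pw[OF F0]
        by (intro ennreal_leI) simp
      also have "\<dots> = ennreal (F x ^ 1) + ennreal (F x ^ b)" using F0 by (intro ennreal_plus) auto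
      finally show "ennreal (F x powr q) \<le> ennreal (F x ^ 1) + ennreal (F x ^ b)" .
    qed
    also have "\<dots> = (\<integral>\<^sup>+x. ennreal (F x ^ 1) \<partial>lborel) + (\<integral>\<^sup>+x. ennreal (F x ^ b) \<partial>lborel)"
      by (rule nn_integral_add) measurable
    also have "\<dots> \<le> ennreal (2 ^ CARD('d) * (C2 * K)) + ennreal (2 ^ CARD('d) * (C1 * K))"
      by (intro add_mono I C1(2) C2(2) n b) simp
    also have "\<dots> = ennreal (2 ^ CARD('d) * (C1 + C2) * (1/2) ^ n * real n ^ (CARD('d) - 1))"
      using C1 C2 K by (subst ennreal_plus[symmetric]) (auto simp: K_def algebra_simps)
    finally show "(\<integral>\<^sup>+x. ennreal ((\<Sum>j\<in>high_levels n L. \<Sum>k\<in>faber_idx j. a j k * cell j k x) powr q)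
      \<partial>lborel)
      \<le> ennreal (2 ^ CARD('d) * (C1 + C2) * (1/2) ^ n * real n ^ (CARD('d) - 1))"
      unfolding F_def .
  qed
qed

text \<open>A level of order at most n has all components at most n, hence at most L. The successor
  appears because \<open>level_box\<close> stops one below its argument.\<close>

lemma levels_split:
  assumes "n \<le> L"
  shows "(level_box (Suc L) :: (int^'d) set) = faber_levels n \<union> high_levels n L"
    and "faber_levels n \<inter> (high_levels n L :: (int^'d) set) = {}"
proof -
  have "j $ i \<le> int L" if "j \<in> faber_levels n" for j :: "int^'d" and i
  proof -
    have "\<bar>j $ i\<bar> \<le> (\<Sum>i\<in>UNIV. \<bar>j $ i\<bar>)" by (rule member_le_sum) auto
    also have "\<dots> \<le> int n" using that by (simp add: faber_levels_def)
    finally show ?thesis using assms by simp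
  qed
  then show "(level_box (Suc L) :: (int^'d) set) = faber_levels n \<union> high_levels n L"
    by (auto simp: faber_levels_def high_levels_def)
  show "faber_levels n \<inter> (high_levels n L :: (int^'d) set) = {}"
    by (auto simp: faber_levels_def high_levels_def)
qed

text \<open>On the cube f is the pointwise limit of its interpolants, so the error is the limit of
  the finite sums over \<open>high_levels n L\<close>. Their q-th powers have integrals bounded
  uniformly in L, and Fatou's lemma passes the bound to the limit.\<close>

lemma faber_trunc_error:
  assumes q: "1 \<le> q"
  shows "\<exists>C>0. \<forall>n\<ge>1. \<forall>f :: real^'d \<Rightarrow> complex. \<forall>B\<ge>0. continuous_on unit_cube f \<longrightarrow>
    (\<forall>j::int^'d. (\<forall>i. -1 \<le> j $ i) \<longrightarrow> (\<Sum>k\<in>faber_idx j. norm (faber_coeff j k f)) \<le> B) \<longrightarrow>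
    Lq_norm_cube q (\<lambda>x. f x - faber_trunc n f x) \<le> (C * (1/2) ^ n * real n ^ (CARD('d) - 1)) powr
      (1 / q) * B"
proof -
  obtain C where C: "C > 0" "\<And>n L (a :: int^'d \<Rightarrow> nat^'d \<Rightarrow> real). n \<ge> 1 \<Longrightarrow> L \<ge> 1 \<Longrightarrow> (\<forall>j k. 0 \<le> a j k) \<Longrightarrow>
    (\<forall>j\<in>high_levels n L. (\<Sum>k\<in>faber_idx j. a j k) \<le> 1) \<Longrightarrow>
    (\<integral>\<^sup>+x. ennreal ((\<Sum>j\<in>high_levels n L. \<Sum>k\<in>faber_idx j. a j k * cell j k x) powr q) \<partial>lborel)
      \<le> ennreal (C * (1/2) ^ n * real n ^ (CARD('d) - 1))"
    using cell_sum_Lq[OF q, where 'd='d] by (elim exE conjE) (rule that, auto)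
  show ?thesis
  proof (intro exI[of _ C] conjI allI impI C(1))
    fix n :: nat and f :: "real^'d \<Rightarrow> complex" and B0 :: real
    assume n: "1 \<le> n" and B0: "B0 \<ge> 0" and f: "continuous_on unit_cube f"
      and cb: "\<forall>j::int^'d. (\<forall>i. -1 \<le> j $ i) \<longrightarrow> (\<Sum>k\<in>faber_idx j. norm (faber_coeff j k f)) \<le> B0"
    define K where "K = C * (1/2) ^ n * real n ^ (CARD('d) - 1)"
    have K: "K > 0" using C n by (simp add: K_def)
    \<comment> \<open>The normalisation divides by B, so B > 0 comes first. The value B0, possibly
      0, is reached at the end by letting B decrease to it.\<close>
    have pos: "Lq_norm_cube q (\<lambda>x. f x - faber_trunc n f x) \<le> K powr (1 / q) * B"
      if B: "B > 0" "B0 \<le> B" for B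
    proof -
      define a where "a j k = norm (faber_coeff j k f) / B" for j k
      have a0: "0 \<le> a j k" for j k using B by (simp add: a_def)
      have a1: "(\<Sum>k\<in>faber_idx j. a j k) \<le> 1" if "j \<in> high_levels n L" for j L
      proof -
        have "(\<Sum>k\<in>faber_idx j. norm (faber_coeff j k f)) \<le> B"
          using cb that B by (force simp: high_levels_def)
        then show ?thesis unfolding a_def using B by (simp flip: sum_divide_distrib)
      qed
      define F where "F L x = (\<Sum>j\<in>high_levels n L. \<Sum>k\<in>faber_idx j. a j k * cell j k x)" for L x
      have F0: "F L x \<ge> 0" for L x unfolding F_def by (intro sum_nonneg mult_nonneg_nonneg
        cell_nonneg a0)
      have [measurable]: "F L \<in> borel_measurable borel" for L unfolding F_def[abs_def] by measurable
      define h where "h x = f x - faber_trunc n f x" for x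
      have pt: "ennreal (indicator unit_cube x * norm (h x) powr q)
        \<le> liminf (\<lambda>L. ennreal ((B * F L x) powr q))" for x
      proof (cases "x \<in> unit_cube")
        case True
        define e where "e L = (\<Sum>j\<in>high_levels n L. \<Sum>k\<in>faber_idx j. faber_coeff j k f
          * of_real (faber j k x))" for L
        have e_le: "norm (e L) \<le> B * F L x" for L
        proof -
          have "norm (e L) \<le> (\<Sum>j\<in>high_levels n L. \<Sum>k\<in>faber_idx j. norm (faber_coeff j k f)
            * cell j k x)"
            unfolding e_def
            by (intro sum_norm_le) (auto simp: norm_mult intro!:
              mult_left_mono faber_le_cell[OF True])
          also have "\<dots> = B * F L x"
            unfolding F_def a_def sum_distrib_left using B by (intro sum.cong refl) simp
          finally show ?thesis .
        qed
        have E: "(\<lambda>L. \<Sum>j\<in>level_box (Suc L). \<Sum>k\<in>faber_idx j. faber_coeff j k f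
          * of_real (faber j k x)) \<longlonglongrightarrow> f x"
          unfolding interpolation[OF True] by (rule LIMSEQ_Suc[OF interpolation_tendsto[OF f True]])
        have split: "(\<Sum>j\<in>level_box (Suc L). \<Sum>k\<in>faber_idx j. faber_coeff j k f
          * of_real (faber j k x)) - faber_trunc n f x = e L"
          if "n \<le> L" for L
          unfolding levels_split(1)[OF that] e_def faber_trunc_def
          by (subst sum.union_disjoint) (auto simp: finite_faber_levels finite_high_levels
            levels_split(2)[OF that])
        have "e \<longlonglongrightarrow> h x"
        proof (rule Lim_transform_eventually)
          show "(\<lambda>L. (\<Sum>j\<in>level_box (Suc L). \<Sum>k\<in>faber_idx j. faber_coeff j k f
            * of_real (faber j k x)) - faber_trunc n f x) \<longlonglongrightarrow> h x"
            unfolding h_def by (intro tendsto_diff E tendsto_const)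
          show "\<forall>\<^sub>F L in sequentially. (\<Sum>j\<in>level_box (Suc L). \<Sum>k\<in>faber_idx j. faber_coeff j k f
            * of_real (faber j k x)) - faber_trunc n f x = e L"
            using eventually_ge_at_top[of n] by eventually_elim (rule split)
        qed
        then have "(\<lambda>L. norm (e L) powr q) \<longlonglongrightarrow> norm (h x) powr q"
          using q by (intro tendsto_powr' tendsto_norm tendsto_const) auto
        then have "(\<lambda>L. ennreal (norm (e L) powr q)) \<longlonglongrightarrow> ennreal (norm (h x) powr q)"
          by (rule tendsto_ennrealI)
        then have "ennreal (norm (h x) powr q) = liminf (\<lambda>L. ennreal (norm (e L) powr q))"
          by (intro lim_imp_Liminf[symmetric]) auto
        also have "\<dots> \<le> liminf (\<lambda>L. ennreal ((B * F L x) powr q))"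
          using e_le q by (intro Liminf_mono always_eventually allI ennreal_leI powr_mono2) auto
        finally show ?thesis using True by simp
      qed simp
      define r where "r = B powr q * K"
      have r: "r \<ge> 0" using K by (simp add: r_def)
      have "(\<integral>\<^sup>+x. ennreal (indicator unit_cube x * norm (h x) powr q) \<partial>lebesgue)
        = (\<integral>\<^sup>+x. ennreal (indicator unit_cube x * norm (h x) powr q) \<partial>lborel)"
        by (rule nn_integral_completion)
      also have "\<dots> \<le> (\<integral>\<^sup>+x. liminf (\<lambda>L. ennreal ((B * F L x) powr q)) \<partial>lborel)"
        by (rule nn_integral_mono) (rule pt)
      also have "\<dots> \<le> liminf (\<lambda>L. \<integral>\<^sup>+x. ennreal ((B * F L x) powr q) \<partial>lborel)"
        by (rule nn_integral_liminf) measurable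
      also have "\<dots> \<le> liminf (\<lambda>L::nat. ennreal r)"
      proof (rule Liminf_mono)
        show "\<forall>\<^sub>F L in sequentially. (\<integral>\<^sup>+x. ennreal ((B * F L x) powr q) \<partial>lborel) \<le> ennreal r"
          using eventually_ge_at_top[of 1]
        proof eventually_elim
          case (elim L)
          have "(\<integral>\<^sup>+x. ennreal ((B * F L x) powr q) \<partial>lborel)
            = (\<integral>\<^sup>+x. ennreal (B powr q) * ennreal (F L x powr q) \<partial>lborel)"
            using B F0 by (intro nn_integral_cong) (simp add: powr_mult ennreal_mult)
          also have "\<dots> = ennreal (B powr q) * (\<integral>\<^sup>+x. ennreal (F L x powr q) \<partial>lborel)"
            by (rule nn_integral_cmult) measurable
          also have "\<dots> \<le> ennreal (B powr q) * ennreal K"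
            unfolding F_def K_def using C(2)[OF n elim] a0 a1 by (intro mult_left_mono) auto
          also have "\<dots> = ennreal r" using K by (simp add: r_def ennreal_mult)
          finally show ?case .
        qed
      qed
      also have "\<dots> = ennreal r" by (rule Liminf_const) simp
      finally have "(LINT x|lebesgue. indicator unit_cube x * norm (h x) powr q) \<le> r"
        using r by (intro integral_real_bounded) auto
      then have "(LINT x:unit_cube|lebesgue. norm (h x) powr q) \<le> r"
        by (simp add: set_lebesgue_integral_def)
      moreover have "0 \<le> (LINT x:unit_cube|lebesgue. norm (h x) powr q)"
        unfolding set_lebesgue_integral_def by (intro Bochner_Integration.integral_nonneg) auto
      ultimately have "Lq_norm_cube q h \<le> r powr (1 / q)"
        unfolding Lq_norm_cube_def using q by (intro powr_mono2) auto
      also have "\<dots> = K powr (1 / q) * B"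
        unfolding r_def using q B K by (simp add: powr_mult powr_powr)
      finally show ?thesis unfolding h_def .
    qed
    have K': "K powr (1 / q) > 0" using K by simp
    have "Lq_norm_cube q (\<lambda>x. f x - faber_trunc n f x) \<le> K powr (1 / q) * B0 + e" if e: "e > 0"
      for e
    proof -
      have "Lq_norm_cube q (\<lambda>x. f x - faber_trunc n f x) \<le> K powr (1 / q)
        * (B0 + e / K powr (1 / q))"
        by (rule pos) (use B0 e K' in \<open>auto simp: add_nonneg_pos\<close>)
      also have "\<dots> = K powr (1 / q) * B0 + e" using K' by (simp add: distrib_left)
      finally show ?thesis .
    qed
    then have "Lq_norm_cube q (\<lambda>x. f x - faber_trunc n f x) \<le> K powr (1 / q) * B0"
      by (rule field_le_epsilon)
    then show "Lq_norm_cube q (\<lambda>x. f x - faber_trunc n f x)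
      \<le> (C * (1/2) ^ n * real n ^ (CARD('d) - 1)) powr (1 / q) * B0"
      unfolding K_def .
  qed
qed

text \<open>Every extension g gives the bound with its own norm. Dividing by K, which is positive
  and finite, makes the left-hand side a lower bound for the infimum over the extensions.\<close>

lemma (in dyadic) faber_trunc_error_SF:
  assumes q: "1 \<le> q"
  shows "\<exists>C>0. \<forall>n\<ge>1. \<forall>f :: real^'d \<Rightarrow> complex. f \<in> SF_cube \<phi> \<longrightarrow>
    ennreal (Lq_norm_cube q (\<lambda>x. f x - faber_trunc n f x)) \<le>
      ennreal (C * 2 powr (- real n / q) * real n powr ((real CARD('d) - 1) / q))
        * SF_cube_norm \<phi> f"
proof -
  obtain A where A: "A > 0" "\<And>(f :: real^'d \<Rightarrow> complex) g (j::int^'d). continuous_on unit_cube f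
    \<Longrightarrow> g \<in> SF_extensions \<phi> f \<Longrightarrow> (\<forall>i. -1 \<le> j $ i) \<Longrightarrow>
    (\<Sum>k\<in>faber_idx j. norm (\<Sum>\<sigma>\<in>nat_box 2. stencil_prod j \<sigma> *
          f (\<chi> i. stencil_node (j $ i) (k $ i) (\<sigma> $ i)))) \<le> A * enn2real (SF_norm \<phi> g)"
    using faber_stencil_bound[where 'd='d] by (elim exE conjE) (rule that, auto)
  obtain C where C: "C > 0" "\<And>n (f :: real^'d \<Rightarrow> complex) B. n \<ge> 1 \<Longrightarrow> B \<ge> 0
    \<Longrightarrow> continuous_on unit_cube f \<Longrightarrow>
    (\<forall>j::int^'d. (\<forall>i. -1 \<le> j $ i) \<longrightarrow> (\<Sum>k\<in>faber_idx j. norm (faber_coeff j k f)) \<le> B) \<Longrightarrow>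
    Lq_norm_cube q (\<lambda>x. f x - faber_trunc n f x) \<le> (C * (1/2) ^ n * real n ^ (CARD('d) - 1)) powr
      (1 / q) * B"
    using faber_trunc_error[OF q, where 'd='d] by (elim exE conjE) (rule that, auto)
  show ?thesis
  proof (intro exI[of _ "C powr (1 / q) * A"] conjI allI impI)
    show "0 < C powr (1 / q) * A" using A C by simp
    fix n :: nat and f :: "real^'d \<Rightarrow> complex"
    assume n: "1 \<le> n" and fS: "f \<in> SF_cube \<phi>"
    have f: "continuous_on unit_cube f" using fS by (auto simp: SF_cube_def)
    define K where "K = C powr (1 / q) * A * 2 powr (- real n / q)
      * real n powr ((real CARD('d) - 1) / q)"
    have K: "K > 0" using A C n by (simp add: K_def)
    have K_eq: "(C * (1/2) ^ n * real n ^ (CARD('d) - 1)) powr (1 / q) * A = K"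
    proof -
      have "(1/2 :: real) ^ n = 2 powr (- real n)" by (simp add: powr_minus powr_realpow
        power_one_over inverse_eq_divide)
      moreover have "real n ^ (CARD('d) - 1) = real n powr (real CARD('d) - 1)"
        using n by (subst powr_realpow[symmetric]) (auto simp: of_nat_diff Suc_leI)
      ultimately show ?thesis
        using C n by (simp add: powr_mult powr_powr K_def)
    qed
    have le: "ennreal (Lq_norm_cube q (\<lambda>x. f x - faber_trunc n f x)) \<le> ennreal K * SF_norm \<phi> g"
      if g: "g \<in> SF_extensions \<phi> f" for g
    proof -
      have fin: "SF_norm \<phi> g < \<infinity>" using g by (auto simp: SF_extensions_def SF_space_def)
      have "Lq_norm_cube q (\<lambda>x. f x - faber_trunc n f x) \<le> (C * (1/2) ^ n * real n ^ (CARD('d) - 1))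
        powr (1 / q) * (A * enn2real (SF_norm \<phi> g))"
      proof (rule C(2)[OF n _ f])
        show "0 \<le> A * enn2real (SF_norm \<phi> g)" using A by simp
        show "\<forall>j::int^'d. (\<forall>i. -1 \<le> j $ i) \<longrightarrow> (\<Sum>k\<in>faber_idx j. norm (faber_coeff j k f)) \<le> A
          * enn2real (SF_norm \<phi> g)"
          using A(2)[OF f g] by (auto simp: faber_coeff_stencil)
      qed
      also have "\<dots> = K * enn2real (SF_norm \<phi> g)" by (simp add: K_eq[symmetric])
      finally have "ennreal (Lq_norm_cube q (\<lambda>x. f x - faber_trunc n f x))
        \<le> ennreal (K * enn2real (SF_norm \<phi> g))"
        by (rule ennreal_leI)
      also have "\<dots> = ennreal K * SF_norm \<phi> g" using fin K by (simp add: ennreal_mult)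
      finally show ?thesis .
    qed
    have "ennreal (Lq_norm_cube q (\<lambda>x. f x - faber_trunc n f x)) / ennreal K \<le> SF_cube_norm \<phi> f"
      unfolding SF_cube_norm_def
    proof (rule INF_greatest)
      fix g assume "g \<in> SF_extensions \<phi> f"
      from le[OF this] show "ennreal (Lq_norm_cube q (\<lambda>x. f x - faber_trunc n f x)) / ennreal K
        \<le> SF_norm \<phi> g"
        using K by (intro divide_le_posI_ennreal) auto
    qed
    then have "ennreal K * (ennreal (Lq_norm_cube q (\<lambda>x. f x - faber_trunc n f x)) / ennreal K)
      \<le> ennreal K * SF_cube_norm \<phi> f"
      by (rule mult_left_mono) simp
    moreover have "ennreal K * (ennreal (Lq_norm_cube q (\<lambda>x. f x - faber_trunc n f x)) / ennreal K)
      = ennreal (Lq_norm_cube q (\<lambda>x. f x - faber_trunc n f x))"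
      unfolding ennreal_times_divide mult.commute[of "ennreal K"]
      by (rule mult_divide_eq_ennreal) (use K in auto)
    ultimately show "ennreal (Lq_norm_cube q (\<lambda>x. f x - faber_trunc n f x))
      \<le> ennreal (C powr (1 / q) * A * 2 powr (- real n / q) * real n powr ((real CARD('d) - 1) / q))
      * SF_cube_norm \<phi> f"
      unfolding K_def by simp
  qed
qed

text \<open>The quotient of the power by the exponential tends to 0 and is therefore
  bounded.\<close>

lemma polynomial_le_exponential:
  assumes e: "\<epsilon> > 0"
  shows "\<exists>C>0. \<forall>n\<ge>1. real n powr real p \<le> C * 2 powr (\<epsilon> * real n)"
proof -
  define c where "c = \<epsilon> * ln 2"
  have c: "c > 0" using e by (simp add: c_def)
  have t: "filterlim (\<lambda>n. c * real n) at_top sequentially"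
    using c by (intro filterlim_tendsto_pos_mult_at_top[OF tendsto_const]
      filterlim_real_sequentially) auto
  have "(\<lambda>n. (c * real n) ^ p / exp (c * real n)) \<longlonglongrightarrow> 0"
    by (rule filterlim_compose[OF tendsto_power_div_exp_0 t])
  then have "Bseq (\<lambda>n. (c * real n) ^ p / exp (c * real n))"
    by (rule convergent_imp_Bseq[OF convergentI])
  then obtain M where M: "M > 0" "\<And>n. norm ((c * real n) ^ p / exp (c * real n)) \<le> M"
    by (auto simp: Bseq_def)
  show ?thesis
  proof (intro exI[of _ "M / c ^ p"] conjI allI impI)
    show "M / c ^ p > 0" using M c by simp
    fix n :: nat assume n: "1 \<le> n"
    have "(c * real n) ^ p \<le> M * exp (c * real n)"
      using M(2)[of n] c by (simp add: field_simps abs_mult power_abs)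
    then have "real n ^ p \<le> M / c ^ p * exp (c * real n)"
      using c by (simp add: power_mult_distrib field_simps)
    moreover have "exp (c * real n) = 2 powr (\<epsilon> * real n)" by (simp add: powr_def c_def mult_ac)
    ultimately show "real n powr real p \<le> M / c ^ p * 2 powr (\<epsilon> * real n)"
      using n by (simp add: powr_realpow)
  qed
qed

theorem theorem6p3:
  fixes \<phi> :: "nat \<Rightarrow> real \<Rightarrow> complex"
  assumes "dyadic_system \<phi>"
  shows "(\<forall>\<epsilon>::real. \<epsilon> > 0 \<longrightarrow>
            (\<exists>C::real. C > 0 \<and>
              (\<forall>n::nat. n \<ge> 1 \<longrightarrow>
                (\<forall>f :: real^'d \<Rightarrow> complex. f \<in> SF_cube \<phi> \<longrightarrow>
                  ennreal (Lq_norm_cube 1 (\<lambda>x. f x - faber_trunc n f x))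
                    \<le> ennreal (C * 2 powr (- real n * (1 - \<epsilon>))) * SF_cube_norm \<phi> f)))) \<and>
         (\<forall>q::real. 1 < q \<longrightarrow>
            (\<exists>C::real. C > 0 \<and>
              (\<forall>n::nat. n \<ge> 1 \<longrightarrow>
                (\<forall>f :: real^'d \<Rightarrow> complex. f \<in> SF_cube \<phi> \<longrightarrow>
                  ennreal (Lq_norm_cube q (\<lambda>x. f x - faber_trunc n f x))
                    \<le> ennreal (C * 2 powr (- real n / q)
                                 * real n powr ((real CARD('d) - 1) / q))
                      * SF_cube_norm \<phi> f))))"
proof -
  interpret dyadic \<phi> by (rule dyadic.intro) fact
  show ?thesis
  proof (intro conjI allI impI)
    fix \<epsilon> :: real assume e: "\<epsilon> > 0"
    \<comment> \<open>For q = 1 the same estimate gives 2^-n n^(d-1), and absorbing the polynomial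
      factor is what costs the \<epsilon>.\<close>
    obtain C where C: "C > 0" "\<And>n (f :: real^'d \<Rightarrow> complex). n \<ge> 1 \<Longrightarrow> f \<in> SF_cube \<phi> \<Longrightarrow>
      ennreal (Lq_norm_cube 1 (\<lambda>x. f x - faber_trunc n f x)) \<le>
      ennreal (C * 2 powr (- real n / 1) * real n powr ((real CARD('d) - 1) / 1))
        * SF_cube_norm \<phi> f"
      using faber_trunc_error_SF[OF order_refl, where 'd='d] by (elim exE conjE) (rule that, auto)
    obtain P where P: "P > 0" "\<And>n. n \<ge> 1 \<Longrightarrow> real n powr real (CARD('d) - 1) \<le> P
      * 2 powr (\<epsilon> * real n)"
      using polynomial_le_exponential[OF e, of "CARD('d) - 1"] by blast
    show "\<exists>C::real. C > 0 \<and> (\<forall>n::nat. n \<ge> 1 \<longrightarrow> (\<forall>f :: real^'d \<Rightarrow> complex. f \<in> SF_cube \<phi> \<longrightarrow>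
        ennreal (Lq_norm_cube 1 (\<lambda>x. f x - faber_trunc n f x))
          \<le> ennreal (C * 2 powr (- real n * (1 - \<epsilon>))) * SF_cube_norm \<phi> f))"
    proof (intro exI[of _ "C * P"] conjI allI impI)
      show "C * P > 0" using C P by simp
      fix n :: nat and f :: "real^'d \<Rightarrow> complex" assume n: "n \<ge> 1" and f: "f \<in> SF_cube \<phi>"
      have "real (CARD('d) - 1) = real CARD('d) - 1" by (simp add: of_nat_diff Suc_leI)
      then have "real n powr (real CARD('d) - 1) \<le> P * 2 powr (\<epsilon> * real n)" using P(2)[OF n] by simp
      then have "C * 2 powr (- real n) * real n powr (real CARD('d) - 1) \<le> C * 2 powr (- real n)
        * (P * 2 powr (\<epsilon> * real n))"
        using C by (intro mult_left_mono) auto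
      also have "\<dots> = C * P * 2 powr (- real n * (1 - \<epsilon>))"
        by (simp add: powr_add[symmetric] algebra_simps flip: powr_add)
      finally have "ennreal (C * 2 powr (- real n / 1) * real n powr ((real CARD('d) - 1) / 1))
        * SF_cube_norm \<phi> f \<le> ennreal (C * P * 2 powr (- real n * (1 - \<epsilon>))) * SF_cube_norm \<phi> f"
        by (intro mult_right_mono ennreal_leI) auto
      with C(2)[OF n f] show "ennreal (Lq_norm_cube 1 (\<lambda>x. f x - faber_trunc n f x))
        \<le> ennreal (C * P * 2 powr (- real n * (1 - \<epsilon>))) * SF_cube_norm \<phi> f"
        by (rule order_trans)
    qed
  next
    fix q :: real assume "1 < q"
    then show "\<exists>C::real. C > 0 \<and> (\<forall>n::nat. n \<ge> 1 \<longrightarrow> (\<forall>f :: real^'d \<Rightarrow> complex. f \<in> SF_cube \<phi> \<longrightarrow>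
        ennreal (Lq_norm_cube q (\<lambda>x. f x - faber_trunc n f x)) \<le> ennreal (C * 2 powr (- real n / q)
          * real n powr ((real CARD('d) - 1) / q)) * SF_cube_norm \<phi> f))"
      using faber_trunc_error_SF[of q, where 'd='d] by simp
  qed
qed

end
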